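(* Let $(\Omega,\mathcal F,P)$ be a probability space, let $S$ be a $\mathcal T_{\varepsilon,\lambda}$-complete random normed module over $K$ ($K=\mathbb R$ or $\mathbb C$) with base $(\Omega,\mathcal F,P)$, and let $C\in B(S)$ be injective. Let $\{W(s):s\ge0\}$ be a $C$-semigroup on $S$ with $\|W(s)\|\le Me^{\xi s}$ for all $s\ge0$, where $M\in L^0_+(\mathcal F)$ and $\xi\in L^0(\mathcal F,\mathbb R)$, and let $(A,D(A))$ be its infinitesimal generator. Let $\eta\in G_\xi$ and let $R(R_C(\eta,A))$ denote the range of the random $C$-resolvent $R_C(\eta,A)$. Then, under the locally $L^0$-Lipschitz condition on the solution, the abstract Cauchy problem $$\frac{du(t)}{dt}=Au(t)\quad\forall t>0,\qquad u(0)=u_0\in R(R_C(\eta,A)),$$ has a unique solution $u(t):=W(t)C^{-1}u_0$ belonging to $C([0,\infty),[D(A)])\cap C^1([0,\infty),S)$.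
   Context: $L^0(\mathcal F,K)$ is the algebra of ($P$-a.s.) equivalence classes of $K$-valued $\mathcal F$-measurable random variables on $\Omega$. For $f,g\in L^0(\mathcal F,\mathbb R)$, $f\le g$ means a.s. inequality and "$f>g$ on $\Omega$" means $f(\omega)>g(\omega)$ for almost all $\omega$. $L^0_+(\mathcal F)=\{\xi\in L^0(\mathcal F,\mathbb R):\xi\ge 0\}$ and $G_\xi=\{\eta\in L^0(\mathcal F,\mathbb R):\eta>\xi\text{ on }\Omega\}$. A random normed module over $K$ with base $(\Omega,\mathcal F,P)$ is a left $L^0(\mathcal F,K)$-module $S$ with a map $\|\cdot\|:S\to L^0_+(\mathcal F)$ (the $L^0$-norm) such that $\|x\|=0\Rightarrow x=\theta$ (the zero of $S$), $\|\zeta x\|=|\zeta|\,\|x\|$ and $\|x+y\|\le\|x\|+\|y\|$ for $\zeta\in L^0(\mathcal F,K)$, $x,y\in S$. The $(\varepsilon,\lambda)$-topology $\mathcal T_{\varepsilon,\lambda}$ on $S$ is the metrizable linear topology with local base at $\theta$ the sets $\{z: P(\|z\|<\varepsilon)>1-\lambda\}$, $\varepsilon>0$, $0<\lambda<1$; thus $z_n\to z$ iff $\|z_n-z\|\to0$ in probability. All limits, continuity and derivatives in $t$ are with respect to $\mathcal T_{\varepsilon,\lambda}$. $B(S)$ is the set of almost surely bounded linear operators $T:S\to S$, i.e. those for which there is $\eta\in L^0_+(\mathcal F)$ with $\|Tz\|\le\eta\|z\|$ for all $z\in S$ (equivalently, continuous $L^0(\mathcal F,K)$-module homomorphisms); $\|T\|$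 is the infimum (in the a.s. order) of all such $\eta$. $R(T)$ denotes the range of $T$. A $C$-semigroup on $S$ ($C\in B(S)$ injective) is a family $\{W(t):t\ge0\}\subset B(S)$ with $W(0)=C$, $CW(s+t)=W(t)W(s)$ for all $s,t\ge0$, and $s\mapsto W(s)x$ continuous from $[0,\infty)$ to $(S,\mathcal T_{\varepsilon,\lambda})$ for each $x\in S$. Its infinitesimal generator $(A,D(A))$ is given by $D(A)=\{x\in S:\lim_{s\to0}\frac{W(s)x-Cx}{s}\text{ exists and belongs to }R(C)\}$ and $Ax=C^{-1}\lim_{s\to0}\frac{W(s)x-Cx}{s}$. $\rho_C(A)=\{\eta\in L^0(\mathcal F,K):\eta-A:D(A)\to S\text{ is injective and }R(C)\subseteq R(\eta-A)\}$, and for $\eta\in\rho_C(A)$ the random $C$-resolvent is $R_C(\eta,A)=(\eta-A)^{-1}C$. (Under the hypotheses of the claim, $G_\xi\subseteq\rho_C(A)$.) $[D(A)]$ is the random normed module $D(A)$ with the graph $L^0$-norm $\|x\|_{[D(A)]}=\|x\|+\|Ax\|$. $C([0,\infty),[D(A)])$ is the set of continuous functions from $[0,\infty)$ to $[D(A)]$, and $C^1([0,\infty),S)$ the set of continuously differentiable functions from $[0,\infty)$ to $S$. A function $g:[0,\infty)\to S$ is locally $L^0$-Lipschitz if for each $L>0$ there is $\zeta_L\in L^0_+(\mathcal F)$ with $\|g(s_1)-g(s_2)\|\le\zeta_L|s_1-s_2|$ for all $s_1,s_2\in[0,L]$; "under the locally $L^0$-Lipschitz condition on the solution" refers to solutions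 that are locally $L^0$-Lipschitz as functions $[0,\infty)\to S$.
   Formalization: Since u_0 in R(R_C(η,A)) need not lie in R(C), W(t)C^{-1}u_0 may be undefined; the unique solution is given as u(t)=C^{-1}W(t)u_0 for all such u_0, and as W(t)C^{-1}u_0 whenever u_0 is in R(C). *)

theory Defs
  imports "HOL-Probability.Probability" "HOL-Algebra.Module" "HOL-Algebra.Lattice"
begin

section \<open>The algebra of classes of random variables\<close>

text \<open>
  The scalar field K is a type of class \<^class>\<open>real_normed_field\<close>; by the Gelfand--Mazur theorem
  such a type is, up to isometric isomorphism, \<^typ>\<open>real\<close> or \<^typ>\<open>complex\<close> (and both are
  instances).  The class \<^class>\<open>second_countable_topology\<close> is then automatic; it is listed because
  the library needs it to see that sums and products of measurable functions are measurable.
\<close>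

definition L0_class :: "'w measure \<Rightarrow> ('w \<Rightarrow> 'k::topological_space) \<Rightarrow> ('w \<Rightarrow> 'k) set" where
  "L0_class P f = {g \<in> borel_measurable P. AE w in P. g w = f w}"

definition L0_rep :: "('w \<Rightarrow> 'k) set \<Rightarrow> 'w \<Rightarrow> 'k" where
  "L0_rep X = (SOME f. f \<in> X)"

definition L0 :: "'w measure \<Rightarrow> ('w \<Rightarrow> 'k::{real_normed_field, second_countable_topology}) set ring"
  where
  "L0 P =
    \<lparr>carrier = L0_class P ` borel_measurable P,
     mult = (\<lambda>X Y. L0_class P (\<lambda>w. L0_rep X w * L0_rep Y w)),
     one = L0_class P (\<lambda>_. 1),
     zero = L0_class P (\<lambda>_. 0),
     add = (\<lambda>X Y. L0_class P (\<lambda>w. L0_rep X w + L0_rep Y w))\<rparr>"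

definition L0_map :: "'w measure \<Rightarrow> ('k \<Rightarrow> 'l::topological_space) \<Rightarrow> ('w \<Rightarrow> 'k) set \<Rightarrow> ('w \<Rightarrow> 'l) set"
  where
  "L0_map P h X = L0_class P (\<lambda>w. h (L0_rep X w))"

definition L0_const :: "'w measure \<Rightarrow> 'k::topological_space \<Rightarrow> ('w \<Rightarrow> 'k) set" where
  "L0_const P c = L0_class P (\<lambda>_. c)"

definition L0_le :: "'w measure \<Rightarrow> ('w \<Rightarrow> real) set \<Rightarrow> ('w \<Rightarrow> real) set \<Rightarrow> bool" where
  "L0_le P X Y \<longleftrightarrow> (AE w in P. L0_rep X w \<le> L0_rep Y w)"

definition L0_plus :: "'w measure \<Rightarrow> ('w \<Rightarrow> real) set set" where
  "L0_plus P = {X \<in> carrier (L0 P). L0_le P \<zero>\<^bsub>L0 P\<^esub> X}"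

definition L0_above :: "'w measure \<Rightarrow> ('w \<Rightarrow> real) set \<Rightarrow> ('w \<Rightarrow> real) set set" where
  "L0_above P \<xi> = {\<eta> \<in> carrier (L0 P). AE w in P. L0_rep \<xi> w < L0_rep \<eta> w}"

definition L0_order :: "'w measure \<Rightarrow> ('w \<Rightarrow> real) set gorder" where
  "L0_order P = \<lparr>carrier = carrier (L0 P), eq = (=), le = L0_le P\<rparr>"

lemma L0_rep_class:
  assumes "f \<in> borel_measurable P"
  shows "L0_rep (L0_class P f) \<in> borel_measurable P"
    and "AE w in P. L0_rep (L0_class P f) w = f w"
proof -
  have "f \<in> L0_class P f" using assms by (simp add: L0_class_def)
  then have "L0_rep (L0_class P f) \<in> L0_class P f" unfolding L0_rep_def
    by (rule someI[of "\<lambda>h. h \<in> L0_class P f"])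
  then show "L0_rep (L0_class P f) \<in> borel_measurable P"
    and "AE w in P. L0_rep (L0_class P f) w = f w"
    by (auto simp: L0_class_def)
qed

lemma L0_class_cong:
  assumes "AE w in P. f w = g w"
  shows "L0_class P f = L0_class P g"
  using assms by (auto simp: L0_class_def elim: AE_mp)

lemma L0_class_eq_iff:
  assumes "f \<in> borel_measurable P"
  shows "L0_class P f = L0_class P g \<longleftrightarrow> (AE w in P. f w = g w)"
proof
  assume "L0_class P f = L0_class P g"
  moreover have "f \<in> L0_class P f" using assms by (simp add: L0_class_def)
  ultimately show "AE w in P. f w = g w" by (simp add: L0_class_def)
qed (rule L0_class_cong)

lemma L0_add_class:
  assumes "f \<in> borel_measurable P" "g \<in> borel_measurable P"
  shows "L0_class P f \<oplus>\<^bsub>L0 P\<^esub> L0_class P g = L0_class P (\<lambda>w. f w + g w)"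
  using L0_rep_class(2)[OF assms(1)] L0_rep_class(2)[OF assms(2)]
  by (auto simp: L0_def intro!: L0_class_cong)

lemma L0_mult_class:
  assumes "f \<in> borel_measurable P" "g \<in> borel_measurable P"
  shows "L0_class P f \<otimes>\<^bsub>L0 P\<^esub> L0_class P g = L0_class P (\<lambda>w. f w * g w)"
  using L0_rep_class(2)[OF assms(1)] L0_rep_class(2)[OF assms(2)]
  by (auto simp: L0_def intro!: L0_class_cong)

lemma L0_carrier: "carrier (L0 P) = L0_class P ` borel_measurable P"
  by (simp add: L0_def)

lemma cring_L0:
  "cring (L0 P :: ('w \<Rightarrow> 'k::{real_normed_field, second_countable_topology}) set ring)"
  (is "cring ?R")
proof (rule cringI)
  have zero: "\<zero>\<^bsub>?R\<^esub> = L0_class P (\<lambda>_. 0)" and one: "\<one>\<^bsub>?R\<^esub> = L0_class P (\<lambda>_. 1)"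
    by (simp_all add: L0_def)
  show "abelian_group ?R"
  proof (rule abelian_groupI)
    fix x assume "x \<in> carrier ?R"
    then obtain f where f: "f \<in> borel_measurable P" "x = L0_class P f" by (auto simp: L0_carrier)
    then have "L0_class P (\<lambda>w. - f w) \<oplus>\<^bsub>?R\<^esub> x = \<zero>\<^bsub>?R\<^esub>"
      by (simp add: L0_add_class zero)
    with f show "\<exists>y\<in>carrier ?R. y \<oplus>\<^bsub>?R\<^esub> x = \<zero>\<^bsub>?R\<^esub>"
      by (intro bexI[of _ "L0_class P (\<lambda>w. - f w)"]) (auto simp: L0_carrier)
  qed (auto simp: L0_carrier L0_add_class zero add_ac)
  show "comm_monoid ?R"
    by (rule comm_monoidI) (auto simp: L0_carrier L0_mult_class one mult_ac)
qed (auto simp: L0_carrier L0_add_class L0_mult_class distrib_right)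


section \<open>Random normed modules and the $(\varepsilon,\lambda)$-topology\<close>

text \<open>The fields \<open>mult\<close> and \<open>one\<close> that the library's module record inherits from rings are unused.\<close>

record ('w, 'k, 's) rn_module = "(('w \<Rightarrow> 'k) set, 's) module" +
  L0norm :: "'s \<Rightarrow> ('w \<Rightarrow> real) set"

locale random_normed_module = prob_space P + Module.module "L0 P" S
  for P :: "'w measure"
    and S :: "('w, 'k::{real_normed_field, second_countable_topology}, 's) rn_module" +
  assumes L0norm_closed: "x \<in> carrier S \<Longrightarrow> L0norm S x \<in> L0_plus P"
    and L0norm_definite: "x \<in> carrier S \<Longrightarrow> L0norm S x = \<zero>\<^bsub>L0 P\<^esub> \<Longrightarrow> x = \<zero>\<^bsub>S\<^esub>"
    and L0norm_smult: "\<zeta> \<in> carrier (L0 P) \<Longrightarrow> x \<in> carrier S \<Longrightarrow>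
          L0norm S (\<zeta> \<odot>\<^bsub>S\<^esub> x) = L0_map P norm \<zeta> \<otimes>\<^bsub>L0 P\<^esub> L0norm S x"
    and L0norm_triangle: "x \<in> carrier S \<Longrightarrow> y \<in> carrier S \<Longrightarrow>
          L0_le P (L0norm S (x \<oplus>\<^bsub>S\<^esub> y)) (L0norm S x \<oplus>\<^bsub>L0 P\<^esub> L0norm S y)"

definition el_ball :: "'w measure \<Rightarrow> ('w, 'k, 's) rn_module \<Rightarrow> real \<Rightarrow> real \<Rightarrow> 's set" where
  "el_ball P S \<epsilon> \<delta> =
    {z \<in> carrier S. measure P {w \<in> space P. L0_rep (L0norm S z) w < \<epsilon>} > 1 - \<delta>}"

definition el_open :: "'w measure \<Rightarrow> ('w, 'k, 's) rn_module \<Rightarrow> 's set \<Rightarrow> bool" where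
  "el_open P S U \<longleftrightarrow> U \<subseteq> carrier S \<and>
    (\<forall>x\<in>U. \<exists>\<epsilon> > 0. \<exists>\<delta>. 0 < \<delta> \<and> \<delta> < 1 \<and> (\<forall>z\<in>el_ball P S \<epsilon> \<delta>. x \<oplus>\<^bsub>S\<^esub> z \<in> U))"

definition el_topology :: "'w measure \<Rightarrow> ('w, 'k, 's) rn_module \<Rightarrow> 's topology" where
  "el_topology P S = topology (el_open P S)"

lemma el_ball_mono:
  assumes "prob_space P" and "\<And>z. z \<in> carrier S \<Longrightarrow> L0_rep (L0norm S z) \<in> borel_measurable P"
    and "\<epsilon> \<le> \<epsilon>'" "\<delta> \<le> \<delta>'"
  shows "el_ball P S \<epsilon> \<delta> \<subseteq> el_ball P S \<epsilon>' \<delta>'"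
proof
  fix z assume z: "z \<in> el_ball P S \<epsilon> \<delta>"
  then have zS: "z \<in> carrier S" by (simp add: el_ball_def)
  interpret prob_space P by fact
  note [measurable] = assms(2)[OF zS]
  have "measure P {w \<in> space P. L0_rep (L0norm S z) w < \<epsilon>}
      \<le> measure P {w \<in> space P. L0_rep (L0norm S z) w < \<epsilon>'}"
    using assms(3) by (intro finite_measure_mono) auto
  with z assms(4) show "z \<in> el_ball P S \<epsilon>' \<delta>'" by (auto simp: el_ball_def)
qed

lemma openin_el_topology:
  assumes "prob_space P" and "\<And>z. z \<in> carrier S \<Longrightarrow> L0_rep (L0norm S z) \<in> borel_measurable P"
  shows "openin (el_topology P S) U \<longleftrightarrow> el_open P S U"
proof -
  have "el_open P S (U \<inter> V)" if U: "el_open P S U" and V: "el_open P S V" for U V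
    unfolding el_open_def
  proof (intro conjI ballI)
    show "U \<inter> V \<subseteq> carrier S" using U by (auto simp: el_open_def)
    fix x assume x: "x \<in> U \<inter> V"
    obtain e d where 1: "e > 0" "0 < d" "d < 1" "\<forall>z\<in>el_ball P S e d. x \<oplus>\<^bsub>S\<^esub> z \<in> U"
      using U x unfolding el_open_def by blast
    obtain e' d' where 2: "e' > 0" "0 < d'" "d' < 1" "\<forall>z\<in>el_ball P S e' d'. x \<oplus>\<^bsub>S\<^esub> z \<in> V"
      using V x unfolding el_open_def by blast
    have "el_ball P S (min e e') (min d d') \<subseteq> el_ball P S e d"
      "el_ball P S (min e e') (min d d') \<subseteq> el_ball P S e' d'"
      using el_ball_mono[OF assms, of "min e e'"] by (simp_all add: el_ball_mono[OF assms])
    with 1 2 show "\<exists>\<epsilon> > 0. \<exists>\<delta>. 0 < \<delta> \<and> \<delta> < 1 \<and> (\<forall>z\<in>el_ball P S \<epsilon> \<delta>. x \<oplus>\<^bsub>S\<^esub> z \<in> U \<inter> V)"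
      by (intro exI[of _ "min e e'"] conjI exI[of _ "min d d'"]) auto
  qed
  moreover have "el_open P S (\<Union>\<K>)" if "\<forall>K\<in>\<K>. el_open P S K" for \<K>
    using that unfolding el_open_def by (meson Union_iff Union_least)
  ultimately have "istopology (el_open P S)" by (simp add: istopology_def)
  then show ?thesis by (simp add: el_topology_def)
qed

definition el_Cauchy :: "'w measure \<Rightarrow> ('w, 'k, 's) rn_module \<Rightarrow> (nat \<Rightarrow> 's) \<Rightarrow> bool" where
  "el_Cauchy P S x \<longleftrightarrow> range x \<subseteq> carrier S \<and>
    (\<forall>\<epsilon> > 0. \<forall>\<delta>. 0 < \<delta> \<and> \<delta> < 1 \<longrightarrow> (\<exists>N. \<forall>m\<ge>N. \<forall>n\<ge>N. x m \<ominus>\<^bsub>S\<^esub> x n \<in> el_ball P S \<epsilon> \<delta>))"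

text \<open>The topology is metrizable and linear, so Cauchy sequences suffice for completeness.\<close>

definition el_complete :: "'w measure \<Rightarrow> ('w, 'k, 's) rn_module \<Rightarrow> bool" where
  "el_complete P S \<longleftrightarrow>
    (\<forall>x. el_Cauchy P S x \<longrightarrow> (\<exists>l. limitin (el_topology P S) x l sequentially))"

definition scale :: "'w measure \<Rightarrow> ('w, 'k::{real_normed_field, second_countable_topology}, 's) rn_module
    \<Rightarrow> 'k \<Rightarrow> 's \<Rightarrow> 's" where
  "scale P S c x = L0_const P c \<odot>\<^bsub>S\<^esub> x"


section \<open>Almost surely bounded operators\<close>

definition op_bounds :: "'w measure \<Rightarrow> ('w, 'k, 's) rn_module \<Rightarrow> ('s \<Rightarrow> 's) \<Rightarrow> ('w \<Rightarrow> real) set set" where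
  "op_bounds P S T = {\<eta> \<in> L0_plus P.
    \<forall>z\<in>carrier S. L0_le P (L0norm S (T z)) (\<eta> \<otimes>\<^bsub>L0 P\<^esub> L0norm S z)}"

text \<open>
  Linearity means linearity over K; for operators with an almost sure bound, linearity over the
  whole algebra of random scalars is a consequence.
\<close>

definition bounded_ops :: "'w measure \<Rightarrow>
    ('w, 'k::{real_normed_field, second_countable_topology}, 's) rn_module \<Rightarrow> ('s \<Rightarrow> 's) set" where
  "bounded_ops P S = {T. T \<in> carrier S \<rightarrow> carrier S \<and>
    (\<forall>x\<in>carrier S. \<forall>y\<in>carrier S. T (x \<oplus>\<^bsub>S\<^esub> y) = T x \<oplus>\<^bsub>S\<^esub> T y) \<and>
    (\<forall>c. \<forall>x\<in>carrier S. T (scale P S c x) = scale P S c (T x)) \<and>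
    op_bounds P S T \<noteq> {}}"

definition op_L0norm :: "'w measure \<Rightarrow> ('w, 'k, 's) rn_module \<Rightarrow> ('s \<Rightarrow> 's) \<Rightarrow> ('w \<Rightarrow> real) set" where
  "op_L0norm P S T = \<Sqinter>\<^bsub>L0_order P\<^esub> (op_bounds P S T)"


section \<open>C-semigroups, generators and random C-resolvents\<close>

abbreviation op_inv :: "('w, 'k, 's) rn_module \<Rightarrow> ('s \<Rightarrow> 's) \<Rightarrow> 's \<Rightarrow> 's" where
  "op_inv S C \<equiv> the_inv_into (carrier S) C"

definition C_semigroup :: "'w measure \<Rightarrow>
    ('w, 'k::{real_normed_field, second_countable_topology}, 's) rn_module \<Rightarrow>
    ('s \<Rightarrow> 's) \<Rightarrow> (real \<Rightarrow> 's \<Rightarrow> 's) \<Rightarrow> bool" where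
  "C_semigroup P S C W \<longleftrightarrow>
    C \<in> bounded_ops P S \<and> inj_on C (carrier S) \<and>
    (\<forall>t\<ge>0. W t \<in> bounded_ops P S) \<and>
    (\<forall>x\<in>carrier S. W 0 x = C x) \<and>
    (\<forall>s\<ge>0. \<forall>t\<ge>0. \<forall>x\<in>carrier S. C (W (s + t) x) = W t (W s x)) \<and>
    (\<forall>x\<in>carrier S. continuous_map (top_of_set {0..}) (el_topology P S) (\<lambda>s. W s x))"

definition gen_limit :: "'w measure \<Rightarrow>
    ('w, 'k::{real_normed_field, second_countable_topology}, 's) rn_module \<Rightarrow>
    ('s \<Rightarrow> 's) \<Rightarrow> (real \<Rightarrow> 's \<Rightarrow> 's) \<Rightarrow> 's \<Rightarrow> 's \<Rightarrow> bool" where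
  "gen_limit P S C W x l \<longleftrightarrow>
    limitin (el_topology P S) (\<lambda>s. scale P S (of_real (1 / s)) (W s x \<ominus>\<^bsub>S\<^esub> C x)) l (at_right 0)"

definition gen_dom :: "'w measure \<Rightarrow>
    ('w, 'k::{real_normed_field, second_countable_topology}, 's) rn_module \<Rightarrow>
    ('s \<Rightarrow> 's) \<Rightarrow> (real \<Rightarrow> 's \<Rightarrow> 's) \<Rightarrow> 's set" where
  "gen_dom P S C W = {x \<in> carrier S. \<exists>l \<in> C ` carrier S. gen_limit P S C W x l}"

definition generator :: "'w measure \<Rightarrow>
    ('w, 'k::{real_normed_field, second_countable_topology}, 's) rn_module \<Rightarrow>
    ('s \<Rightarrow> 's) \<Rightarrow> (real \<Rightarrow> 's \<Rightarrow> 's) \<Rightarrow> 's \<Rightarrow> 's" where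
  "generator P S C W x = op_inv S C (THE l. gen_limit P S C W x l)"

definition C_resolvent_set :: "'w measure \<Rightarrow>
    ('w, 'k::{real_normed_field, second_countable_topology}, 's) rn_module \<Rightarrow>
    ('s \<Rightarrow> 's) \<Rightarrow> 's set \<Rightarrow> ('s \<Rightarrow> 's) \<Rightarrow> ('w \<Rightarrow> 'k) set set" where
  "C_resolvent_set P S C D A = {\<eta> \<in> carrier (L0 P).
    inj_on (\<lambda>x. \<eta> \<odot>\<^bsub>S\<^esub> x \<ominus>\<^bsub>S\<^esub> A x) D \<and>
    C ` carrier S \<subseteq> (\<lambda>x. \<eta> \<odot>\<^bsub>S\<^esub> x \<ominus>\<^bsub>S\<^esub> A x) ` D}"

text \<open>Meaningful only for \<open>\<eta>\<close> in \<^const>\<open>C_resolvent_set\<close>.\<close>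

definition C_resolvent :: "('w, 'k, 's) rn_module \<Rightarrow> ('s \<Rightarrow> 's) \<Rightarrow> 's set \<Rightarrow> ('s \<Rightarrow> 's) \<Rightarrow>
    ('w \<Rightarrow> 'k) set \<Rightarrow> 's \<Rightarrow> 's" where
  "C_resolvent S C D A \<eta> y = the_inv_into D (\<lambda>x. \<eta> \<odot>\<^bsub>S\<^esub> x \<ominus>\<^bsub>S\<^esub> A x) (C y)"


section \<open>The abstract Cauchy problem\<close>

definition graph_module :: "'w measure \<Rightarrow> ('w, 'k, 's) rn_module \<Rightarrow> 's set \<Rightarrow> ('s \<Rightarrow> 's) \<Rightarrow>
    ('w, 'k, 's) rn_module" where
  "graph_module P S D A =
    S\<lparr>carrier := D, L0norm := (\<lambda>x. L0norm S x \<oplus>\<^bsub>L0 P\<^esub> L0norm S (A x))\<rparr>"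

text \<open>The derivative relative to \<open>[0,\<infinity>)\<close>: two-sided for \<open>t > 0\<close>, right-sided for \<open>t = 0\<close>.\<close>

definition has_el_derivative :: "'w measure \<Rightarrow>
    ('w, 'k::{real_normed_field, second_countable_topology}, 's) rn_module \<Rightarrow>
    (real \<Rightarrow> 's) \<Rightarrow> 's \<Rightarrow> real \<Rightarrow> bool" where
  "has_el_derivative P S u d t \<longleftrightarrow>
    limitin (el_topology P S) (\<lambda>s. scale P S (of_real (1 / (s - t))) (u s \<ominus>\<^bsub>S\<^esub> u t)) d
      (at t within {0..})"

definition C0_fun :: "'w measure \<Rightarrow> ('w, 'k, 's) rn_module \<Rightarrow> (real \<Rightarrow> 's) set" where
  "C0_fun P S = {u. continuous_map (top_of_set {0..}) (el_topology P S) u}"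

definition C1_fun :: "'w measure \<Rightarrow>
    ('w, 'k::{real_normed_field, second_countable_topology}, 's) rn_module \<Rightarrow> (real \<Rightarrow> 's) set" where
  "C1_fun P S = {u \<in> C0_fun P S. \<exists>u' \<in> C0_fun P S. \<forall>t\<ge>0. has_el_derivative P S u (u' t) t}"

definition locally_L0_Lipschitz :: "'w measure \<Rightarrow> ('w, 'k, 's) rn_module \<Rightarrow> (real \<Rightarrow> 's) \<Rightarrow> bool" where
  "locally_L0_Lipschitz P S g \<longleftrightarrow> (\<forall>L > 0. \<exists>\<zeta> \<in> L0_plus P. \<forall>s1\<in>{0..L}. \<forall>s2\<in>{0..L}.
    L0_le P (L0norm S (g s1 \<ominus>\<^bsub>S\<^esub> g s2)) (\<zeta> \<otimes>\<^bsub>L0 P\<^esub> L0_const P \<bar>s1 - s2\<bar>))"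

text \<open>
  An initial value in the range of the C-resolvent need not lie in the range of \<open>C\<close>: on the direct
  sum of two copies of \<open>L\<^sup>2\<close> let \<open>A\<close> be multiplication by the matrix with rows \<open>(0, x)\<close>, \<open>(0, 0)\<close> and
  \<open>C\<close> multiplication by \<open>1 / (1 + \<bar>x\<bar>)\<close>.  So \<open>W t (C\<inverse> u0)\<close> may be undefined, whereas
  \<open>C\<inverse> (W t u0)\<close> is always defined on that range and, because \<open>C\<close> and \<open>W t\<close> commute, agrees
  with the former expression whenever the former makes sense.
\<close>

text \<open>Only the values on \<open>[0,\<infinity>)\<close> of the function \<open>u\<close> matter.\<close>

definition ACP_solution :: "'w measure \<Rightarrow>
    ('w, 'k::{real_normed_field, second_countable_topology}, 's) rn_module \<Rightarrow>
    's set \<Rightarrow> ('s \<Rightarrow> 's) \<Rightarrow> 's \<Rightarrow> (real \<Rightarrow> 's) \<Rightarrow> bool" where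
  "ACP_solution P S D A u0 u \<longleftrightarrow>
    u \<in> C0_fun P (graph_module P S D A) \<inter> C1_fun P S \<and>
    locally_L0_Lipschitz P S u \<and>
    (\<forall>t>0. has_el_derivative P S u (A (u t)) t) \<and>
    u 0 = u0"

end

theory Submission
  imports Defs
begin

text \<open>
  With \<open>V s = exp (- \<eta> s) W s\<close> one gets a C-semigroup dominated by \<open>M\<close> and decaying at infinity.  The
  topology is not locally convex, but on functions dominated by a fixed random variable \<open>b\<close>
  convergence in probability is convergence of the expectations \<open>E (\<parallel>z\<parallel> / (1 + \<bar>b\<bar>))\<close>.  In this norm
  Riemann sums of dominated continuous functions converge, and a Lipschitz function with zero
  derivative is constant.

  For \<open>y\<close> in \<open>S\<close> let \<open>F t\<close> be the integral of \<open>V (\<cdot>) y\<close> over \<open>[0, t]\<close> and \<open>G\<close> its limit at infinity.  Then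
  \<open>V h G = C (G - F h)\<close>, so \<open>u t = exp (\<eta> t) (G - F t)\<close> satisfies \<open>W h (u t) = C (u (t + h))\<close>; hence
  \<open>A (u t) = u' t = \<eta> (u t) - W t y\<close>, and at \<open>t = 0\<close> this gives \<open>(\<eta> - A) G = C y\<close>.  Any Lipschitz solution
  \<open>v\<close> makes \<open>s \<mapsto> V (t - s) (exp (- \<eta> s) v s)\<close> a Lipschitz function with zero derivative, whence
  \<open>C (v t) = W t (v 0)\<close>.
\<close>

section \<open>Convergence in probability\<close>

text \<open>Difference quotients converge only in probability, and such a derivative does not
  control a function: with \<open>U\<close> uniformly distributed on [0, 1], the indicator of
  \<open>U \<le> s\<close> has derivative 0 at every \<open>s\<close> and is not constant. So the
  functions to be compared carry, besides a derivative, an almost-sure Lipschitz bound. The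
  truncated expectation that metrizes convergence in probability is not homogeneous, so it cannot
  estimate a sum of many small terms; the weighted expectation is homogeneous and can.

  The random rate \<open>\<eta> - \<xi>\<close> is positive almost surely but need not be bounded
  away from 0. Decay is therefore used pointwise on the sample space, as a geometric series with a
  random ratio.

  Exponentials with random exponents must pass through \<open>W s\<close>, although operators are
  assumed linear over K only; the almost-sure bound makes them linear over random scalars.
  Identities between integrals over bounded intervals are proved by comparing derivatives and
  initial values. The semigroup law produces a factor \<open>C\<close> at each use, and its
  injectivity removes it at the end.\<close>

context prob_space
begin

text \<open>The truncated expectation metrizing convergence in probability. Truncation makes every
  measurable function integrable; the price is that \<open>mag\<close> is subadditive but not
  homogeneous.\<close>

definition mag :: "('a \<Rightarrow> real) \<Rightarrow> real" where
  "mag g = expectation (\<lambda>w. min 1 \<bar>g w\<bar>)"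

lemma integrable_min_one:
  assumes [measurable]: "g \<in> borel_measurable M"
  shows "integrable M (\<lambda>w. min 1 \<bar>g w :: real\<bar>)"
  by (rule integrable_const_bound[where B = 1]) auto

lemma mag_nonneg: "0 \<le> mag g"
  unfolding mag_def by (rule integral_nonneg_AE) auto

lemma mag_le_add:
  assumes [measurable]: "f \<in> borel_measurable M" "g \<in> borel_measurable M" "h \<in> borel_measurable M"
    and "AE w in M. \<bar>f w\<bar> \<le> \<bar>g w\<bar> + \<bar>h w\<bar>"
  shows "mag f \<le> mag g + mag h"
proof -
  have "AE w in M. min 1 \<bar>f w\<bar> \<le> min 1 \<bar>g w\<bar> + min 1 \<bar>h w\<bar>"
    using assms(4) by eventually_elim auto
  then have "mag f \<le> expectation (\<lambda>w. min 1 \<bar>g w\<bar> + min 1 \<bar>h w\<bar>)"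
    unfolding mag_def
    by (intro integral_mono_AE Bochner_Integration.integrable_add integrable_min_one) auto
  then show ?thesis
    unfolding mag_def by (simp add: integrable_min_one)
qed

text \<open>Where both factors are at most 1, the product is at most the first one; elsewhere the
  sum of the truncations is already at least 1. This serves products with two varying factors, as in
  \<open>conv_act_var\<close>.\<close>

lemma mag_le_mult:
  assumes [measurable]: "f \<in> borel_measurable M" "g \<in> borel_measurable M" "h \<in> borel_measurable M"
    and "AE w in M. \<bar>f w\<bar> \<le> \<bar>g w\<bar> * \<bar>h w\<bar>"
  shows "mag f \<le> mag g + mag h"
proof -
  have *: "min 1 y \<le> min 1 a + min 1 b" if "y \<le> a * b" "0 \<le> a" "0 \<le> b" for y a b :: real
  proof (cases "a \<le> 1 \<and> b \<le> 1")
    case True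
    with that have "a * b \<le> a" by (simp add: mult_left_le)
    with True that show ?thesis by linarith
  qed (use that in auto)
  have "AE w in M. min 1 \<bar>f w\<bar> \<le> min 1 \<bar>g w\<bar> + min 1 \<bar>h w\<bar>"
    using assms(4) by eventually_elim (rule *, auto)
  then have "mag f \<le> expectation (\<lambda>w. min 1 \<bar>g w\<bar> + min 1 \<bar>h w\<bar>)"
    unfolding mag_def
    by (intro integral_mono_AE Bochner_Integration.integrable_add integrable_min_one) auto
  then show ?thesis
    unfolding mag_def by (simp add: integrable_min_one)
qed

lemma mag_zero: "mag (\<lambda>_. 0) = 0"
  by (simp add: mag_def)

lemma mag_mono:
  assumes "f \<in> borel_measurable M" "g \<in> borel_measurable M" "AE w in M. \<bar>f w\<bar> \<le> \<bar>g w\<bar>"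
  shows "mag f \<le> mag g"
  using mag_le_add[of f g "\<lambda>_. 0"] assms by (simp add: mag_zero)

lemma mag_cong:
  assumes "f \<in> borel_measurable M" "g \<in> borel_measurable M" "AE w in M. f w = g w"
  shows "mag f = mag g"
  using assms by (intro antisym mag_mono) auto

lemma mag_eq_0:
  assumes "g \<in> borel_measurable M" "mag g = 0"
  shows "AE w in M. g w = 0"
proof -
  have "AE w in M. min 1 \<bar>g w\<bar> = 0"
    using assms(2) integrable_min_one[OF assms(1)] unfolding mag_def
    by (subst (asm) integral_nonneg_eq_0_iff_AE) auto
  then show ?thesis by eventually_elim (auto simp: min_def split: if_splits)
qed

text \<open>Markov's inequality for the truncated function, hence the restriction to thresholds at
  most 1. With the converse estimate \<open>mag_le_prob\<close> it compares \<open>mag\<close> with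
  the basic neighbourhoods of the topology.\<close>

lemma mag_markov:
  assumes [measurable]: "g \<in> borel_measurable M" and "0 < \<epsilon>" "\<epsilon> \<le> 1"
  shows "\<epsilon> * prob {w \<in> space M. \<epsilon> \<le> \<bar>g w\<bar>} \<le> mag g"
proof -
  have "expectation (\<lambda>w. \<epsilon> * indicator {w \<in> space M. \<epsilon> \<le> \<bar>g w\<bar>} w) \<le> mag g"
    unfolding mag_def using assms
    by (intro integral_mono integrable_min_one integrable_mult_right integrable_real_indicator)
       (auto split: split_indicator simp: emeasure_eq_measure)
  then show ?thesis by simp
qed

lemma mag_le_prob:
  assumes [measurable]: "g \<in> borel_measurable M" and "0 \<le> \<epsilon>"
  shows "mag g \<le> \<epsilon> + prob {w \<in> space M. \<epsilon> \<le> \<bar>g w\<bar>}"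
proof -
  have "mag g \<le> expectation (\<lambda>w. \<epsilon> + indicator {w \<in> space M. \<epsilon> \<le> \<bar>g w\<bar>} w)"
    unfolding mag_def using assms
    by (intro integral_mono integrable_min_one Bochner_Integration.integrable_add integrable_real_indicator)
       (auto split: split_indicator simp: emeasure_eq_measure)
  also have "\<dots> = \<epsilon> + prob {w \<in> space M. \<epsilon> \<le> \<bar>g w\<bar>}"
    by (subst Bochner_Integration.integral_add) (auto simp: emeasure_eq_measure prob_space)
  finally show ?thesis .
qed

text \<open>A finite random variable is tight: the sets where it exceeds \<open>n\<close> decrease
  to the empty set. With \<open>K \<ge> 1\<close>, the product \<open>K * min 1 y\<close> dominates
  a truncated product also when \<open>y > 1\<close>, as \<open>mag_mult_tendsto\<close>
  requires.\<close>

lemma prob_large_small: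
  fixes h :: "'a \<Rightarrow> real"
  assumes [measurable]: "h \<in> borel_measurable M" and "0 < \<epsilon>"
  shows "\<exists>K\<ge>1. prob {w \<in> space M. K < \<bar>h w\<bar>} < \<epsilon>"
proof -
  let ?A = "\<lambda>n::nat. {w \<in> space M. real n < \<bar>h w\<bar>}"
  have "(\<lambda>n. prob (?A n)) \<longlonglongrightarrow> prob (\<Inter>n. ?A n)"
    by (rule finite_Lim_measure_decseq) (auto simp: decseq_def)
  moreover have "(\<Inter>n. ?A n) = {}"
    by (auto simp: not_less) (meson reals_Archimedean2 less_imp_le not_less)
  ultimately have "(\<lambda>n. prob (?A n)) \<longlonglongrightarrow> 0" by simp
  then have "eventually (\<lambda>n. prob (?A n) < \<epsilon>) sequentially"
    using \<open>0 < \<epsilon>\<close> by (simp add: order_tendsto_iff)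
  then have "eventually (\<lambda>n. n \<ge> 1 \<and> prob (?A n) < \<epsilon>) sequentially"
    using eventually_ge_at_top by eventually_elim auto
  then obtain n where "n \<ge> 1" "prob (?A n) < \<epsilon>"
    by (metis (mono_tags, lifting) eventually_sequentially order_refl)
  then show ?thesis by (intro exI[of _ "real n"]) auto
qed

text \<open>Off a set of small probability the unbounded factor \<open>h\<close> is at most
  \<open>K\<close>, and there the truncated product is at most \<open>K\<close> times the truncation
  of \<open>g s\<close>. Since \<open>K\<close> depends on the required accuracy, the conclusion is
  a limit and not an inequality.\<close>

lemma mag_mult_tendsto:
  assumes [measurable]: "h \<in> borel_measurable M"
    and g: "eventually (\<lambda>s. g s \<in> borel_measurable M) F"
    and lim: "((\<lambda>s. mag (g s)) \<longlongrightarrow> 0) F"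
  shows "((\<lambda>s. mag (\<lambda>w. h w * g s w)) \<longlongrightarrow> 0) F"
proof (rule order_tendstoI)
  fix a :: real
  show "eventually (\<lambda>s. a < mag (\<lambda>w. h w * g s w)) F" if "a < 0"
    using that mag_nonneg by (intro always_eventually) (auto intro: less_le_trans)
  assume "0 < a"
  then obtain K where K: "K \<ge> 1" "prob {w \<in> space M. K < \<bar>h w\<bar>} < a / 2"
    using prob_large_small[of h "a / 2"] by auto
  have "mag (\<lambda>w. h w * g s w) \<le> prob {w \<in> space M. K < \<bar>h w\<bar>} + K * mag (g s)"
    if [measurable]: "g s \<in> borel_measurable M" for s
  proof -
    have *: "min 1 (c * y) \<le> K * min 1 y" if "c \<le> K" "0 \<le> c" "0 \<le> y" for c y
    proof (cases "y \<le> 1")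
      case True with that show ?thesis by (simp add: mult_right_mono min.coboundedI2)
    qed (use K in auto)
    have "mag (\<lambda>w. h w * g s w)
        \<le> expectation (\<lambda>w. indicator {w \<in> space M. K < \<bar>h w\<bar>} w + K * min 1 \<bar>g s w\<bar>)"
      unfolding mag_def using K
      by (intro integral_mono integrable_min_one Bochner_Integration.integrable_add
          integrable_mult_right integrable_real_indicator)
        (auto split: split_indicator simp: emeasure_eq_measure abs_mult not_less intro: * min.coboundedI1)
    then show ?thesis
      unfolding mag_def by (subst (asm) Bochner_Integration.integral_add)
        (auto simp: integrable_min_one emeasure_eq_measure)
  qed
  note bound = this
  have "eventually (\<lambda>s. mag (g s) < a / (2 * K)) F"
    using order_tendstoD(2)[OF lim, of "a / (2 * K)"] \<open>0 < a\<close> K by simp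
  with g show "eventually (\<lambda>s. mag (\<lambda>w. h w * g s w) < a) F"
  proof eventually_elim
    case (elim s)
    with K have "K * mag (g s) < a / 2" using elim(2) by (simp add: field_simps)
    with bound[OF elim(1)] K show ?case by linarith
  qed
qed

lemma mag_tendsto_AE:
  assumes [measurable]: "\<And>n. g n \<in> borel_measurable M"
    and "AE w in M. (\<lambda>n. g n w) \<longlonglongrightarrow> 0"
  shows "(\<lambda>n. mag (g n)) \<longlonglongrightarrow> 0"
proof -
  have "(\<lambda>n. expectation (\<lambda>w. min 1 \<bar>g n w\<bar>)) \<longlonglongrightarrow> expectation (\<lambda>w. 0)"
  proof (rule integral_dominated_convergence[where w = "\<lambda>_. 1"])
    show "AE w in M. (\<lambda>n. min 1 \<bar>g n w\<bar>) \<longlonglongrightarrow> 0"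
      using assms(2)
    proof eventually_elim
      case (elim w)
      from tendsto_min[OF tendsto_const[of 1] tendsto_rabs[OF elim]] show ?case by simp
    qed
  qed auto
  then show ?thesis by (simp add: mag_def)
qed

lemma mag_tendsto_0_mono:
  assumes "eventually (\<lambda>s. g s \<in> borel_measurable M) F"
    and "eventually (\<lambda>s. h s \<in> borel_measurable M) F"
    and "eventually (\<lambda>s. AE w in M. \<bar>g s w\<bar> \<le> \<bar>h s w\<bar>) F"
    and "((\<lambda>s. mag (h s)) \<longlongrightarrow> 0) F"
  shows "((\<lambda>s. mag (g s)) \<longlongrightarrow> 0) F"
proof (rule tendsto_sandwich[OF _ _ tendsto_const assms(4)])
  show "eventually (\<lambda>s. mag (g s) \<le> mag (h s)) F"
    using assms(1-3) by eventually_elim (rule mag_mono)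
qed (simp add: mag_nonneg)

lemma mag_const: "mag (\<lambda>_. c) = min 1 \<bar>c\<bar>"
  by (simp add: mag_def prob_space)

lemma mag_const_mult_tendsto:
  assumes h: "h \<in> borel_measurable M" and "(c \<longlongrightarrow> 0) F"
  shows "((\<lambda>s. mag (\<lambda>w. h w * c s)) \<longlongrightarrow> 0) F"
proof (rule mag_mult_tendsto[OF h])
  show "((\<lambda>s. mag (\<lambda>_. c s)) \<longlongrightarrow> 0) F"
    using tendsto_min[OF tendsto_const[of 1] tendsto_rabs[OF assms(2)]] by (simp add: mag_const)
qed simp

lemma mag_tendsto_Lipschitz:
  assumes "eventually (\<lambda>s. g s \<in> borel_measurable M) F" "h \<in> borel_measurable M"
    and "eventually (\<lambda>s. AE w in M. \<bar>g s w\<bar> \<le> \<bar>h w\<bar> * \<bar>c s\<bar>) F"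
    and "(c \<longlongrightarrow> 0) F"
  shows "((\<lambda>s. mag (g s)) \<longlongrightarrow> 0) F"
proof (rule mag_tendsto_0_mono[OF assms(1)])
  show "eventually (\<lambda>s. AE w in M. \<bar>g s w\<bar> \<le> \<bar>h w * c s\<bar>) F"
    using assms(3) by (simp add: abs_mult)
  show "((\<lambda>s. mag (\<lambda>w. h w * c s)) \<longlongrightarrow> 0) F"
    by (rule mag_const_mult_tendsto) fact+
qed (use assms in auto)

end

section \<open>Random normed modules through representatives\<close>

lemma L0_class_rep:
  assumes "X \<in> carrier (L0 P)"
  shows "L0_rep X \<in> borel_measurable P" "L0_class P (L0_rep X) = X"
proof -
  from assms obtain f where f: "f \<in> borel_measurable P" "X = L0_class P f"
    by (auto simp: L0_carrier)
  with L0_rep_class[OF f(1)] show "L0_rep X \<in> borel_measurable P" "L0_class P (L0_rep X) = X"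
    by (simp_all add: L0_class_cong)
qed

context random_normed_module
begin

abbreviation add_S (infixl "+\<^sub>S" 65) where "x +\<^sub>S y \<equiv> x \<oplus>\<^bsub>S\<^esub> y"

abbreviation minus_S (infixl "-\<^sub>S" 65) where "x -\<^sub>S y \<equiv> x \<ominus>\<^bsub>S\<^esub> y"

abbreviation zero_S ("0\<^sub>S") where "0\<^sub>S \<equiv> \<zero>\<^bsub>S\<^esub>"

text \<open>With one representative fixed, the order and the arithmetic of norms become almost-sure
  relations between real functions, which can be combined pointwise.\<close>

definition nrm :: "'s \<Rightarrow> 'w \<Rightarrow> real" where
  "nrm x = L0_rep (L0norm S x)"

text \<open>Only real random scalars occur in the proof, whatever the scalar field is.\<close>

definition act :: "('w \<Rightarrow> real) \<Rightarrow> 's \<Rightarrow> 's" where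
  "act h x = L0_class P (\<lambda>w. of_real (h w)) \<odot>\<^bsub>S\<^esub> x"

lemma L0norm_carrier: "x \<in> carrier S \<Longrightarrow> L0norm S x \<in> carrier (L0 P)"
  using L0norm_closed by (auto simp: L0_plus_def)

lemma nrm_measurable[measurable]: "x \<in> carrier S \<Longrightarrow> nrm x \<in> borel_measurable P"
  unfolding nrm_def by (intro L0_class_rep L0norm_carrier)

lemma L0norm_nrm: "x \<in> carrier S \<Longrightarrow> L0norm S x = L0_class P (nrm x)"
  unfolding nrm_def by (intro L0_class_rep(2)[symmetric] L0norm_carrier)

lemma L0_zero: "\<zero>\<^bsub>L0 P\<^esub> = L0_class P (\<lambda>_. 0)"
  by (simp add: L0_def)

lemma nrm_nonneg: assumes "x \<in> carrier S" shows "AE w in P. 0 \<le> nrm x w"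
proof -
  have "AE w in P. L0_rep (L0_class P (\<lambda>_. 0 :: real)) w \<le> nrm x w"
    using L0norm_closed[OF assms] by (simp add: L0_plus_def L0_le_def nrm_def L0_zero)
  moreover have "AE w in P. L0_rep (L0_class P (\<lambda>_. 0 :: real)) w = 0"
    by (rule L0_rep_class) simp
  ultimately show ?thesis by eventually_elim simp
qed

lemma nrm_eq_0:
  assumes "x \<in> carrier S" "AE w in P. nrm x w = 0"
  shows "x = 0\<^sub>S"
  using L0norm_definite[OF assms(1)] L0norm_nrm[OF assms(1)] L0_class_cong[OF assms(2)]
  by (simp add: L0_zero)

lemma nrm_add:
  assumes "x \<in> carrier S" "y \<in> carrier S"
  shows "AE w in P. nrm (x +\<^sub>S y) w \<le> nrm x w + nrm y w"
proof -
  have "L0norm S x \<oplus>\<^bsub>L0 P\<^esub> L0norm S y = L0_class P (\<lambda>w. nrm x w + nrm y w)"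
    using assms by (simp add: L0norm_nrm L0_add_class)
  moreover have "AE w in P. L0_rep (L0_class P (\<lambda>w. nrm x w + nrm y w)) w = nrm x w + nrm y w"
    using assms by (intro L0_rep_class) simp
  moreover have "AE w in P. nrm (x +\<^sub>S y) w \<le> L0_rep (L0norm S x \<oplus>\<^bsub>L0 P\<^esub> L0norm S y) w"
    using L0norm_triangle[OF assms] by (simp add: L0_le_def nrm_def)
  ultimately show ?thesis by auto
qed

lemma of_real_measurable[measurable (raw)]:
  "h \<in> borel_measurable P \<Longrightarrow> (\<lambda>w. of_real (h w) :: 'k) \<in> borel_measurable P"
  by (rule measurable_compose[where g = of_real and N = borel])
     (auto intro!: borel_measurable_continuous_onI continuous_intros)

lemma act_carrier: "h \<in> borel_measurable P \<Longrightarrow> L0_class P (\<lambda>w. of_real (h w) :: 'k) \<in> carrier (L0 P)"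
  by (simp add: L0_carrier of_real_measurable)

lemma act_closed[simp]: "h \<in> borel_measurable P \<Longrightarrow> x \<in> carrier S \<Longrightarrow> act h x \<in> carrier S"
  by (simp add: act_def act_carrier)

lemma nrm_act:
  assumes h[measurable]: "h \<in> borel_measurable P" and x: "x \<in> carrier S"
  shows "AE w in P. nrm (act h x) w = \<bar>h w\<bar> * nrm x w"
proof -
  note [measurable] = of_real_measurable[OF h] nrm_measurable[OF x]
  have "L0_map P norm (L0_class P (\<lambda>w. of_real (h w) :: 'k)) = L0_class P (\<lambda>w. \<bar>h w\<bar>)"
    unfolding L0_map_def using L0_rep_class(2)[OF of_real_measurable[OF h]]
    by (intro L0_class_cong) (auto elim: AE_mp)
  then have "L0norm S (act h x) = L0_class P (\<lambda>w. \<bar>h w\<bar> * nrm x w)"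
    using x h unfolding act_def
    by (subst L0norm_smult) (auto simp: act_carrier L0norm_nrm intro!: L0_mult_class)
  moreover have "AE w in P. L0_rep (L0_class P (\<lambda>w. \<bar>h w\<bar> * nrm x w)) w = \<bar>h w\<bar> * nrm x w"
    by (rule L0_rep_class) simp
  ultimately show ?thesis by (simp add: nrm_def)
qed

lemma act_add_right:
  "h \<in> borel_measurable P \<Longrightarrow> x \<in> carrier S \<Longrightarrow> y \<in> carrier S
    \<Longrightarrow> act h (x +\<^sub>S y) = act h x +\<^sub>S act h y"
  unfolding act_def by (rule smult_r_distr) (auto simp: act_carrier)

lemma act_add_left:
  assumes "h \<in> borel_measurable P" "k \<in> borel_measurable P" "x \<in> carrier S"
  shows "act (\<lambda>w. h w + k w) x = act h x +\<^sub>S act k x"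
  unfolding act_def using assms
  by (subst smult_l_distr[symmetric]) (auto simp: act_carrier L0_add_class of_real_measurable)

lemma act_act:
  assumes "h \<in> borel_measurable P" "k \<in> borel_measurable P" "x \<in> carrier S"
  shows "act h (act k x) = act (\<lambda>w. h w * k w) x"
  unfolding act_def using assms
  by (subst smult_assoc1[symmetric]) (auto simp: act_carrier L0_mult_class of_real_measurable)

lemma act_one[simp]: "x \<in> carrier S \<Longrightarrow> act (\<lambda>_. 1) x = x"
  using smult_one[of x] by (simp add: act_def L0_def)

lemma act_zero_left[simp]: "x \<in> carrier S \<Longrightarrow> act (\<lambda>_. 0) x = 0\<^sub>S"
  using smult_l_null[of x] by (simp add: act_def L0_zero)

lemma act_zero_right[simp]: "h \<in> borel_measurable P \<Longrightarrow> act h 0\<^sub>S = 0\<^sub>S"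
  by (simp add: act_def act_carrier)

lemma scale_of_real: "scale P S (of_real c) x = act (\<lambda>_. c) x"
  by (simp add: scale_def L0_const_def act_def)

lemma minus_act: "x \<in> carrier S \<Longrightarrow> \<ominus>\<^bsub>S\<^esub> x = act (\<lambda>_. -1) x"
  using act_add_left[of "\<lambda>_. -1" "\<lambda>_. 1" x] by (intro M.minus_equality) auto

lemma act_minus_right:
  assumes "h \<in> borel_measurable P" "x \<in> carrier S" "y \<in> carrier S"
  shows "act h (x -\<^sub>S y) = act h x -\<^sub>S act h y"
  using assms by (simp add: M.minus_eq minus_act act_add_right act_act)

lemma act_minus_left:
  assumes "h \<in> borel_measurable P" "k \<in> borel_measurable P" "x \<in> carrier S"
  shows "act (\<lambda>w. h w - k w) x = act h x -\<^sub>S act k x"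
  using assms act_add_left[of h "\<lambda>w. - 1 * k w" x]
  by (simp add: M.minus_eq minus_act act_act)

lemma nrm_uminus: "x \<in> carrier S \<Longrightarrow> AE w in P. nrm (\<ominus>\<^bsub>S\<^esub> x) w = nrm x w"
  using nrm_act[of "\<lambda>_. -1" x] by (simp add: minus_act)

lemma nrm_zero: "AE w in P. nrm 0\<^sub>S w = 0"
  using nrm_act[of "\<lambda>_. 0" "0\<^sub>S"] by simp

lemma minus_minus_swap:
  "x \<in> carrier S \<Longrightarrow> y \<in> carrier S \<Longrightarrow> \<ominus>\<^bsub>S\<^esub> (x -\<^sub>S y) = y -\<^sub>S x"
  by (simp add: M.minus_eq M.minus_add M.a_comm)

lemma nrm_minus_commute:
  "x \<in> carrier S \<Longrightarrow> y \<in> carrier S \<Longrightarrow> AE w in P. nrm (x -\<^sub>S y) w = nrm (y -\<^sub>S x) w"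
  using nrm_uminus[of "y -\<^sub>S x"] by (simp add: minus_minus_swap)

lemma nrm_sub:
  assumes "x \<in> carrier S" "y \<in> carrier S"
  shows "AE w in P. nrm (x -\<^sub>S y) w \<le> nrm x w + nrm y w"
  using nrm_add[of x "\<ominus>\<^bsub>S\<^esub> y"] nrm_uminus[of y] assms
  unfolding M.minus_eq by (auto elim: AE_mp)

lemma minus_trans: "x \<in> carrier S \<Longrightarrow> y \<in> carrier S \<Longrightarrow> z \<in> carrier S \<Longrightarrow>
   (x -\<^sub>S y) +\<^sub>S (y -\<^sub>S z) = x -\<^sub>S z"
  by (simp add: M.minus_eq M.a_assoc M.r_neg1)

lemma nrm_triangle:
  assumes "x \<in> carrier S" "y \<in> carrier S" "z \<in> carrier S"
  shows "AE w in P. nrm (x -\<^sub>S z) w \<le> nrm (x -\<^sub>S y) w + nrm (y -\<^sub>S z) w"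
  using nrm_add[of "x -\<^sub>S y" "y -\<^sub>S z"] assms by (simp add: minus_trans)

lemma minus_zero_right: "x \<in> carrier S \<Longrightarrow> x -\<^sub>S 0\<^sub>S = x"
  by (simp add: M.minus_eq minus_act)

lemma nrm_le_minus:
  assumes "x \<in> carrier S" "y \<in> carrier S"
  shows "AE w in P. nrm x w \<le> nrm (x -\<^sub>S y) w + nrm y w"
  using nrm_triangle[of x y "0\<^sub>S"] assms by (simp add: minus_zero_right)

lemma add_minus_add:
  assumes "x \<in> carrier S" "y \<in> carrier S" "x' \<in> carrier S" "y' \<in> carrier S"
  shows "(x +\<^sub>S y) -\<^sub>S (x' +\<^sub>S y') = (x -\<^sub>S x') +\<^sub>S (y -\<^sub>S y')"
  using assms by (simp add: M.minus_eq M.minus_add M.a_ac)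

lemma minus_minus_minus:
  assumes "x \<in> carrier S" "y \<in> carrier S" "x' \<in> carrier S" "y' \<in> carrier S"
  shows "(x -\<^sub>S y) -\<^sub>S (x' -\<^sub>S y') = (x -\<^sub>S x') -\<^sub>S (y -\<^sub>S y')"
  using assms by (simp add: M.minus_eq M.minus_add M.a_ac)

lemma minus_self: "x \<in> carrier S \<Longrightarrow> x -\<^sub>S x = 0\<^sub>S"
  by (simp add: M.minus_eq M.r_neg)

lemma minus_eq_zero: "x \<in> carrier S \<Longrightarrow> y \<in> carrier S \<Longrightarrow> x -\<^sub>S y = 0\<^sub>S \<Longrightarrow> x = y"
  using minus_trans[of x y "0\<^sub>S"] by (simp add: minus_zero_right)

lemma add_minus_cancel: "x \<in> carrier S \<Longrightarrow> y \<in> carrier S \<Longrightarrow> y +\<^sub>S (x -\<^sub>S y) = x"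
  by (simp add: M.minus_eq M.a_lcomm M.r_neg)

end

section \<open>Convergence in the module\<close>

lemma (in prob_space) el_ballI:
  assumes z: "z \<in> carrier G" and [measurable]: "L0_rep (L0norm G z) \<in> borel_measurable M"
    and "0 < \<epsilon>" and small: "mag (L0_rep (L0norm G z)) < min \<epsilon> 1 * \<delta>"
  shows "z \<in> el_ball M G \<epsilon> \<delta>"
proof -
  let ?n = "L0_rep (L0norm G z)"
  \<comment> \<open>Markov's inequality for \<open>mag\<close> needs a threshold of at most 1;
    lowering the threshold only shrinks the event whose probability is to be large.\<close>
  define e where "e = min \<epsilon> 1"
  have e: "0 < e" "e \<le> 1" "e \<le> \<epsilon>" using \<open>0 < \<epsilon>\<close> by (auto simp: e_def)
  have "e * prob {w \<in> space M. e \<le> \<bar>?n w\<bar>} < e * \<delta>"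
    using e small unfolding e_def[symmetric] by (rule_tac le_less_trans[OF mag_markov]) simp_all
  then have "prob {w \<in> space M. e \<le> \<bar>?n w\<bar>} < \<delta>" using e by simp
  moreover have "prob {w \<in> space M. e \<le> \<bar>?n w\<bar>} = 1 - prob {w \<in> space M. \<bar>?n w\<bar> < e}"
    by (subst prob_compl[symmetric]) (auto intro!: arg_cong[where f = prob])
  moreover have "prob {w \<in> space M. \<bar>?n w\<bar> < e} \<le> prob {w \<in> space M. ?n w < \<epsilon>}"
    using e by (intro finite_measure_mono) auto
  ultimately show ?thesis using z by (simp add: el_ball_def)
qed

text \<open>Stated for an arbitrary record \<open>G\<close> with the few properties used, so that it
  applies to \<open>S\<close> and also to the domain of the generator with its graph norm, without
  setting up the latter as a random normed module.\<close>

lemma (in prob_space) limitin_el_topologyI: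
  assumes meas: "\<And>z. z \<in> carrier G \<Longrightarrow> L0_rep (L0norm G z) \<in> borel_measurable M"
    and nonneg: "\<And>z. z \<in> carrier G \<Longrightarrow> AE w in M. 0 \<le> L0_rep (L0norm G z) w"
    and add: "\<And>x y. x \<in> carrier G \<Longrightarrow> y \<in> carrier G \<Longrightarrow> x \<oplus>\<^bsub>G\<^esub> y \<in> carrier G"
    and l: "l \<in> carrier G"
    and f: "eventually (\<lambda>s. z s \<in> carrier G \<and> f s = l \<oplus>\<^bsub>G\<^esub> z s) F"
    and z: "((\<lambda>s. mag (L0_rep (L0norm G (z s)))) \<longlongrightarrow> 0) F"
  shows "limitin (el_topology M G) f l F"
proof -
  have op: "openin (el_topology M G) U = el_open M G U" for U
    by (rule openin_el_topology[OF prob_space_axioms meas])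
  have "el_open M G (carrier G)"
    unfolding el_open_def el_ball_def using add by (auto intro!: exI[of _ "1/2"])
  then have "l \<in> topspace (el_topology M G)"
    using l op openin_subset by blast
  moreover have "eventually (\<lambda>s. f s \<in> U) F" if "openin (el_topology M G) U" "l \<in> U" for U
  proof -
    from that obtain \<epsilon> \<delta> where ed: "\<epsilon> > 0" "0 < \<delta>" "\<delta> < 1"
      and U: "\<And>z. z \<in> el_ball M G \<epsilon> \<delta> \<Longrightarrow> l \<oplus>\<^bsub>G\<^esub> z \<in> U"
      unfolding op el_open_def by blast
    have "eventually (\<lambda>s. mag (L0_rep (L0norm G (z s))) < min \<epsilon> 1 * \<delta>) F"
      using ed by (intro order_tendstoD(2)[OF z]) simp
    with f show ?thesis
      by eventually_elim (simp add: U ed el_ballI meas)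
  qed
  ultimately show ?thesis by (simp add: limitin_def)
qed

context random_normed_module
begin

text \<open>By \<open>limitin_iff\<close> this is convergence in the
  (\<epsilon>,\<lambda>)-topology. Membership in the carrier is required only eventually, since the
  functions of time that occur are controlled on nonnegative times only.\<close>

definition conv :: "('b \<Rightarrow> 's) \<Rightarrow> 's \<Rightarrow> 'b filter \<Rightarrow> bool" where
  "conv f l F \<longleftrightarrow> l \<in> carrier S \<and> eventually (\<lambda>s. f s \<in> carrier S) F
     \<and> ((\<lambda>s. mag (nrm (f s -\<^sub>S l))) \<longlongrightarrow> 0) F"

lemma openin_S: "openin (el_topology P S) U \<longleftrightarrow> el_open P S U"
  by (rule openin_el_topology) (simp_all add: prob_space_axioms flip: nrm_def)

lemma mag_nrm_triangle:
  assumes "x \<in> carrier S" "y \<in> carrier S" "z \<in> carrier S"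
  shows "mag (nrm (x -\<^sub>S z)) \<le> mag (nrm (x -\<^sub>S y)) + mag (nrm (y -\<^sub>S z))"
proof (rule mag_le_add)
  show "AE w in P. \<bar>nrm (x -\<^sub>S z) w\<bar> \<le> \<bar>nrm (x -\<^sub>S y) w\<bar> + \<bar>nrm (y -\<^sub>S z) w\<bar>"
    using nrm_triangle[OF assms] nrm_nonneg[OF M.minus_closed[OF assms(1,3)]] by eventually_elim auto
qed (use assms in auto)

lemma mag_nrm_commute:
  "x \<in> carrier S \<Longrightarrow> y \<in> carrier S \<Longrightarrow> mag (nrm (x -\<^sub>S y)) = mag (nrm (y -\<^sub>S x))"
  by (rule mag_cong) (auto intro: nrm_minus_commute)

text \<open>Openness of these balls is what turns a topological limit into a limit for
  \<open>mag\<close>: the ball of each radius about the limit must eventually be entered.\<close>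

lemma el_open_mag_ball:
  assumes "l \<in> carrier S"
  shows "el_open P S {z \<in> carrier S. mag (nrm (z -\<^sub>S l)) < r}"
  unfolding el_open_def
proof (intro conjI ballI)
  fix x assume x: "x \<in> {z \<in> carrier S. mag (nrm (z -\<^sub>S l)) < r}"
  \<comment> \<open>Membership in \<open>el_ball\<close> with both parameters equal to
    \<open>e\<close> gives \<open>mag\<close> below \<open>2 * e\<close>, so a third of the
    remaining slack suffices; the cap 1/2 keeps \<open>e\<close> admissible as a probability
    parameter.\<close>
  define e where "e = min ((r - mag (nrm (x -\<^sub>S l))) / 3) (1 / 2)"
  have e: "0 < e" "e < 1" "mag (nrm (x -\<^sub>S l)) + 2 * e < r"
    using x by (auto simp: e_def min_def field_simps)
  have "x +\<^sub>S z \<in> {z \<in> carrier S. mag (nrm (z -\<^sub>S l)) < r}" if z: "z \<in> el_ball P S e e" for z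
  proof -
    from z have zS: "z \<in> carrier S" and pr: "prob {w \<in> space P. nrm z w < e} > 1 - e"
      by (auto simp: el_ball_def nrm_def)
    note [measurable] = nrm_measurable[OF zS]
    have "prob {w \<in> space P. e \<le> \<bar>nrm z w\<bar>} = prob {w \<in> space P. e \<le> nrm z w}"
      using nrm_nonneg[OF zS] by (intro finite_measure_eq_AE) (auto elim: AE_mp)
    also have "\<dots> = 1 - prob {w \<in> space P. nrm z w < e}"
      by (subst prob_compl[symmetric]) (auto intro!: arg_cong[where f = prob])
    finally have "mag (nrm z) < 2 * e"
      using mag_le_prob[of "nrm z" e] e pr by simp
    moreover have "(x +\<^sub>S z) -\<^sub>S x = z"
      using x zS by (simp add: M.minus_eq M.a_comm[of x z] M.a_assoc M.r_neg)
    then have "mag (nrm ((x +\<^sub>S z) -\<^sub>S l)) \<le> mag (nrm z) + mag (nrm (x -\<^sub>S l))"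
      using mag_nrm_triangle[of "x +\<^sub>S z" x l] x zS assms by simp
    ultimately show ?thesis using e x zS by simp
  qed
  with e show "\<exists>\<epsilon>>0. \<exists>\<delta>. 0 < \<delta> \<and> \<delta> < 1 \<and>
     (\<forall>z\<in>el_ball P S \<epsilon> \<delta>. x +\<^sub>S z \<in> {z \<in> carrier S. mag (nrm (z -\<^sub>S l)) < r})"
    by blast
qed auto

lemma limitin_iff: "limitin (el_topology P S) f l F \<longleftrightarrow> conv f l F"
proof
  assume lim: "limitin (el_topology P S) f l F"
  have "topspace (el_topology P S) \<subseteq> carrier S"
    using openin_S[of "topspace (el_topology P S)"] by (auto simp: el_open_def)
  with lim have l: "l \<in> carrier S" by (auto simp: limitin_def)
  have *: "eventually (\<lambda>s. f s \<in> {z \<in> carrier S. mag (nrm (z -\<^sub>S l)) < r}) F" if "0 < r" for r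
  proof -
    have "l \<in> {z \<in> carrier S. mag (nrm (z -\<^sub>S l)) < r}"
      using l that mag_cong[OF _ _ nrm_zero] by (simp add: minus_self mag_zero)
    then show ?thesis
      using lim el_open_mag_ball[OF l, of r] unfolding limitin_def openin_S by blast
  qed
  have "((\<lambda>s. mag (nrm (f s -\<^sub>S l))) \<longlongrightarrow> 0) F"
  proof (rule order_tendstoI)
    fix r :: real
    show "eventually (\<lambda>s. r < mag (nrm (f s -\<^sub>S l))) F" if "r < 0"
      using that by (auto intro!: always_eventually less_le_trans[OF _ mag_nonneg])
    show "eventually (\<lambda>s. mag (nrm (f s -\<^sub>S l)) < r) F" if "0 < r"
      using *[OF that] by eventually_elim simp
  qed
  with l *[of 1] show "conv f l F" unfolding conv_def by (auto elim: eventually_mono)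
next
  assume conv: "conv f l F"
  show "limitin (el_topology P S) f l F"
  proof (rule limitin_el_topologyI[where z = "\<lambda>s. f s -\<^sub>S l"])
    have "eventually (\<lambda>s. f s \<in> carrier S) F" and l: "l \<in> carrier S"
      using conv by (simp_all add: conv_def)
    then show "eventually (\<lambda>s. f s -\<^sub>S l \<in> carrier S \<and> f s = l +\<^sub>S (f s -\<^sub>S l)) F"
      by (auto elim!: eventually_mono simp: add_minus_cancel)
  qed (use conv in \<open>auto simp: conv_def nrm_nonneg simp flip: nrm_def\<close>)
qed

lemma conv_closed: "conv f l F \<Longrightarrow> l \<in> carrier S"
  by (simp add: conv_def)

lemma conv_cong:
  assumes "eventually (\<lambda>s. f s = g s) F" "conv g l F"
  shows "conv f l F"
proof -
  have "eventually (\<lambda>s. f s \<in> carrier S) F"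
    using assms unfolding conv_def by (auto elim: eventually_elim2)
  moreover have "((\<lambda>s. mag (nrm (f s -\<^sub>S l))) \<longlongrightarrow> 0) F"
  proof (rule Lim_transform_eventually)
    show "((\<lambda>s. mag (nrm (g s -\<^sub>S l))) \<longlongrightarrow> 0) F"
      using assms(2) by (simp add: conv_def)
    show "eventually (\<lambda>s. mag (nrm (g s -\<^sub>S l)) = mag (nrm (f s -\<^sub>S l))) F"
      using assms(1) by eventually_elim simp
  qed
  ultimately show ?thesis using assms(2) by (simp add: conv_def)
qed

lemma convI_mag_le:
  assumes "l \<in> carrier S" "eventually (\<lambda>s. f s \<in> carrier S) F"
    and "eventually (\<lambda>s. mag (nrm (f s -\<^sub>S l)) \<le> g s) F" "(g \<longlongrightarrow> 0) F"
  shows "conv f l F"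
  using assms tendsto_sandwich[OF _ assms(3) tendsto_const assms(4)]
  by (simp add: conv_def mag_nonneg)

lemma convI_nrm_le:
  assumes "l \<in> carrier S" "eventually (\<lambda>s. f s \<in> carrier S) F"
    and "eventually (\<lambda>s. g s \<in> borel_measurable P) F"
    and "eventually (\<lambda>s. AE w in P. nrm (f s -\<^sub>S l) w \<le> \<bar>g s w\<bar>) F" "((\<lambda>s. mag (g s)) \<longlongrightarrow> 0) F"
  shows "conv f l F"
proof (rule convI_mag_le[OF assms(1,2) _ assms(5)])
  show "eventually (\<lambda>s. mag (nrm (f s -\<^sub>S l)) \<le> mag (g s)) F"
    using assms(2,3,4)
  proof eventually_elim
    case (elim s)
    have "AE w in P. \<bar>nrm (f s -\<^sub>S l) w\<bar> \<le> \<bar>g s w\<bar>"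
      using elim(3) nrm_nonneg[of "f s -\<^sub>S l"] elim assms(1) by auto
    with elim assms(1) show ?case by (intro mag_mono) auto
  qed
qed

lemma convI_Lipschitz:
  assumes "l \<in> carrier S" "eventually (\<lambda>s. f s \<in> carrier S) F" "h \<in> borel_measurable P"
    and "eventually (\<lambda>s. AE w in P. nrm (f s -\<^sub>S l) w \<le> h w * \<bar>c s\<bar>) F" "(c \<longlongrightarrow> 0) F"
  shows "conv f l F"
proof (rule convI_nrm_le[OF assms(1,2)])
  show "((\<lambda>s. mag (\<lambda>w. h w * c s)) \<longlongrightarrow> 0) F"
    by (rule mag_const_mult_tendsto) fact+
  show "eventually (\<lambda>s. AE w in P. nrm (f s -\<^sub>S l) w \<le> \<bar>h w * c s\<bar>) F"
    using assms(4)
  proof eventually_elim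
    case (elim s)
    then show ?case
    proof eventually_elim
      case (elim w)
      have "h w * \<bar>c s\<bar> \<le> \<bar>h w * c s\<bar>" by (simp add: abs_mult mult_right_mono)
      with elim show ?case by linarith
    qed
  qed
qed (use assms(3) in simp)

lemma conv_const: "l \<in> carrier S \<Longrightarrow> conv (\<lambda>_. l) l F"
  using mag_cong[OF _ _ nrm_zero] by (simp add: conv_def minus_self mag_zero)

lemma conv_unique:
  assumes "conv f l F" "conv f l' F" "F \<noteq> bot"
  shows "l = l'"
proof -
  have l: "l \<in> carrier S" "l' \<in> carrier S" using assms by (auto simp: conv_def)
  have "((\<lambda>s. mag (nrm (f s -\<^sub>S l)) + mag (nrm (f s -\<^sub>S l'))) \<longlongrightarrow> 0 + 0) F"
    using assms by (intro tendsto_add) (auto simp: conv_def)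
  moreover have "eventually (\<lambda>s. f s \<in> carrier S) F" using assms by (simp add: conv_def)
  then have "eventually (\<lambda>s. mag (nrm (l -\<^sub>S l')) \<le> mag (nrm (f s -\<^sub>S l)) + mag (nrm (f s -\<^sub>S l'))) F"
    by eventually_elim (metis l mag_nrm_triangle mag_nrm_commute)
  ultimately have "mag (nrm (l -\<^sub>S l')) \<le> 0"
    using tendsto_lowerbound[OF _ _ assms(3)] by fastforce
  then have "mag (nrm (l -\<^sub>S l')) = 0" by (simp add: antisym mag_nonneg)
  then have "AE w in P. nrm (l -\<^sub>S l') w = 0" using l by (intro mag_eq_0) auto
  then have "l -\<^sub>S l' = 0\<^sub>S" using l by (intro nrm_eq_0) auto
  with l show ?thesis by (rule minus_eq_zero)
qed

lemma conv_add:
  assumes f: "conv f l F" and g: "conv g k F"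
  shows "conv (\<lambda>s. f s +\<^sub>S g s) (l +\<^sub>S k) F"
proof (rule convI_mag_le)
  have l: "l \<in> carrier S" "k \<in> carrier S" using assms by (auto simp: conv_def)
  then show "l +\<^sub>S k \<in> carrier S" by simp
  have ev: "eventually (\<lambda>s. f s \<in> carrier S) F" "eventually (\<lambda>s. g s \<in> carrier S) F"
    using assms by (auto simp: conv_def)
  then show "eventually (\<lambda>s. f s +\<^sub>S g s \<in> carrier S) F" by eventually_elim simp
  show "eventually (\<lambda>s. mag (nrm (f s +\<^sub>S g s -\<^sub>S (l +\<^sub>S k)))
      \<le> mag (nrm (f s -\<^sub>S l)) + mag (nrm (g s -\<^sub>S k))) F"
    using ev
  proof eventually_elim
    case (elim s)
    then have "f s -\<^sub>S l \<in> carrier S" "g s -\<^sub>S k \<in> carrier S" using l by auto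
    from nrm_add[OF this] nrm_nonneg[OF M.a_closed[OF this]]
    have "AE w in P. \<bar>nrm (f s -\<^sub>S l +\<^sub>S (g s -\<^sub>S k)) w\<bar>
        \<le> \<bar>nrm (f s -\<^sub>S l) w\<bar> + \<bar>nrm (g s -\<^sub>S k) w\<bar>"
      by eventually_elim auto
    then show ?case using elim l by (subst add_minus_add) (auto intro!: mag_le_add)
  qed
  show "((\<lambda>s. mag (nrm (f s -\<^sub>S l)) + mag (nrm (g s -\<^sub>S k))) \<longlongrightarrow> 0) F"
    using tendsto_add_zero assms by (auto simp: conv_def)
qed

text \<open>With \<open>d = f s - l\<close> the difference is
  \<open>g s * d + (g s - h) * l\<close>, and \<open>g s * d\<close> splits into
  \<open>(g s - h) * d\<close> and \<open>h * d\<close>. The terms with a fixed factor,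
  \<open>h\<close> or \<open>nrm l\<close>, fall under \<open>mag_mult_tendsto\<close>, the one with
  two varying factors under \<open>mag_le_mult\<close>.\<close>

lemma conv_act_var:
  assumes f: "conv f l F" and h: "h \<in> borel_measurable P"
    and g: "eventually (\<lambda>s. g s \<in> borel_measurable P) F" and gh: "((\<lambda>s. mag (\<lambda>w. g s w - h w)) \<longlongrightarrow> 0) F"
  shows "conv (\<lambda>s. act (g s) (f s)) (act h l) F"
proof (rule convI_mag_le)
  note [measurable] = h
  have l: "l \<in> carrier S" using f by (auto simp: conv_def)
  note [measurable] = nrm_measurable[OF l]
  show "act h l \<in> carrier S" using l h by simp
  have ev: "eventually (\<lambda>s. f s \<in> carrier S) F" using f by (auto simp: conv_def)
  with g show "eventually (\<lambda>s. act (g s) (f s) \<in> carrier S) F" by eventually_elim simp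
  let ?b = "\<lambda>s. ((mag (\<lambda>w. g s w - h w) + mag (nrm (f s -\<^sub>S l)))
       + mag (\<lambda>w. h w * nrm (f s -\<^sub>S l) w)) + mag (\<lambda>w. nrm l w * (g s w - h w))"
  show "eventually (\<lambda>s. mag (nrm (act (g s) (f s) -\<^sub>S act h l)) \<le> ?b s) F"
    using ev g
  proof eventually_elim
    case (elim s)
    note [measurable] = elim(2)
    define d where "d = f s -\<^sub>S l"
    have d: "d \<in> carrier S" using elim l by (simp add: d_def)
    note [measurable] = nrm_measurable[OF d]
    have "act (g s) (f s) -\<^sub>S act h l = (act (g s) (f s) -\<^sub>S act (g s) l) +\<^sub>S (act (g s) l -\<^sub>S act h l)"
      using elim l h by (simp add: minus_trans)
    also have "\<dots> = act (g s) d +\<^sub>S act (\<lambda>w. g s w - h w) l"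
      using elim l h by (simp add: d_def act_minus_left act_minus_right)
    finally have eq: "act (g s) (f s) -\<^sub>S act h l = act (g s) d +\<^sub>S act (\<lambda>w. g s w - h w) l" .
    have c: "act (g s) (f s) -\<^sub>S act h l \<in> carrier S" using elim l h by simp
    have 1: "AE w in P. nrm (act (g s) (f s) -\<^sub>S act h l) w
        \<le> \<bar>g s w\<bar> * nrm d w + \<bar>g s w - h w\<bar> * nrm l w"
      using nrm_add[of "act (g s) d" "act (\<lambda>w. g s w - h w) l"] nrm_act[of "g s" d]
        nrm_act[of "\<lambda>w. g s w - h w" l] d l unfolding eq by (auto elim!: AE_mp)
    let ?m = "\<lambda>w. g s w - h w"
    have "mag (nrm (act (g s) (f s) -\<^sub>S act h l))
       \<le> mag (\<lambda>w. g s w * nrm d w) + mag (\<lambda>w. nrm l w * ?m w)"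
      using 1 nrm_nonneg[OF c] nrm_nonneg[OF d] nrm_nonneg[OF l]
      by (intro mag_le_add) (use c in \<open>auto elim!: AE_mp simp: abs_mult mult.commute\<close>)
    moreover have "mag (\<lambda>w. g s w * nrm d w) \<le> mag (\<lambda>w. ?m w * nrm d w) + mag (\<lambda>w. h w * nrm d w)"
    proof (intro mag_le_add AE_I2)
      fix w
      have "g s w * nrm d w = ?m w * nrm d w + h w * nrm d w" by (simp add: algebra_simps)
      then show "\<bar>g s w * nrm d w\<bar> \<le> \<bar>?m w * nrm d w\<bar> + \<bar>h w * nrm d w\<bar>"
        by (metis abs_triangle_ineq)
    qed simp_all
    moreover have "mag (\<lambda>w. ?m w * nrm d w) \<le> mag ?m + mag (nrm d)"
      by (intro mag_le_mult) (auto simp: abs_mult)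
    ultimately show ?case unfolding d_def by linarith
  qed
  have d0: "((\<lambda>s. mag (nrm (f s -\<^sub>S l))) \<longlongrightarrow> 0) F" using f by (simp add: conv_def)
  have t1: "((\<lambda>s. mag (\<lambda>w. h w * nrm (f s -\<^sub>S l) w)) \<longlongrightarrow> 0) F"
    by (rule mag_mult_tendsto[OF h _ d0], use ev in eventually_elim) (simp add: l)
  have t2: "((\<lambda>s. mag (\<lambda>w. nrm l w * (g s w - h w))) \<longlongrightarrow> 0) F"
    by (rule mag_mult_tendsto[OF nrm_measurable[OF l] _ gh], use g in eventually_elim) (simp add: h)
  show "(?b \<longlongrightarrow> 0) F"
    using tendsto_add[OF tendsto_add[OF tendsto_add[OF gh d0] t1] t2] by simp
qed

lemma conv_act:
  assumes "conv f l F" "h \<in> borel_measurable P"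
  shows "conv (\<lambda>s. act h (f s)) (act h l) F"
  using conv_act_var[OF assms, of "\<lambda>_. h"] assms(2) by (simp add: mag_zero)

lemma conv_minus:
  assumes "conv f l F" "conv g k F"
  shows "conv (\<lambda>s. f s -\<^sub>S g s) (l -\<^sub>S k) F"
proof (rule conv_cong)
  show "conv (\<lambda>s. f s +\<^sub>S act (\<lambda>_. -1) (g s)) (l -\<^sub>S k) F"
    using conv_add[OF assms(1) conv_act[OF assms(2), of "\<lambda>_. -1"]] conv_closed[OF assms(2)]
    by (simp add: M.minus_eq minus_act)
  show "eventually (\<lambda>s. f s -\<^sub>S g s = f s +\<^sub>S act (\<lambda>_. -1) (g s)) F"
    using assms(2) unfolding conv_def by (auto elim!: eventually_mono simp: M.minus_eq minus_act)
qed

lemma conv_filterlim: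
  assumes "conv f l G" "filterlim g G F"
  shows "conv (\<lambda>s. f (g s)) l F"
  unfolding conv_def
proof (intro conjI)
  show "((\<lambda>s. mag (nrm (f (g s) -\<^sub>S l))) \<longlongrightarrow> 0) F"
    using assms filterlim_compose[of "\<lambda>s. mag (nrm (f s -\<^sub>S l))"] by (auto simp: conv_def)
  show "eventually (\<lambda>s. f (g s) \<in> carrier S) F"
    using assms unfolding conv_def filterlim_iff by blast
qed (use assms in \<open>simp add: conv_def\<close>)

lemma conv_mono_filter: "conv f l G \<Longrightarrow> F \<le> G \<Longrightarrow> conv f l F"
  using conv_filterlim[of f l G "\<lambda>x. x" F] by (simp add: filterlim_def)

text \<open>Eventually the positive part of \<open>nrm l - b\<close> is at most
  \<open>nrm (f s - l)\<close>, whose \<open>mag\<close> tends to 0, so it vanishes almost surely.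
  This is how almost-sure bounds survive limits in probability.\<close>

lemma conv_nrm_le:
  assumes f: "conv f l F" "F \<noteq> bot" and b[measurable]: "b \<in> borel_measurable P"
    and "eventually (\<lambda>s. AE w in P. nrm (f s) w \<le> b w) F"
  shows "AE w in P. nrm l w \<le> b w"
proof -
  have l: "l \<in> carrier S" using f by (auto simp: conv_def)
  note [measurable] = nrm_measurable[OF l]
  let ?g = "\<lambda>w. max 0 (nrm l w - b w)"
  have "eventually (\<lambda>s. f s \<in> carrier S) F" using f by (auto simp: conv_def)
  with assms(4) have "eventually (\<lambda>s. mag ?g \<le> mag (nrm (f s -\<^sub>S l))) F"
  proof eventually_elim
    case (elim s)
    have "AE w in P. \<bar>?g w\<bar> \<le> \<bar>nrm (f s -\<^sub>S l) w\<bar>"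
      using elim(1) nrm_le_minus[OF l elim(2)] nrm_minus_commute[OF l elim(2)]
      by eventually_elim auto
    then show ?case using elim l by (intro mag_mono) auto
  qed
  moreover have "((\<lambda>s. mag (nrm (f s -\<^sub>S l))) \<longlongrightarrow> 0) F" using f by (simp add: conv_def)
  ultimately have "mag ?g \<le> 0" using tendsto_lowerbound f(2) by blast
  then have "mag ?g = 0" by (simp add: antisym mag_nonneg)
  then have "AE w in P. ?g w = 0" by (intro mag_eq_0) auto
  then show ?thesis by eventually_elim (auto simp: max_def split: if_splits)
qed

lemma complete_mag:
  assumes "el_complete P S" and x: "\<And>n. x n \<in> carrier S"
    and cauchy: "\<And>e. 0 < e \<Longrightarrow> \<exists>N. \<forall>m\<ge>N. \<forall>n\<ge>N. mag (nrm (x m -\<^sub>S x n)) < e"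
  shows "\<exists>l. conv x l sequentially"
proof -
  have "el_Cauchy P S x"
    unfolding el_Cauchy_def
  proof (intro conjI allI impI)
    fix \<epsilon> \<delta> :: real assume "0 < \<epsilon>" and \<delta>: "0 < \<delta> \<and> \<delta> < 1"
    then obtain N where N: "\<And>m n. m \<ge> N \<Longrightarrow> n \<ge> N \<Longrightarrow> mag (nrm (x m -\<^sub>S x n)) < min \<epsilon> 1 * \<delta>"
      using cauchy[of "min \<epsilon> 1 * \<delta>"] by auto
    have "x m -\<^sub>S x n \<in> el_ball P S \<epsilon> \<delta>" if "m \<ge> N" "n \<ge> N" for m n
      using N[OF that] x \<open>0 < \<epsilon>\<close> by (intro el_ballI) (simp_all flip: nrm_def)
    then show "\<exists>N. \<forall>m\<ge>N. \<forall>n\<ge>N. x m -\<^sub>S x n \<in> el_ball P S \<epsilon> \<delta>" by blast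
  qed (use x in auto)
  with assms(1) show ?thesis by (simp add: el_complete_def limitin_iff)
qed

section \<open>Almost surely bounded operators\<close>

text \<open>The bound is an explicit random variable, so that one and the same \<open>b\<close> can
  dominate a whole family of operators. Compatibility with scalars is a separate matter, settled by
  \<open>bdd_additive_act\<close>.\<close>

definition bdd_additive :: "('w \<Rightarrow> real) \<Rightarrow> ('s \<Rightarrow> 's) \<Rightarrow> bool" where
  "bdd_additive b T \<longleftrightarrow> b \<in> borel_measurable P \<and> (\<forall>x\<in>carrier S. T x \<in> carrier S)
     \<and> (\<forall>x\<in>carrier S. \<forall>y\<in>carrier S. T (x +\<^sub>S y) = T x +\<^sub>S T y)
     \<and> (\<forall>x\<in>carrier S. AE w in P. nrm (T x) w \<le> b w * nrm x w)"

lemma bdd_additiveD: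
  assumes "bdd_additive b T"
  shows "b \<in> borel_measurable P" "x \<in> carrier S \<Longrightarrow> T x \<in> carrier S"
    "x \<in> carrier S \<Longrightarrow> y \<in> carrier S \<Longrightarrow> T (x +\<^sub>S y) = T x +\<^sub>S T y"
    "x \<in> carrier S \<Longrightarrow> AE w in P. nrm (T x) w \<le> b w * nrm x w"
  using assms by (auto simp: bdd_additive_def)

lemma bdd_additive_minus:
  assumes "bdd_additive b T" "x \<in> carrier S" "y \<in> carrier S"
  shows "T (x -\<^sub>S y) = T x -\<^sub>S T y"
proof -
  have "T x = T y +\<^sub>S T (x -\<^sub>S y)"
    using bdd_additiveD(3)[OF assms(1), of y "x -\<^sub>S y"] assms by (simp add: add_minus_cancel)
  moreover have "T y \<in> carrier S" "T (x -\<^sub>S y) \<in> carrier S"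
    using assms by (auto intro: bdd_additiveD(2))
  ultimately show ?thesis
    by (simp add: M.minus_eq M.a_comm[of "T y"] M.a_assoc M.r_neg)
qed

lemma bdd_additive_zero: "bdd_additive b T \<Longrightarrow> T 0\<^sub>S = 0\<^sub>S"
  using bdd_additive_minus[of b T "0\<^sub>S" "0\<^sub>S"] bdd_additiveD(2)[of b T "0\<^sub>S"]
  by (simp add: minus_self)

text \<open>The common bound makes the family equicontinuous: in
  \<open>T s (f s) = T s (f s - l) + T s l\<close> the first summand tends to 0. The intended case
  is a semigroup operator at a moving time, applied to a difference quotient.\<close>

lemma conv_op_family:
  assumes f: "conv f l F" and T: "eventually (\<lambda>s. bdd_additive b (T s)) F"
    and k: "conv (\<lambda>s. T s l) k F"
  shows "conv (\<lambda>s. T s (f s)) k F"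
proof (cases "F = bot")
  case True
  then show ?thesis using k by (simp add: conv_def)
next
  case False
  have b: "b \<in> borel_measurable P"
    using T bdd_additiveD(1) False eventually_happens by blast
  have l: "l \<in> carrier S" and ev: "eventually (\<lambda>s. f s \<in> carrier S) F"
    and f0: "((\<lambda>s. mag (nrm (f s -\<^sub>S l))) \<longlongrightarrow> 0) F"
    using f by (auto simp: conv_def)
  have "conv (\<lambda>s. T s (f s -\<^sub>S l)) 0\<^sub>S F"
  proof (rule convI_nrm_le[OF _ _ _ _ mag_mult_tendsto[OF b _ f0]])
    show "eventually (\<lambda>s. nrm (f s -\<^sub>S l) \<in> borel_measurable P) F"
      using ev by eventually_elim (simp add: l)
    show "eventually (\<lambda>s. (\<lambda>w. b w * nrm (f s -\<^sub>S l) w) \<in> borel_measurable P) F"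
      using ev by eventually_elim (intro borel_measurable_times b nrm_measurable, simp add: l)
    show "eventually (\<lambda>s. T s (f s -\<^sub>S l) \<in> carrier S) F"
      using ev T by eventually_elim (simp add: l bdd_additiveD(2))
    show "eventually (\<lambda>s. AE w in P. nrm (T s (f s -\<^sub>S l) -\<^sub>S 0\<^sub>S) w \<le> \<bar>b w * nrm (f s -\<^sub>S l) w\<bar>) F"
      using ev T
    proof eventually_elim
      case (elim s)
      then have "f s -\<^sub>S l \<in> carrier S" using l by simp
      from bdd_additiveD(2,4)[OF elim(2) this] show ?case by (auto simp: minus_zero_right)
    qed
  qed simp
  then have "conv (\<lambda>s. T s (f s -\<^sub>S l) +\<^sub>S T s l) k F"
    using conv_add[OF _ k] conv_closed[OF k] by fastforce
  then show ?thesis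
  proof (rule conv_cong[rotated])
    show "eventually (\<lambda>s. T s (f s) = T s (f s -\<^sub>S l) +\<^sub>S T s l) F"
      using ev T
    proof eventually_elim
      case (elim s)
      then show ?case
        using bdd_additiveD(3)[OF elim(2), of "f s -\<^sub>S l" l] l
        by (simp add: M.a_comm[of "f s -\<^sub>S l" l] add_minus_cancel)
    qed
  qed
qed

lemma conv_op:
  assumes "conv f l F" "bdd_additive b T"
  shows "conv (\<lambda>s. T (f s)) (T l) F"
  using conv_op_family[OF assms(1), of b "\<lambda>_. T" "T l"] conv_const[of "T l" F] assms(2)
    bdd_additiveD(2)[OF assms(2) conv_closed[OF assms(1)]] by simp

text \<open>The bound makes \<open>T\<close> local: multiplying by \<open>a'\<close> before and by
  \<open>a\<close> after leaves a norm of at most \<open>\<bar>a * a'\<bar> * (b * nrm x)\<close>,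
  which is 0 for disjoint supports. So \<open>T\<close> commutes with indicators, with simple
  functions by real homogeneity and additivity, and with their monotone limits by
  continuity.\<close>

lemma bdd_additive_act:
  assumes T: "bdd_additive b T"
    and const: "\<And>c x. x \<in> carrier S \<Longrightarrow> T (act (\<lambda>_. c) x) = act (\<lambda>_. c) (T x)"
    and h: "h \<in> borel_measurable P" and "x \<in> carrier S"
  shows "T (act h x) = act h (T x)"
proof -
  note TD = bdd_additiveD[OF T]
  let ?good = "\<lambda>h. \<forall>x\<in>carrier S. T (act h x) = act h (T x)"
  have disjoint: "act a (T (act a' x)) = 0\<^sub>S"
    if a: "a \<in> borel_measurable P" "a' \<in> borel_measurable P" "\<And>w. a w * a' w = 0" and x: "x \<in> carrier S"
    for a a' x
  proof (rule nrm_eq_0)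
    show c: "act a (T (act a' x)) \<in> carrier S" using a x by (simp add: TD)
    have "act a' x \<in> carrier S" using a x by simp
    note T' = TD(2,4)[OF this]
    have "AE w in P. nrm (act a (T (act a' x))) w \<le> 0"
      using nrm_act[OF a(1) T'(1)] T'(2) nrm_act[OF a(2) x]
    proof eventually_elim
      case (elim w)
      have "\<bar>a w\<bar> * nrm (T (act a' x)) w \<le> \<bar>a w\<bar> * (b w * (\<bar>a' w\<bar> * nrm x w))"
        using elim by (intro mult_left_mono) auto
      also have "\<dots> = \<bar>a w * a' w\<bar> * (b w * nrm x w)" by (simp add: abs_mult mult_ac)
      finally show ?case using elim a(3) by simp
    qed
    with nrm_nonneg[OF c] show "AE w in P. nrm (act a (T (act a' x))) w = 0"
      by eventually_elim simp
  qed
  have nonneg: "?good u" if u: "u \<in> borel_measurable P" "\<And>w. 0 \<le> u w" for u :: "'w \<Rightarrow> real"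
    using u
  proof (induction rule: borel_measurable_induct_real)
    case (set A)
    show ?case
    proof
      fix x assume x: "x \<in> carrier S"
      define a a' :: "'w \<Rightarrow> real" where "a = indicator A" and "a' = (\<lambda>w. 1 - indicator A w)"
      have a: "a \<in> borel_measurable P" "a' \<in> borel_measurable P" "\<And>w. a w * a' w = 0" "\<And>w. a' w * a w = 0"
        "\<And>w. a w + a' w = 1"
        using set by (auto simp: a_def a'_def indicator_def)
      have split: "act a y +\<^sub>S act a' y = y" if "y \<in> carrier S" for y
        using act_add_left[of a a' y] a that by simp
      \<comment> \<open>The decomposition \<open>a + a' = 1\<close> is inserted after
        \<open>T\<close> and then before it; both mixed terms vanish by disjointness.\<close>
      have "T (act a x) = act a (T (act a x))"
        using split[of "T (act a x)"] disjoint[of a' a x] a x by (simp add: TD)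
      also have "\<dots> = act a (T (act a x) +\<^sub>S T (act a' x))"
        using disjoint[of a a' x] a x by (simp add: TD act_add_right)
      also have "\<dots> = act a (T x)"
        using split[OF x] a x by (simp add: TD flip: TD(3))
      finally show "T (act (indicator A) x) = act (indicator A) (T x)" by (simp add: a_def)
    qed
  next
    case (mult u c)
    have "T (act (\<lambda>w. c * u w) x) = act (\<lambda>w. c * u w) (T x)" if x: "x \<in> carrier S" for x
      using mult(2,4) x const[of "act u x" c] act_act[of "\<lambda>_. c" u] by (simp add: TD)
    then show ?case by simp
  next
    case (add u v)
    then show ?case by (simp add: act_add_left TD)
  next
    case (seq U)
    show ?case
    proof
      fix x assume x: "x \<in> carrier S"
      have lim: "conv (\<lambda>i. act (U i) y) (act u y) sequentially" if "y \<in> carrier S" for y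
      proof (rule conv_act_var[OF conv_const[OF that]])
        show "(\<lambda>i. mag (\<lambda>w. U i w - u w)) \<longlonglongrightarrow> 0"
        proof (rule mag_tendsto_AE)
          show "AE w in P. (\<lambda>i. U i w - u w) \<longlonglongrightarrow> 0"
            using seq(4) by (auto intro!: AE_I2 simp: LIM_zero)
        qed (use seq(1) u(1) in simp)
      qed (use seq(1) u(1) in simp_all)
      have "conv (\<lambda>i. T (act (U i) x)) (T (act u x)) sequentially"
        by (rule conv_op[OF lim[OF x] T])
      moreover have "conv (\<lambda>i. T (act (U i) x)) (act u (T x)) sequentially"
        using lim[OF TD(2)[OF x]] seq x by simp
      ultimately show "T (act u x) = act u (T x)"
        by (rule conv_unique) simp
    qed
  qed
  have eq: "h = (\<lambda>w. max 0 (h w) - max 0 (- h w))" by (auto simp: max_def)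
  have x': "act (\<lambda>w. max 0 (h w)) x \<in> carrier S" "act (\<lambda>w. max 0 (- h w)) x \<in> carrier S"
    using h assms(4) by auto
  have "T (act (\<lambda>w. max 0 (h w) - max 0 (- h w)) x) = act (\<lambda>w. max 0 (h w) - max 0 (- h w)) (T x)"
    using h assms(4) nonneg[of "\<lambda>w. max 0 (h w)"] nonneg[of "\<lambda>w. max 0 (- h w)"] x'
    by (simp add: act_minus_left bdd_additive_minus[OF T] TD)
  then show ?thesis unfolding eq[symmetric] .
qed

lemma L0_rep_mult:
  fixes X Y :: "('w \<Rightarrow> real) set"
  assumes "X \<in> carrier (L0 P)" "Y \<in> carrier (L0 P)"
  shows "AE w in P. L0_rep (X \<otimes>\<^bsub>L0 P\<^esub> Y) w = L0_rep X w * L0_rep Y w"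
proof -
  note [measurable] = L0_class_rep(1)[OF assms(1)] L0_class_rep(1)[OF assms(2)]
  have "X \<otimes>\<^bsub>L0 P\<^esub> Y = L0_class P (\<lambda>w. L0_rep X w * L0_rep Y w)"
    by (simp add: L0_def)
  then show ?thesis using L0_rep_class(2)[of "\<lambda>w. L0_rep X w * L0_rep Y w" P] by simp
qed

lemma L0_plus_iff: "X \<in> L0_plus P \<longleftrightarrow> X \<in> carrier (L0 P) \<and> (AE w in P. 0 \<le> L0_rep X w)"
proof -
  have "AE w in P. L0_rep (L0_class P (\<lambda>_. 0 :: real)) w = 0"
    by (rule L0_rep_class) simp
  then show ?thesis by (auto simp: L0_plus_def L0_le_def L0_zero elim: AE_mp)
qed

lemma op_bounds_iff:
  assumes "\<And>z. z \<in> carrier S \<Longrightarrow> T z \<in> carrier S"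
  shows "X \<in> op_bounds P S T \<longleftrightarrow> X \<in> carrier (L0 P) \<and> (AE w in P. 0 \<le> L0_rep X w)
    \<and> (\<forall>z\<in>carrier S. AE w in P. nrm (T z) w \<le> L0_rep X w * nrm z w)"
proof -
  have "L0_le P (L0norm S (T z)) (X \<otimes>\<^bsub>L0 P\<^esub> L0norm S z)
      \<longleftrightarrow> (AE w in P. nrm (T z) w \<le> L0_rep X w * nrm z w)"
    if "X \<in> carrier (L0 P)" "z \<in> carrier S" for z
    using L0_rep_mult[OF that(1) L0norm_carrier[OF that(2)]]
    unfolding L0_le_def nrm_def by (auto elim: AE_mp)
  then show ?thesis unfolding op_bounds_def L0_plus_iff by blast
qed

text \<open>The set of bounds of an operator is closed under countable infima, so a bound minimizing the
  expectation of a strictly increasing bounded function is the least one.\<close>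

lemma op_bounds_least:
  assumes T: "\<And>z. z \<in> carrier S \<Longrightarrow> T z \<in> carrier S" and ne: "op_bounds P S T \<noteq> {}"
  shows "\<exists>X\<in>op_bounds P S T. \<forall>Y\<in>op_bounds P S T. L0_le P X Y"
proof -
  define B where "B = {h \<in> borel_measurable P. (\<forall>w. 0 \<le> h w)
     \<and> (\<forall>z\<in>carrier S. AE w in P. nrm (T z) w \<le> h w * nrm z w)}"
  define J where "J h = expectation (\<lambda>w. arctan (h w))" for h
  have arctan_abs: "\<bar>arctan y\<bar> \<le> pi / 2" for y using arctan_bounded[of y] by linarith
  have int: "integrable P (\<lambda>w. arctan (h w))" if "h \<in> borel_measurable P" for h
    by (rule integrable_const_bound[where B = "pi / 2"]) (use that arctan_abs in auto)
  have BI: "(\<lambda>w. max 0 (L0_rep X w)) \<in> B" if "X \<in> op_bounds P S T" for X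
  proof -
    have X: "X \<in> carrier (L0 P)" "AE w in P. 0 \<le> L0_rep X w"
      "\<And>z. z \<in> carrier S \<Longrightarrow> AE w in P. nrm (T z) w \<le> L0_rep X w * nrm z w"
      using that by (auto simp: op_bounds_iff[OF T])
    have "AE w in P. nrm (T z) w \<le> max 0 (L0_rep X w) * nrm z w" if "z \<in> carrier S" for z
      using X(2) X(3)[OF that] by eventually_elim (simp add: max_def)
    with L0_class_rep(1)[OF X(1)] show ?thesis by (simp add: B_def)
  qed
  have bdd: "bdd_below (J ` B)"
  proof (rule bdd_belowI)
    fix y assume "y \<in> J ` B"
    then show "0 \<le> y" by (auto simp: J_def B_def intro!: integral_nonneg_AE)
  qed
  have neB: "J ` B \<noteq> {}" using ne BI by auto
  have "\<exists>h\<in>B. J h < Inf (J ` B) + 1 / real (Suc n)" for n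
    using cInf_lessD[OF neB, of "Inf (J ` B) + 1 / real (Suc n)"] by auto
  then obtain h where h: "\<And>n. h n \<in> B" "\<And>n. J (h n) < Inf (J ` B) + 1 / real (Suc n)" by metis
  have hm[measurable]: "h n \<in> borel_measurable P" and h0: "0 \<le> h n w" for n w
    using h(1)[of n] by (auto simp: B_def)
  define i where "i w = (INF n. h n w)" for w
  have bdd_h: "bdd_below (range (\<lambda>n. h n w))" for w by (rule bdd_belowI[of _ 0]) (use h0 in auto)
  have im[measurable]: "i \<in> borel_measurable P"
    unfolding i_def by (rule borel_measurable_cINF) (use bdd_h in auto)
  have i_le: "i w \<le> h n w" for w n unfolding i_def by (rule cINF_lower[OF bdd_h]) simp
  have i0: "0 \<le> i w" for w unfolding i_def by (rule cINF_greatest) (use h0 in auto)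
  have iB: "i \<in> B"
  proof -
    have "AE w in P. nrm (T z) w \<le> i w * nrm z w" if z: "z \<in> carrier S" for z
    proof -
      have "AE w in P. \<forall>n. nrm (T z) w \<le> h n w * nrm z w"
        using h(1) z by (auto simp: AE_all_countable B_def)
      with nrm_nonneg[OF z] show ?thesis
      proof eventually_elim
        case (elim w)
        \<comment> \<open>Where \<open>nrm z w\<close> is positive, division turns the bounds by
          \<open>h n w\<close> into a common lower bound of the sequence, hence of its infimum;
          where it vanishes, every factor gives the same inequality.\<close>
        show ?case
        proof (cases "nrm z w = 0")
          case False
          with elim have "0 < nrm z w" by simp
          with elim have "nrm (T z) w / nrm z w \<le> i w"
            unfolding i_def by (intro cINF_greatest) (auto simp: divide_le_eq)
          with \<open>0 < nrm z w\<close> show ?thesis by (simp add: divide_le_eq)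
        qed (use elim in auto)
      qed
    qed
    with im i0 show ?thesis by (simp add: B_def)
  qed
  have least: "AE w in P. i w \<le> k w" if k: "k \<in> B" for k
  proof -
    have [measurable]: "k \<in> borel_measurable P" using k by (simp add: B_def)
    \<comment> \<open>The minimum with a competitor is again a bound, so its value of
      \<open>J\<close> is not below that of the minimizer \<open>i\<close>; strict monotonicity of
      \<open>arctan\<close> then forces \<open>i \<le> k\<close>.\<close>
    let ?l = "\<lambda>w. min (i w) (k w)"
    have "?l \<in> B"
    proof -
      have "AE w in P. nrm (T z) w \<le> ?l w * nrm z w" if z: "z \<in> carrier S" for z
      proof -
        have "AE w in P. nrm (T z) w \<le> i w * nrm z w" "AE w in P. nrm (T z) w \<le> k w * nrm z w"
          using iB k z by (auto simp: B_def)
        then show ?thesis by eventually_elim (simp add: min_def)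
      qed
      with i0 k show ?thesis by (simp add: B_def)
    qed
    then have "Inf (J ` B) \<le> J ?l" using bdd by (intro cInf_lower) auto
    moreover have "J i \<le> Inf (J ` B)"
    proof (rule LIMSEQ_le_const)
      show "(\<lambda>n. Inf (J ` B) + 1 / real (Suc n)) \<longlonglongrightarrow> Inf (J ` B)"
        using tendsto_add[OF tendsto_const LIMSEQ_Suc[OF lim_const_over_n[of 1]]] by simp
      have "J i \<le> J (h n)" for n
        unfolding J_def by (intro integral_mono int) (auto simp: arctan_le_iff i_le)
      then show "\<exists>N. \<forall>n\<ge>N. J i \<le> Inf (J ` B) + 1 / real (Suc n)"
        using h(2) by (meson less_imp_le order_trans)
    qed
    ultimately have "expectation (\<lambda>w. arctan (i w) - arctan (?l w)) \<le> 0"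
      by (simp add: J_def int)
    moreover have "0 \<le> expectation (\<lambda>w. arctan (i w) - arctan (?l w))"
      by (intro integral_nonneg_AE AE_I2) (simp add: arctan_le_iff)
    ultimately have "expectation (\<lambda>w. arctan (i w) - arctan (?l w)) = 0" by simp
    then have "AE w in P. arctan (i w) - arctan (?l w) = 0"
      by (subst (asm) integral_nonneg_eq_0_iff_AE) (auto simp: int arctan_le_iff)
    then show ?thesis by eventually_elim (simp add: arctan_eq_iff min_def split: if_splits)
  qed
  have rep: "AE w in P. L0_rep (L0_class P i) w = i w" by (rule L0_rep_class(2)[OF im])
  have "AE w in P. nrm (T z) w \<le> L0_rep (L0_class P i) w * nrm z w" if "z \<in> carrier S" for z
  proof -
    have "AE w in P. nrm (T z) w \<le> i w * nrm z w" using iB that by (simp add: B_def)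
    with rep show ?thesis by eventually_elim simp
  qed
  moreover have "AE w in P. 0 \<le> L0_rep (L0_class P i) w" using rep i0 by (auto elim: AE_mp)
  ultimately have "L0_class P i \<in> op_bounds P S T"
    using im by (simp add: op_bounds_iff[OF T] L0_carrier)
  moreover have "L0_le P (L0_class P i) Y" if Y: "Y \<in> op_bounds P S T" for Y
  proof -
    have "AE w in P. 0 \<le> L0_rep Y w" using Y by (simp add: op_bounds_iff[OF T])
    with rep least[OF BI[OF Y]] show ?thesis
      unfolding L0_le_def by eventually_elim simp
  qed
  ultimately show ?thesis by blast
qed

text \<open>\<open>op_L0norm\<close> is a greatest lower bound selected by choice, so one has to
  exist before anything is known about it. The least bound from \<open>op_bounds_least\<close> is
  such an element and lies below the selected one, which is therefore a bound itself.\<close>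

lemma op_L0norm_bound:
  assumes T: "\<And>z. z \<in> carrier S \<Longrightarrow> T z \<in> carrier S" and ne: "op_bounds P S T \<noteq> {}"
    and z: "z \<in> carrier S"
  shows "AE w in P. nrm (T z) w \<le> L0_rep (op_L0norm P S T) w * nrm z w"
proof -
  let ?L = "Lower (L0_order P) (op_bounds P S T)"
  obtain X where X: "X \<in> op_bounds P S T" "\<And>Y. Y \<in> op_bounds P S T \<Longrightarrow> L0_le P X Y"
    using op_bounds_least[OF T ne] by blast
  then have XL: "X \<in> ?L"
    by (auto simp: Lower_def L0_order_def op_bounds_def L0_plus_def)
  have "greatest (L0_order P) X ?L"
    unfolding greatest_def using XL X(1)
    by (auto simp: Lower_def L0_order_def op_bounds_def L0_plus_def)
  then have "greatest (L0_order P) (op_L0norm P S T) ?L"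
    unfolding op_L0norm_def inf_def by (rule someI)
  with XL have "L0_le P X (op_L0norm P S T)"
    by (simp add: greatest_def L0_order_def)
  then have "AE w in P. L0_rep X w \<le> L0_rep (op_L0norm P S T) w" by (simp add: L0_le_def)
  moreover have "AE w in P. nrm (T z) w \<le> L0_rep X w * nrm z w"
    using X(1) z by (simp add: op_bounds_iff[OF T])
  ultimately show ?thesis using nrm_nonneg[OF z]
    by eventually_elim (meson mult_right_mono order_trans)
qed

lemma bounded_opsD:
  assumes "T \<in> bounded_ops P S"
  shows "\<exists>b. bdd_additive b T" "h \<in> borel_measurable P \<Longrightarrow> x \<in> carrier S \<Longrightarrow> T (act h x) = act h (T x)"
    "z \<in> carrier S \<Longrightarrow> AE w in P. nrm (T z) w \<le> L0_rep (op_L0norm P S T) w * nrm z w"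
    "z \<in> carrier S \<Longrightarrow> T z \<in> carrier S"
proof -
  have T: "z \<in> carrier S \<Longrightarrow> T z \<in> carrier S" for z
    using assms unfolding bounded_ops_def by blast
  then show "z \<in> carrier S \<Longrightarrow> T z \<in> carrier S" .
  obtain X where "X \<in> op_bounds P S T" using assms unfolding bounded_ops_def by blast
  then have X: "X \<in> carrier (L0 P)" "\<forall>z\<in>carrier S. AE w in P. nrm (T z) w \<le> L0_rep X w * nrm z w"
    by (simp_all add: op_bounds_iff[OF T])
  have "\<forall>x\<in>carrier S. \<forall>y\<in>carrier S. T (x +\<^sub>S y) = T x +\<^sub>S T y"
    using assms by (simp add: bounded_ops_def)
  with X T have "bdd_additive (L0_rep X) T"
    unfolding bdd_additive_def by (simp add: L0_class_rep(1))
  then show "\<exists>b. bdd_additive b T" by blast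
  have "T (act (\<lambda>_. c) x) = act (\<lambda>_. c) (T x)" if "x \<in> carrier S" for c x
    using assms that unfolding bounded_ops_def scale_of_real[symmetric] by blast
  then show "h \<in> borel_measurable P \<Longrightarrow> x \<in> carrier S \<Longrightarrow> T (act h x) = act h (T x)"
    using bdd_additive_act[OF \<open>bdd_additive (L0_rep X) T\<close>] by blast
  show "z \<in> carrier S \<Longrightarrow> AE w in P. nrm (T z) w \<le> L0_rep (op_L0norm P S T) w * nrm z w"
    using assms unfolding bounded_ops_def by (intro op_L0norm_bound T) simp_all
qed

section \<open>Derivatives\<close>

definition diff_quot :: "(real \<Rightarrow> 's) \<Rightarrow> real \<Rightarrow> real \<Rightarrow> 's" where
  "diff_quot u t s = act (\<lambda>_. 1 / (s - t)) (u s -\<^sub>S u t)"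

text \<open>The set is a parameter because derivatives relative to \<open>{0..}\<close>, to a
  compact interval and to the whole line all occur; at interior points they agree.\<close>

definition has_deriv :: "(real \<Rightarrow> 's) \<Rightarrow> 's \<Rightarrow> real \<Rightarrow> real set \<Rightarrow> bool" where
  "has_deriv u d t A \<longleftrightarrow> conv (diff_quot u t) d (at t within A)"

lemma has_el_derivative_iff: "has_el_derivative P S u d t \<longleftrightarrow> has_deriv u d t {0..}"
  unfolding has_el_derivative_def has_deriv_def diff_quot_def[abs_def] limitin_iff scale_of_real ..

lemma has_deriv_closed: "has_deriv u d t A \<Longrightarrow> d \<in> carrier S"
  by (simp add: has_deriv_def conv_closed)

lemma has_deriv_subset: "has_deriv u d t A \<Longrightarrow> B \<subseteq> A \<Longrightarrow> has_deriv u d t B"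
  unfolding has_deriv_def by (rule conv_mono_filter) (auto intro: at_le)

lemma has_deriv_at: "has_deriv u d t {0..} \<longleftrightarrow> has_deriv u d t UNIV" if "0 < t"
  unfolding has_deriv_def using that by (subst at_within_open_subset[of t "{0<..}"]) auto

lemma has_deriv_const: "x \<in> carrier S \<Longrightarrow> has_deriv (\<lambda>_. x) 0\<^sub>S t A"
  by (simp add: has_deriv_def diff_quot_def[abs_def] minus_self conv_const)

lemma has_deriv_cong:
  assumes "has_deriv v d t A" "t \<in> A" "\<And>s. s \<in> A \<Longrightarrow> u s = v s"
  shows "has_deriv u d t A"
  using assms(1) unfolding has_deriv_def
  by (rule conv_cong[rotated]) (auto simp: eventually_at_filter diff_quot_def assms)

lemma eventually_within: "(\<And>s. s \<in> A \<Longrightarrow> Q s) \<Longrightarrow> eventually Q (at t within A)"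
  by (simp add: eventually_at_filter)

lemma has_deriv_add:
  assumes "has_deriv u d t A" "has_deriv v e t A" "t \<in> A"
    and uv: "\<And>s. s \<in> A \<Longrightarrow> u s \<in> carrier S" "\<And>s. s \<in> A \<Longrightarrow> v s \<in> carrier S"
  shows "has_deriv (\<lambda>s. u s +\<^sub>S v s) (d +\<^sub>S e) t A"
  unfolding has_deriv_def
proof (rule conv_cong)
  show "conv (\<lambda>s. diff_quot u t s +\<^sub>S diff_quot v t s) (d +\<^sub>S e) (at t within A)"
    using assms(1,2) unfolding has_deriv_def by (rule conv_add)
  show "eventually (\<lambda>s. diff_quot (\<lambda>s. u s +\<^sub>S v s) t s = diff_quot u t s +\<^sub>S diff_quot v t s) (at t within A)"
    using uv[OF \<open>t \<in> A\<close>] uv by (intro eventually_within) (simp add: diff_quot_def add_minus_add act_add_right)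
qed

lemma has_deriv_minus:
  assumes "has_deriv u d t A" "has_deriv v e t A" "t \<in> A"
    and uv: "\<And>s. s \<in> A \<Longrightarrow> u s \<in> carrier S" "\<And>s. s \<in> A \<Longrightarrow> v s \<in> carrier S"
  shows "has_deriv (\<lambda>s. u s -\<^sub>S v s) (d -\<^sub>S e) t A"
  unfolding has_deriv_def
proof (rule conv_cong)
  show "conv (\<lambda>s. diff_quot u t s -\<^sub>S diff_quot v t s) (d -\<^sub>S e) (at t within A)"
    using assms by (intro conv_minus) (auto simp: has_deriv_def)
  show "eventually (\<lambda>s. diff_quot (\<lambda>s. u s -\<^sub>S v s) t s = diff_quot u t s -\<^sub>S diff_quot v t s) (at t within A)"
    using uv[OF \<open>t \<in> A\<close>] uv by (intro eventually_within) (simp add: diff_quot_def minus_minus_minus act_minus_right)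
qed

lemma has_deriv_op:
  assumes u: "has_deriv u d t A" "t \<in> A" "\<And>s. s \<in> A \<Longrightarrow> u s \<in> carrier S"
    and T: "bdd_additive b T" "\<And>c x. x \<in> carrier S \<Longrightarrow> T (act (\<lambda>_. c) x) = act (\<lambda>_. c) (T x)"
  shows "has_deriv (\<lambda>s. T (u s)) (T d) t A"
  unfolding has_deriv_def
proof (rule conv_cong)
  show "conv (\<lambda>s. T (diff_quot u t s)) (T d) (at t within A)"
    using u(1) unfolding has_deriv_def by (rule conv_op) (rule T(1))
  show "eventually (\<lambda>s. diff_quot (\<lambda>s. T (u s)) t s = T (diff_quot u t s)) (at t within A)"
    using u by (intro eventually_within) (simp add: diff_quot_def T(2) bdd_additive_minus[OF T(1)])
qed

text \<open>The quotient is that of \<open>p\<close> acting on \<open>u t\<close> plus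
  \<open>p s\<close> acting on that of \<open>u\<close>. The hypotheses on \<open>p\<close> ask for
  convergence in probability because the scalars in use are exponentials with unbounded random
  exponents.\<close>

lemma has_deriv_act:
  assumes u: "has_deriv u d t A" "t \<in> A" "\<And>s. s \<in> A \<Longrightarrow> u s \<in> carrier S"
    and p: "\<And>s. p s \<in> borel_measurable P" "p' \<in> borel_measurable P"
    and p0: "((\<lambda>s. mag (\<lambda>w. p s w - p t w)) \<longlongrightarrow> 0) (at t within A)"
    and p1: "((\<lambda>s. mag (\<lambda>w. (p s w - p t w) / (s - t) - p' w)) \<longlongrightarrow> 0) (at t within A)"
  shows "has_deriv (\<lambda>s. act (p s) (u s)) (act p' (u t) +\<^sub>S act (p t) d) t A"
  unfolding has_deriv_def
proof (rule conv_cong)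
  let ?q = "\<lambda>s w. (p s w - p t w) / (s - t)"
  have q: "?q s \<in> borel_measurable P" for s using p by simp
  show "conv (\<lambda>s. act (?q s) (u t) +\<^sub>S act (p s) (diff_quot u t s)) (act p' (u t) +\<^sub>S act (p t) d) (at t within A)"
  proof (rule conv_add)
    show "conv (\<lambda>s. act (?q s) (u t)) (act p' (u t)) (at t within A)"
      by (rule conv_act_var[OF conv_const p(2) _ p1]) (use u(2,3) q in auto)
    show "conv (\<lambda>s. act (p s) (diff_quot u t s)) (act (p t) d) (at t within A)"
      by (rule conv_act_var[OF _ p(1) _ p0]) (use u(1) p in \<open>auto simp: has_deriv_def\<close>)
  qed
  have eq: "diff_quot (\<lambda>s. act (p s) (u s)) t s = act (?q s) (u t) +\<^sub>S act (p s) (diff_quot u t s)"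
    if "s \<in> A" for s
  proof -
    note us = u(3)[OF that] u(3)[OF u(2)]
    let ?c = "\<lambda>_. 1 / (s - t)"
    have 1: "act (?q s) (u t) = act ?c (act (p s) (u t) -\<^sub>S act (p t) (u t))"
      using us p by (simp add: act_act flip: act_minus_left)
    have 2: "act (p s) (diff_quot u t s) = act ?c (act (p s) (u s) -\<^sub>S act (p s) (u t))"
      using us p by (simp add: diff_quot_def act_act flip: act_minus_right)
    show ?thesis unfolding 1 2 unfolding diff_quot_def using us p(1)[of s] p(1)[of t]
      by (subst act_add_right[symmetric]) (simp_all add: M.a_comm[of "act (p s) (u t) -\<^sub>S act (p t) (u t)"] minus_trans)
  qed
  then show "eventually (\<lambda>s. diff_quot (\<lambda>s. act (p s) (u s)) t s
      = act (?q s) (u t) +\<^sub>S act (p s) (diff_quot u t s)) (at t within A)"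
    by (rule eventually_within)
qed

lemma has_deriv_shift:
  assumes "has_deriv u d (t + h) {0..}" "0 \<le> h"
  shows "has_deriv (\<lambda>s. u (s + h)) d t {0..}"
proof -
  have "filterlim (\<lambda>s. s + h) (at (t + h) within {0..}) (at t within {0..})"
    unfolding filterlim_at using \<open>0 \<le> h\<close>
    by (auto intro!: tendsto_intros simp: eventually_at_filter)
  from conv_filterlim[OF assms(1)[unfolded has_deriv_def] this]
  show ?thesis by (simp add: has_deriv_def diff_quot_def[abs_def])
qed

text \<open>Both estimates come from the mean value theorem, the second by applying the first at the
  intermediate point. They are used pointwise with a random \<open>c\<close>: the constant then
  depends on the sample point, while the factor \<open>\<bar>s - t\<bar>\<close> does not.\<close>

lemma exp_diff_le:
  fixes c :: real
  assumes "\<bar>s\<bar> \<le> L" "\<bar>t\<bar> \<le> L"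
  shows "\<bar>exp (c * s) - exp (c * t)\<bar> \<le> \<bar>c\<bar> * exp (\<bar>c\<bar> * L) * \<bar>s - t\<bar>"
    and "s \<noteq> t \<Longrightarrow> \<bar>(exp (c * s) - exp (c * t)) / (s - t) - c * exp (c * t)\<bar>
      \<le> \<bar>c\<bar> * (\<bar>c\<bar> * exp (\<bar>c\<bar> * L)) * \<bar>s - t\<bar>"
proof -
  have mvt: "\<exists>z. \<bar>z\<bar> \<le> L \<and> \<bar>z - t\<bar> \<le> \<bar>s - t\<bar> \<and> exp (c * s) - exp (c * t) = (s - t) * (c * exp (c * z))"
    if "\<bar>s\<bar> \<le> L" "\<bar>t\<bar> \<le> L" for s t
  proof -
    have der: "((\<lambda>x. exp (c * x)) has_real_derivative c * exp (c * x)) (at x)" for x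
      by (auto intro!: derivative_eq_intros)
    consider "s < t" | "s = t" | "t < s" by linarith
    then show ?thesis
    proof cases
      case 1
      then obtain z where "s < z" "z < t" "exp (c * t) - exp (c * s) = (t - s) * (c * exp (c * z))"
        using MVT2[of s t "\<lambda>x. exp (c * x)" "\<lambda>x. c * exp (c * x)"] der by blast
      with that show ?thesis by (intro exI[of _ z]) (auto simp: algebra_simps)
    next
      case 3
      then obtain z where "t < z" "z < s" "exp (c * s) - exp (c * t) = (s - t) * (c * exp (c * z))"
        using MVT2[of t s "\<lambda>x. exp (c * x)" "\<lambda>x. c * exp (c * x)"] der by blast
      with that show ?thesis by (intro exI[of _ z]) auto
    qed (use that in auto)
  qed
  have bound: "\<bar>c * exp (c * z)\<bar> \<le> \<bar>c\<bar> * exp (\<bar>c\<bar> * L)" if "\<bar>z\<bar> \<le> L" for z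
  proof -
    have "c * z \<le> \<bar>c\<bar> * \<bar>z\<bar>" using abs_ge_self[of "c * z"] by (simp add: abs_mult)
    also have "\<dots> \<le> \<bar>c\<bar> * L" using that by (simp add: mult_left_mono)
    finally show ?thesis by (simp add: abs_mult mult_left_mono)
  qed
  have first: "\<bar>exp (c * s) - exp (c * t)\<bar> \<le> \<bar>c\<bar> * exp (\<bar>c\<bar> * L) * \<bar>s - t\<bar>"
    if st: "\<bar>s\<bar> \<le> L" "\<bar>t\<bar> \<le> L" for s t
  proof -
    obtain z where z: "\<bar>z\<bar> \<le> L" "exp (c * s) - exp (c * t) = (s - t) * (c * exp (c * z))"
      using mvt[OF st] by blast
    then have "\<bar>exp (c * s) - exp (c * t)\<bar> = \<bar>s - t\<bar> * \<bar>c * exp (c * z)\<bar>" by (simp only: abs_mult)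
    also have "\<dots> \<le> \<bar>s - t\<bar> * (\<bar>c\<bar> * exp (\<bar>c\<bar> * L))"
      by (intro mult_left_mono bound z) simp
    finally show ?thesis by (simp add: mult.commute)
  qed
  then show "\<bar>exp (c * s) - exp (c * t)\<bar> \<le> \<bar>c\<bar> * exp (\<bar>c\<bar> * L) * \<bar>s - t\<bar>" using assms by blast
  assume "s \<noteq> t"
  obtain z where z: "\<bar>z\<bar> \<le> L" "\<bar>z - t\<bar> \<le> \<bar>s - t\<bar>" "exp (c * s) - exp (c * t) = (s - t) * (c * exp (c * z))"
    using mvt[OF assms] by blast
  have "(exp (c * s) - exp (c * t)) / (s - t) - c * exp (c * t) = c * (exp (c * z) - exp (c * t))"
    using \<open>s \<noteq> t\<close> by (simp add: z(3) right_diff_distrib)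
  then have "\<bar>(exp (c * s) - exp (c * t)) / (s - t) - c * exp (c * t)\<bar> = \<bar>c\<bar> * \<bar>exp (c * z) - exp (c * t)\<bar>"
    by (simp only: abs_mult)
  also have "\<dots> \<le> \<bar>c\<bar> * (\<bar>c\<bar> * exp (\<bar>c\<bar> * L) * \<bar>s - t\<bar>)"
    using first[OF z(1) assms(2)] z(2)
    by (intro mult_left_mono order_trans[OF first[OF z(1) assms(2)]]) auto
  finally show "\<bar>(exp (c * s) - exp (c * t)) / (s - t) - c * exp (c * t)\<bar>
      \<le> \<bar>c\<bar> * (\<bar>c\<bar> * exp (\<bar>c\<bar> * L)) * \<bar>s - t\<bar>" by (simp add: mult_ac)
qed

lemma mag_exp_tendsto:
  assumes c[measurable]: "c \<in> borel_measurable P"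
  shows "((\<lambda>s. mag (\<lambda>w. exp (c w * s) - exp (c w * t))) \<longlongrightarrow> 0) (at t within A)"
    and "((\<lambda>s. mag (\<lambda>w. (exp (c w * s) - exp (c w * t)) / (s - t) - c w * exp (c w * t))) \<longlongrightarrow> 0) (at t within A)"
proof -
  \<comment> \<open>Times within distance 1 of \<open>t\<close> stay in \<open>[-L, L]\<close>, so
    one random constant serves for all of them.\<close>
  define L where "L = \<bar>t\<bar> + 1"
  have ev: "eventually (\<lambda>s. \<bar>s\<bar> \<le> L \<and> s \<noteq> t) (at t within A)"
    unfolding eventually_at by (intro exI[of _ 1]) (auto simp: L_def dist_real_def)
  have t: "\<bar>t\<bar> \<le> L" by (simp add: L_def)
  have lim: "((\<lambda>s. s - t) \<longlongrightarrow> 0) (at t within A)"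
    by (auto intro!: tendsto_eq_intros)
  show "((\<lambda>s. mag (\<lambda>w. exp (c w * s) - exp (c w * t))) \<longlongrightarrow> 0) (at t within A)"
  proof (rule mag_tendsto_Lipschitz[OF _ _ _ lim])
    show "eventually (\<lambda>s. AE w in P. \<bar>exp (c w * s) - exp (c w * t)\<bar>
        \<le> \<bar>\<bar>c w\<bar> * exp (\<bar>c w\<bar> * L)\<bar> * \<bar>s - t\<bar>) (at t within A)"
      using ev by eventually_elim (use exp_diff_le(1)[OF _ t] in \<open>auto simp: abs_mult\<close>)
  qed simp_all
  show "((\<lambda>s. mag (\<lambda>w. (exp (c w * s) - exp (c w * t)) / (s - t) - c w * exp (c w * t))) \<longlongrightarrow> 0) (at t within A)"
  proof (rule mag_tendsto_Lipschitz[OF _ _ _ lim])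
    show "eventually (\<lambda>s. AE w in P. \<bar>(exp (c w * s) - exp (c w * t)) / (s - t) - c w * exp (c w * t)\<bar>
        \<le> \<bar>\<bar>c w\<bar> * (\<bar>c w\<bar> * exp (\<bar>c w\<bar> * L))\<bar> * \<bar>s - t\<bar>) (at t within A)"
      using ev by eventually_elim (use exp_diff_le(2)[OF _ t] in \<open>auto simp: abs_mult\<close>)
  qed simp_all
qed

section \<open>Functions with zero derivative\<close>

lemma eventually_at_Icc:
  fixes s :: real
  assumes "a < s" "s < b"
  shows "eventually (\<lambda>r. r \<in> {a..b} \<and> r \<noteq> s) (at s)"
  using eventually_at_in_open'[of "{a<..<b}" s] assms
  by (auto simp: eventually_at_filter elim!: eventually_mono)

text \<open>The weight turns the random bound on the difference quotients into a deterministic one; then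
  convergence in probability gives convergence of expectations, and the weighted distance is a
  real function with zero derivative.\<close>

lemma const_of_zero_deriv:
  assumes "a \<le> b" and g: "\<And>s. s \<in> {a..b} \<Longrightarrow> g s \<in> carrier S"
    and \<zeta>[measurable]: "\<zeta> \<in> borel_measurable P"
    and lip: "\<And>s r. s \<in> {a..b} \<Longrightarrow> r \<in> {a..b} \<Longrightarrow> AE w in P. nrm (g s -\<^sub>S g r) w \<le> \<zeta> w * \<bar>s - r\<bar>"
    and der: "\<And>s. s \<in> {a<..<b} \<Longrightarrow> has_deriv g 0\<^sub>S s UNIV"
  shows "g b = g a"
proof (cases "a = b")
  case False
  with \<open>a \<le> b\<close> have ab: "a < b" by simp
  define wt where "wt w = 1 / (1 + \<bar>\<zeta> w\<bar>)" for w
  have wtm[measurable]: "wt \<in> borel_measurable P" by (simp add: wt_def[abs_def])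
  have wt0: "0 < wt w" for w by (simp add: wt_def add_pos_nonneg)
  have wt1: "wt w * \<zeta> w \<le> 1" for w by (simp add: wt_def divide_le_eq, linarith)
  define N where "N z = expectation (\<lambda>w. wt w * nrm z w)" for z
  define \<phi> where "\<phi> s = N (g s -\<^sub>S g a)" for s
  have wlip: "AE w in P. 0 \<le> wt w * nrm (g s -\<^sub>S g r) w \<and> wt w * nrm (g s -\<^sub>S g r) w \<le> \<bar>s - r\<bar>"
    if "s \<in> {a..b}" "r \<in> {a..b}" for s r
    using lip[OF that] nrm_nonneg[OF M.minus_closed[OF g g], OF that]
  proof eventually_elim
    case (elim w)
    have "wt w * nrm (g s -\<^sub>S g r) w \<le> (wt w * \<zeta> w) * \<bar>s - r\<bar>"
      using elim wt0[of w] by (simp add: mult.assoc)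
    also have "\<dots> \<le> 1 * \<bar>s - r\<bar>" by (intro mult_right_mono wt1) simp
    finally show ?case using elim wt0[of w] by (simp add: less_imp_le)
  qed
  have int: "integrable P (\<lambda>w. wt w * nrm (g s -\<^sub>S g r) w)" if "s \<in> {a..b}" "r \<in> {a..b}" for s r
    using wlip[OF that] g[OF that(1)] g[OF that(2)]
    by (intro integrable_const_bound[where B = "\<bar>s - r\<bar>"]) auto
  have N_le: "N (g s -\<^sub>S g r) \<le> \<bar>s - r\<bar>" if "s \<in> {a..b}" "r \<in> {a..b}" for s r
  proof -
    have "N (g s -\<^sub>S g r) \<le> expectation (\<lambda>_. \<bar>s - r\<bar>)"
      unfolding N_def using wlip[OF that] by (intro integral_mono_AE int that) auto
    then show ?thesis by (simp add: prob_space)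
  qed
  have N_tri: "N (g s -\<^sub>S g a) \<le> N (g s -\<^sub>S g r) + N (g r -\<^sub>S g a)"
    if sr: "s \<in> {a..b}" "r \<in> {a..b}" for s r
  proof -
    have a: "a \<in> {a..b}" using ab by simp
    have "N (g s -\<^sub>S g a) \<le> expectation (\<lambda>w. wt w * nrm (g s -\<^sub>S g r) w + wt w * nrm (g r -\<^sub>S g a) w)"
      unfolding N_def
    proof (intro integral_mono_AE Bochner_Integration.integrable_add int sr a)
      show "AE w in P. wt w * nrm (g s -\<^sub>S g a) w \<le> wt w * nrm (g s -\<^sub>S g r) w + wt w * nrm (g r -\<^sub>S g a) w"
        using nrm_triangle[OF g[OF sr(1)] g[OF sr(2)] g[OF a]]
      proof eventually_elim
        case (elim w)
        from mult_left_mono[OF elim less_imp_le[OF wt0[of w]]] show ?case by (simp add: distrib_left)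
      qed
    qed
    then show ?thesis unfolding N_def using int sr a by simp
  qed
  have N_comm: "N (g s -\<^sub>S g r) = N (g r -\<^sub>S g s)" if sr: "s \<in> {a..b}" "r \<in> {a..b}" for s r
    unfolding N_def using nrm_minus_commute[OF g g, OF sr] g[OF sr(1)] g[OF sr(2)]
    by (intro integral_cong_AE) auto
  have \<phi>_diff: "\<bar>\<phi> s - \<phi> r\<bar> \<le> N (g s -\<^sub>S g r)" if "s \<in> {a..b}" "r \<in> {a..b}" for s r
    unfolding \<phi>_def using N_tri[OF that] N_tri[OF that(2,1)] N_comm[OF that] by linarith
  have "\<phi> b = \<phi> a"
  proof (rule DERIV_isconst_end[OF ab])
    have "\<bar>\<phi> s - \<phi> r\<bar> \<le> \<bar>s - r\<bar>" if "s \<in> {a..b}" "r \<in> {a..b}" for s r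
      using \<phi>_diff[OF that] N_le[OF that] by linarith
    then have "1-lipschitz_on {a..b} \<phi>" by (intro lipschitz_onI) (auto simp: dist_real_def)
    then show "continuous_on {a..b} \<phi>" by (rule lipschitz_on_continuous_on)
    fix s assume s: "a < s" "s < b"
    note near = eventually_at_Icc[of a s b, OF s]
    have dS: "diff_quot g s r \<in> carrier S" if "r \<in> {a..b}" for r
      using that s g by (simp add: diff_quot_def)
    have quot: "\<bar>(\<phi> r - \<phi> s) / (r - s)\<bar> \<le> mag (\<lambda>w. wt w * nrm (diff_quot g s r) w)"
      if r: "r \<in> {a..b}" "r \<noteq> s" for r
    proof -
      have sI: "s \<in> {a..b}" using s by simp
      let ?d = "g r -\<^sub>S g s"
      have d: "?d \<in> carrier S" using g r sI by simp
      \<comment> \<open>The weighted quotient is at most 1, so the truncation in \<open>mag\<close>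
        is inactive and \<open>mag\<close> is the weighted expectation of the quotient
        itself.\<close>
      have "AE w in P. min 1 \<bar>wt w * nrm (diff_quot g s r) w\<bar> = wt w * nrm ?d w / \<bar>r - s\<bar>"
        using nrm_act[of "\<lambda>_. 1 / (r - s)" ?d, simplified, OF d] wlip[OF r(1) sI]
        unfolding diff_quot_def
      proof eventually_elim
        case (elim w)
        then have "0 \<le> nrm ?d w" using wt0[of w] by (simp add: zero_le_mult_iff)
        with elim have "\<bar>wt w * nrm (act (\<lambda>_. 1 / (r - s)) ?d) w\<bar> = wt w * nrm ?d w / \<bar>r - s\<bar>"
          using wt0[of w] by (simp add: abs_mult)
        moreover have "wt w * nrm ?d w / \<bar>r - s\<bar> \<le> 1"
          using elim r(2) by (simp add: divide_le_eq)
        ultimately show ?case by simp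
      qed
      then have "mag (\<lambda>w. wt w * nrm (diff_quot g s r) w) = expectation (\<lambda>w. wt w * nrm ?d w / \<bar>r - s\<bar>)"
        unfolding mag_def using d dS[OF r(1)] by (intro integral_cong_AE) auto
      also have "\<dots> = N ?d / \<bar>r - s\<bar>" by (simp add: N_def)
      finally show ?thesis using \<phi>_diff[OF r(1) sI] by (simp add: divide_right_mono)
    qed
    have "((\<lambda>r. mag (\<lambda>w. wt w * nrm (diff_quot g s r) w)) \<longlongrightarrow> 0) (at s)"
    proof (rule mag_mult_tendsto[OF wtm])
      show "eventually (\<lambda>r. nrm (diff_quot g s r) \<in> borel_measurable P) (at s)"
        using near by eventually_elim (simp add: dS)
      have "((\<lambda>r. mag (nrm (diff_quot g s r -\<^sub>S 0\<^sub>S))) \<longlongrightarrow> 0) (at s)"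
        using der[of s] s by (simp add: has_deriv_def conv_def)
      then show "((\<lambda>r. mag (nrm (diff_quot g s r))) \<longlongrightarrow> 0) (at s)"
        by (rule Lim_transform_eventually) (use near in eventually_elim, simp add: dS minus_zero_right)
    qed
    then have "((\<lambda>r. (\<phi> r - \<phi> s) / (r - s)) \<longlongrightarrow> 0) (at s)"
      by (rule Lim_null_comparison[rotated]) (use near in eventually_elim, use quot in auto)
    then show "(\<phi> has_real_derivative 0) (at s)" by (simp add: has_field_derivative_iff)
  qed
  moreover have "\<phi> a = 0"
    using N_le[of a a] wlip[of a a] ab unfolding \<phi>_def N_def
    by (intro antisym integral_nonneg_AE) auto
  ultimately have "N (g b -\<^sub>S g a) = 0" by (simp add: \<phi>_def)
  then have "AE w in P. wt w * nrm (g b -\<^sub>S g a) w = 0"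
    unfolding N_def using int[of b a] wlip[of b a] ab by (subst (asm) integral_nonneg_eq_0_iff_AE) auto
  then have "AE w in P. nrm (g b -\<^sub>S g a) w = 0"
    by eventually_elim (use wt0 in \<open>auto simp: less_le\<close>)
  then have "g b -\<^sub>S g a = 0\<^sub>S" using g ab by (intro nrm_eq_0) auto
  with g ab show ?thesis by (intro minus_eq_zero[of "g b" "g a"]) auto
qed simp

section \<open>Antiderivatives of dominated continuous functions\<close>

text \<open>The left-endpoint sum over \<open>[0, N * h]\<close> with constant mesh. The difference
  of two sums with the same mesh involves only the nodes in between, which yields estimates on
  subintervals.\<close>

primrec riemann_sum :: "(real \<Rightarrow> 's) \<Rightarrow> real \<Rightarrow> nat \<Rightarrow> 's" where
  "riemann_sum f h 0 = 0\<^sub>S"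
| "riemann_sum f h (Suc N) = riemann_sum f h N +\<^sub>S act (\<lambda>_. h) (f (real N * h))"

lemma riemann_sum_closed:
  "(\<And>k. k < N \<Longrightarrow> f (real k * h) \<in> carrier S) \<Longrightarrow> riemann_sum f h N \<in> carrier S"
  by (induction N) auto

text \<open>The bound \<open>c\<close> is required only at nodes between \<open>N1\<close> and
  \<open>N2\<close>. This locality passes to the antiderivative and later provides the exponentially
  small tails in \<open>laplace_limit\<close>.\<close>

lemma riemann_sum_nrm_le:
  assumes "N1 \<le> N2" "0 \<le> h" and f: "\<And>k. f (real k * h) \<in> carrier S"
    and c: "\<And>k. N1 \<le> k \<Longrightarrow> k < N2 \<Longrightarrow> AE w in P. nrm (f (real k * h)) w \<le> c w"
  shows "AE w in P. nrm (riemann_sum f h N2 -\<^sub>S riemann_sum f h N1) w \<le> c w * (h * (real N2 - real N1))"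
  using assms(1,4)
proof (induction N2 rule: dec_induct)
  case base
  show ?case using nrm_zero by (auto simp: minus_self riemann_sum_closed f elim: AE_mp)
next
  case (step n)
  let ?d = "riemann_sum f h n -\<^sub>S riemann_sum f h N1" and ?e = "act (\<lambda>_. h) (f (real n * h))"
  note R = riemann_sum_closed[of _ f h, OF f]
  have cl: "?d \<in> carrier S" "?e \<in> carrier S" using R f by auto
  have eq: "riemann_sum f h (Suc n) -\<^sub>S riemann_sum f h N1 = ?d +\<^sub>S ?e"
    using R f by (simp add: M.minus_eq M.a_ac)
  have IH: "AE w in P. nrm ?d w \<le> c w * (h * (real n - real N1))"
    using step.IH step.prems by simp
  have "AE w in P. nrm (f (real n * h)) w \<le> c w" using step by simp
  with IH nrm_add[OF cl] nrm_act[of "\<lambda>_. h", simplified, OF f[of n]]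
  show ?case unfolding eq
  proof eventually_elim
    case (elim w)
    have "h * nrm (f (real n * h)) w \<le> h * c w" using elim \<open>0 \<le> h\<close> by (intro mult_left_mono)
    then show ?case using elim \<open>0 \<le> h\<close> by (simp add: algebra_simps)
  qed
qed

section \<open>Weighted expectation norms on dominated elements\<close>

definition wnrm :: "('w \<Rightarrow> real) \<Rightarrow> 's \<Rightarrow> real" where
  "wnrm b z = expectation (\<lambda>w. nrm z w / (1 + \<bar>b w\<bar>))"

text \<open>On this real subspace \<open>wnrm b\<close> is finite and, unlike \<open>mag\<close>,
  homogeneous. Adding 1 to \<open>\<bar>b\<bar>\<close> keeps the weight defined where
  \<open>b\<close> vanishes, and the deterministic factor \<open>K\<close> allows for sums and real
  multiples.\<close>

definition dominated :: "('w \<Rightarrow> real) \<Rightarrow> 's set" where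
  "dominated b = {z \<in> carrier S. \<exists>K. AE w in P. nrm z w \<le> K * (1 + \<bar>b w\<bar>)}"

lemma dominatedI: "z \<in> carrier S \<Longrightarrow> AE w in P. nrm z w \<le> K * (1 + \<bar>b w\<bar>) \<Longrightarrow> z \<in> dominated b"
  by (auto simp: dominated_def)

lemma dominated_closed: "z \<in> dominated b \<Longrightarrow> z \<in> carrier S"
  by (simp add: dominated_def)

lemma weighted_le:
  fixes n b K :: real
  assumes "n \<le> K * (1 + \<bar>b\<bar>)"
  shows "n / (1 + \<bar>b\<bar>) \<le> K"
  using assms by (simp add: divide_le_eq add_pos_nonneg)

lemma integrable_wnrm:
  assumes b[measurable]: "b \<in> borel_measurable P" and z: "z \<in> dominated b"
  shows "integrable P (\<lambda>w. nrm z w / (1 + \<bar>b w\<bar>))"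
proof -
  obtain K where K: "AE w in P. nrm z w \<le> K * (1 + \<bar>b w\<bar>)" using z by (auto simp: dominated_def)
  note [measurable] = nrm_measurable[OF dominated_closed[OF z]]
  show ?thesis
  proof (rule integrable_const_bound[where B = K])
    show "AE w in P. norm (nrm z w / (1 + \<bar>b w\<bar>)) \<le> K"
      using K nrm_nonneg[OF dominated_closed[OF z]]
      by eventually_elim (simp add: weighted_le abs_of_nonneg)
  qed simp
qed

lemma wnrm_nonneg: "z \<in> carrier S \<Longrightarrow> 0 \<le> wnrm b z"
  unfolding wnrm_def using nrm_nonneg[of z] by (intro integral_nonneg_AE) auto

lemma dominated_add:
  assumes b: "b \<in> borel_measurable P" and x: "x \<in> dominated b" and y: "y \<in> dominated b"
  shows "x +\<^sub>S y \<in> dominated b" "wnrm b (x +\<^sub>S y) \<le> wnrm b x + wnrm b y"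
proof -
  note cl = dominated_closed[OF x] dominated_closed[OF y]
  obtain K L where "AE w in P. nrm x w \<le> K * (1 + \<bar>b w\<bar>)" "AE w in P. nrm y w \<le> L * (1 + \<bar>b w\<bar>)"
    using x y by (auto simp: dominated_def)
  with nrm_add[OF cl] have "AE w in P. nrm (x +\<^sub>S y) w \<le> (K + L) * (1 + \<bar>b w\<bar>)"
    by eventually_elim (simp add: distrib_right)
  then show dom: "x +\<^sub>S y \<in> dominated b" using cl by (intro dominatedI) auto
  have "wnrm b (x +\<^sub>S y) \<le> expectation (\<lambda>w. nrm x w / (1 + \<bar>b w\<bar>) + nrm y w / (1 + \<bar>b w\<bar>))"
    unfolding wnrm_def
  proof (intro integral_mono_AE Bochner_Integration.integrable_add integrable_wnrm b x y dom)
    show "AE w in P. nrm (x +\<^sub>S y) w / (1 + \<bar>b w\<bar>) \<le> nrm x w / (1 + \<bar>b w\<bar>) + nrm y w / (1 + \<bar>b w\<bar>)"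
      using nrm_add[OF cl] by eventually_elim (simp add: divide_right_mono flip: add_divide_distrib)
  qed
  then show "wnrm b (x +\<^sub>S y) \<le> wnrm b x + wnrm b y"
    unfolding wnrm_def using integrable_wnrm[OF b] x y by simp
qed

lemma dominated_act:
  assumes b: "b \<in> borel_measurable P" and x: "x \<in> dominated b"
  shows "act (\<lambda>_. c) x \<in> dominated b" "wnrm b (act (\<lambda>_. c) x) = \<bar>c\<bar> * wnrm b x"
proof -
  note cl = dominated_closed[OF x]
  have act: "AE w in P. nrm (act (\<lambda>_. c) x) w = \<bar>c\<bar> * nrm x w"
    by (rule nrm_act) (simp_all add: cl)
  obtain K where "AE w in P. nrm x w \<le> K * (1 + \<bar>b w\<bar>)"
    using x by (auto simp: dominated_def)
  with act have "AE w in P. nrm (act (\<lambda>_. c) x) w \<le> (\<bar>c\<bar> * K) * (1 + \<bar>b w\<bar>)"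
    by eventually_elim (simp add: mult.assoc mult_left_mono)
  then show "act (\<lambda>_. c) x \<in> dominated b" using cl by (intro dominatedI) auto
  have "wnrm b (act (\<lambda>_. c) x) = expectation (\<lambda>w. \<bar>c\<bar> * (nrm x w / (1 + \<bar>b w\<bar>)))"
    unfolding wnrm_def using act b cl by (intro integral_cong_AE) auto
  then show "wnrm b (act (\<lambda>_. c) x) = \<bar>c\<bar> * wnrm b x"
    by (simp only: wnrm_def integral_mult_right_zero)
qed

lemma dominated_minus:
  assumes b: "b \<in> borel_measurable P" and x: "x \<in> dominated b" and y: "y \<in> dominated b"
  shows "x -\<^sub>S y \<in> dominated b" "wnrm b (x -\<^sub>S y) \<le> wnrm b x + wnrm b y"
  using dominated_add[OF b x dominated_act(1)[OF b y, of "-1"]] dominated_act(2)[OF b y, of "-1"]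
    dominated_closed[OF y] by (simp_all add: M.minus_eq minus_act)

lemma wnrm_minus_commute:
  assumes b: "b \<in> borel_measurable P" and x: "x \<in> carrier S" and y: "y \<in> carrier S"
  shows "wnrm b (x -\<^sub>S y) = wnrm b (y -\<^sub>S x)"
  unfolding wnrm_def using nrm_minus_commute[OF x y] b x y by (intro integral_cong_AE) auto

lemma wnrm_triangle:
  assumes b: "b \<in> borel_measurable P" and "x \<in> dominated b" "y \<in> dominated b" "z \<in> dominated b"
  shows "wnrm b (x -\<^sub>S z) \<le> wnrm b (x -\<^sub>S y) + wnrm b (y -\<^sub>S z)"
  using dominated_add(2)[OF b, of "x -\<^sub>S y" "y -\<^sub>S z"] assms dominated_closed
  by (simp add: dominated_minus minus_trans)

lemma wnrm_zero: "b \<in> borel_measurable P \<Longrightarrow> wnrm b 0\<^sub>S = 0"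
  unfolding wnrm_def using nrm_zero
  by (subst integral_cong_AE[of _ _ "\<lambda>_. 0"]) auto

lemma dominated_zero: "0\<^sub>S \<in> dominated b"
  using nrm_zero by (intro dominatedI[of _ 0]) auto

lemma wnrm_le:
  assumes b: "b \<in> borel_measurable P" and z: "z \<in> carrier S" "AE w in P. nrm z w \<le> K * (1 + \<bar>b w\<bar>)"
  shows "wnrm b z \<le> K"
proof -
  have "wnrm b z \<le> expectation (\<lambda>_. K)"
    unfolding wnrm_def
  proof (intro integral_mono_AE integrable_wnrm[OF b dominatedI[OF z]])
    show "AE w in P. nrm z w / (1 + \<bar>b w\<bar>) \<le> K"
      using z(2) by eventually_elim (rule weighted_le)
  qed simp
  then show ?thesis by (simp add: prob_space)
qed

text \<open>A number between 0 and \<open>K\<close> is at most \<open>K\<close> times its truncation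
  at 1. On families with a common \<open>K\<close> this acts as dominated convergence along
  arbitrary filters, from \<open>mag\<close> to \<open>wnrm\<close>.\<close>

lemma wnrm_le_mag:
  assumes b[measurable]: "b \<in> borel_measurable P"
    and z: "z \<in> carrier S" "AE w in P. nrm z w \<le> K * (1 + \<bar>b w\<bar>)" and "1 \<le> K"
  shows "wnrm b z \<le> K * mag (\<lambda>w. 1 / (1 + \<bar>b w\<bar>) * nrm z w)"
proof -
  note [measurable] = nrm_measurable[OF z(1)]
  let ?g = "\<lambda>w. 1 / (1 + \<bar>b w\<bar>) * nrm z w"
  have "wnrm b z \<le> expectation (\<lambda>w. K * min 1 \<bar>?g w\<bar>)"
    unfolding wnrm_def
  proof (intro integral_mono_AE integrable_wnrm[OF b dominatedI[OF z]] integrable_mult_right integrable_min_one)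
    show "AE w in P. nrm z w / (1 + \<bar>b w\<bar>) \<le> K * min 1 \<bar>?g w\<bar>"
      using z(2) nrm_nonneg[OF z(1)]
    proof eventually_elim
      case (elim w)
      define y where "y = nrm z w / (1 + \<bar>b w\<bar>)"
      have "0 \<le> y" "y \<le> K" using elim by (simp_all add: y_def weighted_le)
      then have "y \<le> K * min 1 \<bar>y\<bar>"
        using \<open>1 \<le> K\<close> mult_right_mono[of 1 K y] by (auto simp: min_def)
      then show ?case by (simp add: y_def)
    qed
  qed simp
  then show ?thesis by (simp add: mag_def)
qed

lemma mag_le_wnrm:
  assumes b[measurable]: "b \<in> borel_measurable P" and z: "z \<in> dominated b"
  shows "mag (\<lambda>w. 1 / (1 + \<bar>b w\<bar>) * nrm z w) \<le> wnrm b z"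
proof -
  note cl = dominated_closed[OF z]
  note [measurable] = nrm_measurable[OF cl]
  show ?thesis
    unfolding mag_def wnrm_def
  proof (intro integral_mono_AE integrable_wnrm[OF b z] integrable_min_one)
    show "AE w in P. min 1 \<bar>1 / (1 + \<bar>b w\<bar>) * nrm z w\<bar> \<le> nrm z w / (1 + \<bar>b w\<bar>)"
      using nrm_nonneg[OF cl] by eventually_elim simp
  qed simp
qed

text \<open>The weight is a fixed random factor, so \<open>mag_mult_tendsto\<close> removes it
  although \<open>1 + \<bar>b\<bar>\<close> may be unbounded. In this direction the constants
  dominating the individual \<open>z s\<close> may vary.\<close>

lemma mag_nrm_tendsto_of_wnrm:
  assumes b[measurable]: "b \<in> borel_measurable P"
    and z: "eventually (\<lambda>s. z s \<in> dominated b) F" and lim: "((\<lambda>s. wnrm b (z s)) \<longlongrightarrow> 0) F"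
  shows "((\<lambda>s. mag (nrm (z s))) \<longlongrightarrow> 0) F"
proof -
  have "((\<lambda>s. mag (\<lambda>w. 1 / (1 + \<bar>b w\<bar>) * nrm (z s) w)) \<longlongrightarrow> 0) F"
    by (rule tendsto_sandwich[OF _ _ tendsto_const lim])
      (simp add: mag_nonneg, use z in eventually_elim, rule mag_le_wnrm[OF b])
  then have "((\<lambda>s. mag (\<lambda>w. (1 + \<bar>b w\<bar>) * (1 / (1 + \<bar>b w\<bar>) * nrm (z s) w))) \<longlongrightarrow> 0) F"
  proof (rule mag_mult_tendsto[rotated 2])
    show "eventually (\<lambda>s. (\<lambda>w. 1 / (1 + \<bar>b w\<bar>) * nrm (z s) w) \<in> borel_measurable P) F"
      using z by eventually_elim (intro borel_measurable_times nrm_measurable, simp_all add: dominated_closed)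
  qed simp
  moreover have "(1 + \<bar>b w\<bar>) * (1 / (1 + \<bar>b w\<bar>) * y) = y" for w y
    using abs_ge_zero[of "b w"] by (simp add: field_simps)
  ultimately show ?thesis by (simp only:)
qed

lemma wnrm_tendsto_of_mag:
  assumes b[measurable]: "b \<in> borel_measurable P"
    and z: "eventually (\<lambda>s. z s \<in> carrier S \<and> (AE w in P. nrm (z s) w \<le> K * (1 + \<bar>b w\<bar>))) F" and "1 \<le> K"
    and lim: "((\<lambda>s. mag (nrm (z s))) \<longlongrightarrow> 0) F"
  shows "((\<lambda>s. wnrm b (z s)) \<longlongrightarrow> 0) F"
proof (rule tendsto_sandwich[OF _ _ tendsto_const])
  show "eventually (\<lambda>s. 0 \<le> wnrm b (z s)) F"
    using z by eventually_elim (simp add: wnrm_nonneg)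
  show "eventually (\<lambda>s. wnrm b (z s) \<le> K * mag (\<lambda>w. 1 / (1 + \<bar>b w\<bar>) * nrm (z s) w)) F"
    using z by eventually_elim (simp add: wnrm_le_mag[OF b _ _ \<open>1 \<le> K\<close>] del: times_divide_eq_left)
  have "((\<lambda>s. mag (\<lambda>w. 1 / (1 + \<bar>b w\<bar>) * nrm (z s) w)) \<longlongrightarrow> 0) F"
    by (rule mag_mult_tendsto[OF _ _ lim]) (simp, use z in eventually_elim, simp)
  then show "((\<lambda>s. K * mag (\<lambda>w. 1 / (1 + \<bar>b w\<bar>) * nrm (z s) w)) \<longlongrightarrow> 0) F"
    by (rule tendsto_mult_right_zero)
qed

section \<open>Riemann sums in the weighted norm\<close>

lemma riemann_sum_dominated:
  assumes b: "b \<in> borel_measurable P" and f: "\<And>k. f (real k * h) \<in> dominated b"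
  shows "riemann_sum f h N \<in> dominated b"
  by (induction N) (simp_all add: dominated_zero dominated_add dominated_act b f)

text \<open>The constant \<open>z\<close> plays three parts: the value at a coarse node when a mesh
  is refined, 0 when the excess of a sum is estimated, and \<open>f t\<close> when the
  antiderivative is differentiated at \<open>t\<close>.\<close>

lemma riemann_sum_wnrm_le:
  assumes b: "b \<in> borel_measurable P" and "N1 \<le> N2" "0 \<le> h"
    and f: "\<And>k. f (real k * h) \<in> dominated b" and z: "z \<in> dominated b"
    and \<epsilon>: "\<And>k. N1 \<le> k \<Longrightarrow> k < N2 \<Longrightarrow> wnrm b (f (real k * h) -\<^sub>S z) \<le> \<epsilon>"
  shows "wnrm b (riemann_sum f h N2 -\<^sub>S riemann_sum f h N1 -\<^sub>S act (\<lambda>_. h * (real N2 - real N1)) z)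
    \<le> \<epsilon> * (h * (real N2 - real N1))"
  using assms(2,6)
proof (induction N2 rule: dec_induct)
  case base
  have "riemann_sum f h N1 \<in> carrier S" "z \<in> carrier S"
    using riemann_sum_dominated[of b f h N1] b f z by (blast intro: dominated_closed)+
  then show ?case using b by (simp add: minus_self wnrm_zero)
next
  case (step n)
  let ?d = "riemann_sum f h n -\<^sub>S riemann_sum f h N1 -\<^sub>S act (\<lambda>_. h * (real n - real N1)) z"
    and ?e = "act (\<lambda>_. h) (f (real n * h) -\<^sub>S z)"
  note R = riemann_sum_dominated[of b f h, OF b f]
  have d: "?d \<in> dominated b" "?e \<in> dominated b"
    using R f z b by (simp_all add: dominated_minus dominated_act)
  have cl: "riemann_sum f h n \<in> carrier S" "riemann_sum f h N1 \<in> carrier S" "z \<in> carrier S"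
      "f (real n * h) \<in> carrier S"
    using R f z by (blast intro: dominated_closed)+
  have "act (\<lambda>_. h * (real (Suc n) - real N1)) z = act (\<lambda>_. h * (real n - real N1)) z +\<^sub>S act (\<lambda>_. h) z"
    using cl by (subst act_add_left[symmetric]) (simp_all add: algebra_simps)
  then have eq: "riemann_sum f h (Suc n) -\<^sub>S riemann_sum f h N1 -\<^sub>S act (\<lambda>_. h * (real (Suc n) - real N1)) z
      = ?d +\<^sub>S ?e"
    using cl by (simp add: act_minus_right) (simp add: M.minus_eq M.minus_add M.a_ac)
  have IH: "wnrm b ?d \<le> \<epsilon> * (h * (real n - real N1))"
    using step.IH step.prems by simp
  have "wnrm b ?e = h * wnrm b (f (real n * h) -\<^sub>S z)"
    using dominated_act(2)[OF b dominated_minus(1)[OF b f z], of h] \<open>0 \<le> h\<close> by simp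
  also have "\<dots> \<le> h * \<epsilon>" using step \<open>0 \<le> h\<close> by (intro mult_left_mono) auto
  finally show ?case
    unfolding eq using dominated_add(2)[OF b d] IH by (simp add: algebra_simps)
qed

text \<open>Each coarse cell carries \<open>q\<close> fine nodes, and on it the fine sum is compared
  with the constant value at the left end of the cell; the errors of the cells add up by the
  triangle inequality.\<close>

lemma riemann_sum_refine:
  assumes b: "b \<in> borel_measurable P" and "0 \<le> h" "0 < q"
    and f: "\<And>s. 0 \<le> s \<Longrightarrow> f s \<in> dominated b"
    and \<epsilon>: "\<And>k r. k < N \<Longrightarrow> real k * h \<le> r \<Longrightarrow> r \<le> (real k + 1) * h \<Longrightarrow> wnrm b (f r -\<^sub>S f (real k * h)) \<le> \<epsilon>"
  shows "wnrm b (riemann_sum f (h / real q) (N * q) -\<^sub>S riemann_sum f h N) \<le> \<epsilon> * (h * real N)"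
  using assms(5)
proof (induction N)
  case 0
  then show ?case using b by (simp add: minus_self wnrm_zero)
next
  case (Suc N)
  let ?h = "h / real q"
  let ?R = "riemann_sum f ?h"
  let ?x = "?R (Suc N * q) -\<^sub>S ?R (N * q) -\<^sub>S act (\<lambda>_. h) (f (real N * h))"
    and ?y = "?R (N * q) -\<^sub>S riemann_sum f h N"
  have R: "?R n \<in> dominated b" "riemann_sum f h n \<in> dominated b" "f (real n * h) \<in> dominated b" for n
    using f \<open>0 \<le> h\<close> b by (auto intro!: riemann_sum_dominated)
  have d: "?x \<in> dominated b" "?y \<in> dominated b"
    using R b by (simp_all add: dominated_minus dominated_act del: mult_Suc)
  have hq: "?h * (real (Suc N * q) - real (N * q)) = h"
    using \<open>0 < q\<close> by (simp add: field_simps)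
  have "wnrm b (f (real k * ?h) -\<^sub>S f (real N * h)) \<le> \<epsilon>" if "N * q \<le> k" "k < Suc N * q" for k
  proof (rule Suc.prems)
    have "real N * real q \<le> real k" "real k \<le> (real N + 1) * real q"
      using that by (metis of_nat_le_iff of_nat_mult, metis of_nat_Suc of_nat_le_iff of_nat_mult less_imp_le add.commute)
    then show "real N * h \<le> real k * ?h" "real k * ?h \<le> (real N + 1) * h"
      using \<open>0 < q\<close> \<open>0 \<le> h\<close> mult_right_mono[of "real N * real q" "real k" h]
         mult_right_mono[of "real k" "(real N + 1) * real q" h]
      by (simp_all add: field_simps)
  qed simp
  then have 1: "wnrm b ?x \<le> \<epsilon> * h"
    using riemann_sum_wnrm_le[of b "N * q" "Suc N * q" ?h f "f (real N * h)" \<epsilon>] b R f \<open>0 \<le> h\<close>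
    unfolding hq by simp
  have cl: "?R n \<in> carrier S" "riemann_sum f h n \<in> carrier S" "f (real n * h) \<in> carrier S" for n
    using R by (blast intro: dominated_closed)+
  have eq: "?R (Suc N * q) -\<^sub>S riemann_sum f h (Suc N) = ?x +\<^sub>S ?y"
  proof -
    have "X -\<^sub>S (Z +\<^sub>S w) = (X -\<^sub>S Y -\<^sub>S w) +\<^sub>S (Y -\<^sub>S Z)"
      if c: "X \<in> carrier S" "Y \<in> carrier S" "Z \<in> carrier S" "w \<in> carrier S" for X Y Z w
    proof -
      have "(X -\<^sub>S Y -\<^sub>S w) +\<^sub>S (Y -\<^sub>S Z) = ((X -\<^sub>S Y) +\<^sub>S (Y -\<^sub>S Z)) -\<^sub>S w"
        using c by (simp add: M.minus_eq M.a_ac)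
      then show ?thesis using c by (simp add: minus_trans) (simp add: M.minus_eq M.minus_add M.a_ac)
    qed
    then show ?thesis using cl by simp
  qed
  have "wnrm b ?y \<le> \<epsilon> * (h * real N)" using Suc by simp
  with 1 show ?case
    unfolding eq using dominated_add(2)[OF b d] by (simp add: algebra_simps)
qed

text \<open>The pseudometric \<open>\<phi>\<close> is itself a continuous real function on a compact
  square, hence uniformly continuous, and it vanishes on the diagonal; the claim follows by
  comparing \<open>(s, r)\<close> with \<open>(r, r)\<close>. Domination makes continuity in
  probability a continuity for \<open>wnrm\<close>.\<close>

lemma uniformly_continuous_wnrm:
  fixes f :: "real \<Rightarrow> 's"
  assumes f: "\<And>s. 0 \<le> s \<Longrightarrow> f s \<in> carrier S"
    and cont: "\<And>t. 0 \<le> t \<Longrightarrow> conv f (f t) (at t within {0..})"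
    and b: "b \<in> borel_measurable P"
    and dom: "\<And>s. 0 \<le> s \<Longrightarrow> AE w in P. nrm (f s) w \<le> b w"
    and "0 < \<epsilon>"
  obtains \<delta> where "0 < \<delta>"
    "\<And>s r. s \<in> {0..T} \<Longrightarrow> r \<in> {0..T} \<Longrightarrow> \<bar>s - r\<bar> < \<delta> \<Longrightarrow> wnrm b (f s -\<^sub>S f r) < \<epsilon>"
proof -
  have fD: "f s \<in> dominated b" if "0 \<le> s" for s
    using dom[OF that] by (intro dominatedI[of _ 1] f that, eventually_elim) auto
  have near: "\<exists>\<delta>>0. \<forall>s\<ge>0. \<bar>s - t\<bar> < \<delta> \<longrightarrow> wnrm b (f s -\<^sub>S f t) < e" if "0 \<le> t" "0 < e" for t e
  proof -
    have "((\<lambda>s. wnrm b (f s -\<^sub>S f t)) \<longlongrightarrow> 0) (at t within {0..})"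
    proof (rule wnrm_tendsto_of_mag[OF b, where K = 2])
      show "eventually (\<lambda>s. f s -\<^sub>S f t \<in> carrier S \<and> (AE w in P. nrm (f s -\<^sub>S f t) w \<le> 2 * (1 + \<bar>b w\<bar>)))
          (at t within {0..})"
      proof (rule eventually_within, intro conjI)
        fix s :: real assume "s \<in> {0..}"
        then have s: "0 \<le> s" by simp
        show "f s -\<^sub>S f t \<in> carrier S" using f[OF s] f[OF \<open>0 \<le> t\<close>] by simp
        show "AE w in P. nrm (f s -\<^sub>S f t) w \<le> 2 * (1 + \<bar>b w\<bar>)"
          using nrm_sub[OF f[OF s] f[OF \<open>0 \<le> t\<close>]] dom[OF s] dom[OF \<open>0 \<le> t\<close>]
        proof eventually_elim
          case (elim w)
          then have "nrm (f s -\<^sub>S f t) w \<le> 2 * b w" by simp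
          also have "\<dots> \<le> 2 * (1 + \<bar>b w\<bar>)" using abs_ge_self[of "b w"] by simp
          finally show ?case .
        qed
      qed
      show "((\<lambda>s. mag (nrm (f s -\<^sub>S f t))) \<longlongrightarrow> 0) (at t within {0..})"
        using cont[OF \<open>0 \<le> t\<close>] by (simp add: conv_def)
    qed simp
    from order_tendstoD(2)[OF this \<open>0 < e\<close>] obtain \<delta> where "0 < \<delta>"
      and \<delta>: "\<And>s. 0 \<le> s \<Longrightarrow> s \<noteq> t \<Longrightarrow> \<bar>s - t\<bar> < \<delta> \<Longrightarrow> wnrm b (f s -\<^sub>S f t) < e"
      unfolding eventually_at by (auto simp: dist_real_def)
    have "wnrm b (f t -\<^sub>S f t) < e" using f[OF \<open>0 \<le> t\<close>] b \<open>0 < e\<close> by (simp add: minus_self wnrm_zero)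
    with \<delta> \<open>0 < \<delta>\<close> show ?thesis by metis
  qed
  define \<phi> where "\<phi> p = wnrm b (f (fst p) -\<^sub>S f (snd p))" for p :: "real \<times> real"
  have \<phi>_diff: "\<bar>\<phi> (s, r) - \<phi> (s', r')\<bar> \<le> \<phi> (s, s') + \<phi> (r, r')"
    if "0 \<le> s" "0 \<le> r" "0 \<le> s'" "0 \<le> r'" for s r s' r'
  proof -
    have tri: "\<phi> (x, z) \<le> \<phi> (x, y) + \<phi> (y, z)" if "0 \<le> x" "0 \<le> y" "0 \<le> z" for x y z
      unfolding \<phi>_def using wnrm_triangle[OF b fD[OF that(1)] fD[OF that(2)] fD[OF that(3)]] by simp
    have comm: "\<phi> (x, y) = \<phi> (y, x)" if "0 \<le> x" "0 \<le> y" for x y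
      unfolding \<phi>_def using wnrm_minus_commute[OF b f[OF that(1)] f[OF that(2)]] by simp
    show ?thesis
      using tri[of s s' r] tri[of s' r' r] tri[of s' s r'] tri[of s r r'] comm[of s s'] comm[of r r'] that
      by linarith
  qed
  have "continuous_on ({0..T} \<times> {0..T}) \<phi>"
    unfolding continuous_on_iff
  proof (intro ballI allI impI)
    fix p and e :: real assume p: "p \<in> {0..T} \<times> {0..T}" and "0 < e"
    obtain s r where sr: "p = (s, r)" "0 \<le> s" "0 \<le> r" using p by auto
    obtain \<delta>1 where 1: "0 < \<delta>1" "\<forall>s'\<ge>0. \<bar>s' - s\<bar> < \<delta>1 \<longrightarrow> wnrm b (f s' -\<^sub>S f s) < e / 2"
      using near[OF sr(2), of "e / 2"] \<open>0 < e\<close> by auto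
    obtain \<delta>2 where 2: "0 < \<delta>2" "\<forall>r'\<ge>0. \<bar>r' - r\<bar> < \<delta>2 \<longrightarrow> wnrm b (f r' -\<^sub>S f r) < e / 2"
      using near[OF sr(3), of "e / 2"] \<open>0 < e\<close> by auto
    show "\<exists>d>0. \<forall>p'\<in>{0..T} \<times> {0..T}. dist p' p < d \<longrightarrow> dist (\<phi> p') (\<phi> p) < e"
    proof (intro exI[of _ "min \<delta>1 \<delta>2"] conjI ballI impI)
      fix p' assume p': "p' \<in> {0..T} \<times> {0..T}" "dist p' p < min \<delta>1 \<delta>2"
      obtain s' r' where sr': "p' = (s', r')" "0 \<le> s'" "0 \<le> r'" using p' by auto
      have "\<bar>s' - s\<bar> < \<delta>1" "\<bar>r' - r\<bar> < \<delta>2"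
        using p'(2) dist_fst_le[of p' p] dist_snd_le[of p' p] by (auto simp: sr sr' dist_real_def)
      then have "\<phi> (s', s) < e / 2" "\<phi> (r', r) < e / 2" using 1 2 sr' by (auto simp: \<phi>_def)
      then show "dist (\<phi> p') (\<phi> p) < e"
        using \<phi>_diff[OF sr'(2,3) sr(2,3)] by (simp add: sr sr' dist_real_def)
    qed (use 1 2 in simp)
  qed
  then have "uniformly_continuous_on ({0..T} \<times> {0..T}) \<phi>"
    by (intro compact_uniformly_continuous compact_Times) auto
  from uniformly_continuous_onE[OF this \<open>0 < \<epsilon>\<close>] obtain \<delta> where "0 < \<delta>"
    and \<delta>: "\<And>p p'. p \<in> {0..T} \<times> {0..T} \<Longrightarrow> p' \<in> {0..T} \<times> {0..T} \<Longrightarrow> dist p' p < \<delta> \<Longrightarrow> dist (\<phi> p') (\<phi> p) < \<epsilon>"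
    by metis
  show ?thesis
  proof (rule that[OF \<open>0 < \<delta>\<close>])
    fix s r assume sr: "s \<in> {0..T}" "r \<in> {0..T}" "\<bar>s - r\<bar> < \<delta>"
    then have "dist (\<phi> (s, r)) (\<phi> (r, r)) < \<epsilon>"
      by (intro \<delta>) (auto simp: dist_prod_def dist_real_def)
    moreover have "\<phi> (r, r) = 0" using f[of r] sr b by (simp add: \<phi>_def minus_self wnrm_zero)
    ultimately show "wnrm b (f s -\<^sub>S f r) < \<epsilon>" by (simp add: \<phi>_def dist_real_def)
  qed
qed

lemma minus_swap_act:
  "x \<in> carrier S \<Longrightarrow> y \<in> carrier S \<Longrightarrow> x -\<^sub>S y = act (\<lambda>_. -1) (y -\<^sub>S x)"
  using minus_minus_swap[of y x] minus_act[of "y -\<^sub>S x"] by simp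

lemma diff_quot_commute:
  assumes "u s \<in> carrier S" "u t \<in> carrier S"
  shows "diff_quot u t s = diff_quot u s t"
proof -
  have "diff_quot u t s = act (\<lambda>_. 1 / (s - t)) (act (\<lambda>_. -1) (u t -\<^sub>S u s))"
    using assms by (simp only: diff_quot_def minus_swap_act[of "u s" "u t"])
  also have "\<dots> = diff_quot u s t"
    using assms by (subst act_act) (simp_all add: diff_quot_def minus_divide_right)
  finally show ?thesis .
qed

text \<open>Dyadic left sums are Cauchy in \<open>wnrm b\<close>, hence in probability, and
  completeness yields the limit. The last conclusion stands beside the derivative because a
  derivative in probability does not bound increments; it holds for the sums up to one mesh and
  passes to the limit.\<close>

lemma antiderivative_exists:
  assumes complete: "el_complete P S"
    and f: "\<And>s. 0 \<le> s \<Longrightarrow> f s \<in> carrier S"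
    and cont: "\<And>t. 0 \<le> t \<Longrightarrow> conv f (f t) (at t within {0..})"
    and b[measurable]: "b \<in> borel_measurable P"
    and dom: "\<And>s. 0 \<le> s \<Longrightarrow> AE w in P. nrm (f s) w \<le> b w"
  obtains F where "\<And>t. 0 \<le> t \<Longrightarrow> F t \<in> carrier S" "F 0 = 0\<^sub>S"
    "\<And>t. 0 \<le> t \<Longrightarrow> has_deriv F (f t) t {0..}"
    "\<And>s t c. 0 \<le> s \<Longrightarrow> s \<le> t \<Longrightarrow> c \<in> borel_measurable P
      \<Longrightarrow> (\<And>r. r \<in> {s..t} \<Longrightarrow> AE w in P. nrm (f r) w \<le> c w)
      \<Longrightarrow> AE w in P. nrm (F t -\<^sub>S F s) w \<le> c w * (t - s)"
proof -
  have fD: "f s \<in> dominated b" if "0 \<le> s" for s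
    using dom[OF that] by (intro dominatedI[of _ 1] f that, eventually_elim) auto
  \<comment> \<open>Rounding up places the nodes from \<open>ix n s\<close> to just before
    \<open>ix n t\<close> in \<open>[s, t]\<close>, so that bounds known on this interval alone
    apply; the length covered exceeds \<open>t\<close> by less than one mesh.\<close>
  define ix where "ix n t = nat \<lceil>t * 2 ^ n\<rceil>" for n :: nat and t :: real
  have ix: "t * 2 ^ n \<le> real (ix n t)" "real (ix n t) < t * 2 ^ n + 1" if "0 \<le> t" for n t
    using that unfolding ix_def by (auto simp: of_nat_nat) linarith+
  have ix_le: "ix n t \<le> k" if "t * 2 ^ n \<le> real k" for n t k
    using that unfolding ix_def by (simp add: ceiling_le_iff nat_le_iff)
  have ix_gt: "real k < t * 2 ^ n" if "k < ix n t" for n t k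
    using ix_le[of t n k] that by linarith
  have ix_mono: "ix n s \<le> ix n t" if "s \<le> t" for n s t
    unfolding ix_def using that by (intro nat_mono ceiling_mono mult_right_mono) auto
  define J where "J n t = riemann_sum f (1 / 2 ^ n) (ix n t)" for n t
  have JD: "J n t \<in> dominated b" for n t
    unfolding J_def by (intro riemann_sum_dominated b fD) simp
  note JS = dominated_closed[OF JD]
  have ix_diff: "0 \<le> 1 / 2 ^ n * (real (ix n t) - real (ix n s))"
      "1 / 2 ^ n * (real (ix n t) - real (ix n s)) \<le> (t - s) + 1 / 2 ^ n"
      "(t - s) - 1 / 2 ^ n \<le> 1 / 2 ^ n * (real (ix n t) - real (ix n s))"
    if "0 \<le> s" "s \<le> t" for n s t
  proof -
    have *: "r \<le> 1 / 2 ^ n * real (ix n r)" "1 / 2 ^ n * real (ix n r) \<le> r + 1 / 2 ^ n" if "0 \<le> r" for r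
      using ix[OF that, of n] by (simp_all add: field_simps)
    show "0 \<le> 1 / 2 ^ n * (real (ix n t) - real (ix n s))"
      using ix_mono[OF that(2), of n] by simp
    show "1 / 2 ^ n * (real (ix n t) - real (ix n s)) \<le> (t - s) + 1 / 2 ^ n"
      "(t - s) - 1 / 2 ^ n \<le> 1 / 2 ^ n * (real (ix n t) - real (ix n s))"
      using *[of s] *[of t] that unfolding right_diff_distrib by linarith+
  qed
  have nodes: "real k * (1 / 2 ^ n) \<in> {s..t}" if "0 \<le> s" "ix n s \<le> k" "k < ix n t" for n k s t
    using ix(1)[OF that(1), of n] ix_gt[OF that(3)] that(2) by (auto simp: field_simps)
  have J_bound: "AE w in P. nrm (J n t -\<^sub>S J n s) w \<le> c w * ((t - s) + 1 / 2 ^ n)"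
    if "0 \<le> s" "s \<le> t" and c: "\<And>r. r \<in> {s..t} \<Longrightarrow> AE w in P. nrm (f r) w \<le> c w" for n s t c
  proof -
    have "AE w in P. nrm (J n t -\<^sub>S J n s) w \<le> c w * (1 / 2 ^ n * (real (ix n t) - real (ix n s)))"
      unfolding J_def using that
      by (intro riemann_sum_nrm_le ix_mono f c nodes) auto
    moreover have "AE w in P. 0 \<le> nrm (f s) w" "AE w in P. nrm (f s) w \<le> c w"
      using that nrm_nonneg[OF f[OF that(1)]] by simp_all
    ultimately show ?thesis
    proof eventually_elim
      case (elim w)
      then have "c w * (1 / 2 ^ n * (real (ix n t) - real (ix n s))) \<le> c w * ((t - s) + 1 / 2 ^ n)"
        using ix_diff(2)[OF that(1,2)] by (intro mult_left_mono) auto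
      with elim show ?case by linarith
    qed
  qed
  have wnrm_f: "wnrm b (f s) \<le> 1" if "0 \<le> s" for s
    using dom[OF that] by (intro wnrm_le b f that, eventually_elim) auto
  have small: "eventually (\<lambda>n. 1 / 2 ^ n < e) sequentially" if "0 < e" for e :: real
  proof -
    have "(\<lambda>n. (1 / 2) ^ n) \<longlonglongrightarrow> (0::real)" by (rule LIMSEQ_power_zero) simp
    from order_tendstoD(2)[OF this that] show ?thesis by (simp add: power_divide)
  qed
  have J_cauchy: "\<exists>N. \<forall>n\<ge>N. \<forall>m\<ge>n. wnrm b (J m t -\<^sub>S J n t) \<le> e" if "0 \<le> t" "0 < e" for t e
  proof -
    \<comment> \<open>Half of the error pays for refining the mesh on a length of at most
      \<open>t + 1\<close>, the other half for the last cell, which may reach beyond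
      \<open>t\<close>.\<close>
    define e' where "e' = e / (2 * (t + 1))"
    have e': "0 < e'" "e' * (t + 1) = e / 2" using that by (auto simp: e'_def field_simps)
    obtain \<delta> where \<delta>: "0 < \<delta>" "\<And>s r. s \<in> {0..t + 1} \<Longrightarrow> r \<in> {0..t + 1} \<Longrightarrow> \<bar>s - r\<bar> < \<delta>
        \<Longrightarrow> wnrm b (f s -\<^sub>S f r) < e'"
      using uniformly_continuous_wnrm[of f b e' "t + 1", OF f cont b dom e'(1)] by blast
    have "0 < min \<delta> (e / 2)" using \<delta>(1) that by simp
    from small[OF this] obtain N where N: "\<And>n. n \<ge> N \<Longrightarrow> 1 / 2 ^ n < min \<delta> (e / 2)"
      unfolding eventually_sequentially by blast
    have "wnrm b (J m t -\<^sub>S J n t) \<le> e" if "N \<le> n" "n \<le> m" for m n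
    proof -
      define h :: real where "h = 1 / 2 ^ n"
      define q :: nat where "q = 2 ^ (m - n)"
      define I where "I = ix n t"
      have h: "0 < h" "h \<le> 1" "h < \<delta>" "h < e / 2" using N[OF that(1)] by (auto simp: h_def)
      have q: "0 < q" "h / real q = 1 / 2 ^ m"
        using that(2) by (auto simp: q_def h_def simp flip: power_add)
      have I: "t \<le> h * real I" "h * real I \<le> t + h"
        using ix[OF \<open>0 \<le> t\<close>, of n] by (auto simp: h_def I_def field_simps)
      have Iq: "ix m t \<le> I * q"
      proof (rule ix_le)
        have "h = real q / 2 ^ m" using q by (simp add: divide_eq_eq)
        with I(1) have "t \<le> real I * real q / 2 ^ m" by (simp add: mult.commute)
        then show "t * 2 ^ m \<le> real (I * q)" by (simp add: pos_le_divide_eq)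
      qed
      let ?R = "riemann_sum f (h / real q) (I * q)"
      have RD: "?R \<in> dominated b" using h q by (intro riemann_sum_dominated b fD) auto
      have "wnrm b (?R -\<^sub>S riemann_sum f h I) \<le> e' * (h * real I)"
      proof (rule riemann_sum_refine[OF b _ q(1)])
        fix k r assume k: "k < I" "real k * h \<le> r" "r \<le> (real k + 1) * h"
        have "(real k + 1) * h \<le> real I * h" using k(1) h(1) by (intro mult_right_mono) auto
        then have "(real k + 1) * h \<le> t + 1" using I(2) h(2) by (simp add: mult.commute)
        moreover have "0 \<le> real k * h" using h by simp
        moreover from this have "0 \<le> r" using k(2) by linarith
        ultimately have "wnrm b (f r -\<^sub>S f (real k * h)) < e'"
          using k h by (intro \<delta>(2)) (auto simp: distrib_right)
        then show "wnrm b (f r -\<^sub>S f (real k * h)) \<le> e'" by simp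
      qed (use h fD in auto)
      also have "\<dots> \<le> e' * (t + 1)" using I h e' by (intro mult_left_mono) auto
      finally have 1: "wnrm b (?R -\<^sub>S J n t) \<le> e / 2"
        using e'(2) by (simp add: J_def h_def I_def)
      \<comment> \<open>The refined coarse sum may contain nodes beyond those of
        \<open>J m t\<close>; the excess is a sum over a length of at most \<open>h\<close> of
        values whose \<open>wnrm\<close> is at most 1.\<close>
      have "wnrm b (?R -\<^sub>S J m t -\<^sub>S act (\<lambda>_. 1 / 2 ^ m * (real (I * q) - real (ix m t))) 0\<^sub>S)
          \<le> 1 * (1 / 2 ^ m * (real (I * q) - real (ix m t)))"
        unfolding J_def q(2)
      proof (rule riemann_sum_wnrm_le[OF b Iq])
        fix k
        show "wnrm b (f (real k * (1 / 2 ^ m)) -\<^sub>S 0\<^sub>S) \<le> 1"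
          using wnrm_f[of "real k * (1 / 2 ^ m)"] f[of "real k * (1 / 2 ^ m)"] by (simp add: minus_zero_right)
      qed (use fD dominated_zero in auto)
      moreover have "act (\<lambda>_. 1 / 2 ^ m * (real (I * q) - real (ix m t))) 0\<^sub>S = 0\<^sub>S" by simp
      moreover have "?R -\<^sub>S J m t \<in> carrier S" using RD JS dominated_closed by blast
      ultimately have "wnrm b (?R -\<^sub>S J m t) \<le> 1 / 2 ^ m * (real (I * q) - real (ix m t))"
        by (simp only: minus_zero_right mult_1)
      also have "\<dots> = h * real I - 1 / 2 ^ m * real (ix m t)"
        using q by (simp add: right_diff_distrib flip: q(2))
      also have "\<dots> \<le> h"
      proof -
        have "t \<le> 1 / 2 ^ m * real (ix m t)" using ix(1)[OF \<open>0 \<le> t\<close>, of m] by (simp add: field_simps)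
        with I(2) show ?thesis by linarith
      qed
      finally have "wnrm b (J m t -\<^sub>S ?R) \<le> e / 2"
        using h wnrm_minus_commute[OF b JS dominated_closed[OF RD]] by simp
      with 1 show ?thesis using wnrm_triangle[OF b JD RD JD] by (smt (verit) field_sum_of_halves)
    qed
    then show ?thesis by blast
  qed
  have "\<exists>l. conv (\<lambda>n. J n t) l sequentially" if t: "0 \<le> t" for t
  proof (rule complete_mag[OF complete JS])
    fix e :: real assume "0 < e"
    \<comment> \<open>The Cauchy property is phrased as a limit along a product filter, so that
      \<open>mag_nrm_tendsto_of_wnrm\<close> transfers it from \<open>wnrm\<close> to
      \<open>mag\<close>.\<close>
    have "((\<lambda>p. wnrm b (J (fst p) t -\<^sub>S J (snd p) t)) \<longlongrightarrow> 0) (sequentially \<times>\<^sub>F sequentially)"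
    proof (rule order_tendstoI)
      fix a :: real assume "a < 0"
      then show "eventually (\<lambda>p. a < wnrm b (J (fst p) t -\<^sub>S J (snd p) t)) (sequentially \<times>\<^sub>F sequentially)"
        using wnrm_nonneg[OF M.minus_closed[OF JS JS], of b] by (intro always_eventually allI) (rule less_le_trans)
    next
      fix a :: real assume "0 < a"
      then obtain N where N: "\<And>m n. N \<le> n \<Longrightarrow> n \<le> m \<Longrightarrow> wnrm b (J m t -\<^sub>S J n t) \<le> a / 2"
        using J_cauchy[OF t, of "a / 2"] by auto
      have "wnrm b (J m t -\<^sub>S J n t) \<le> a / 2" if "N \<le> m" "N \<le> n" for m n
        using N[of n m] N[of m n] that wnrm_minus_commute[OF b JS JS, of m t n t] by (cases "n \<le> m") auto
      moreover have "a / 2 < a" using \<open>0 < a\<close> by simp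
      ultimately have "wnrm b (J m t -\<^sub>S J n t) < a" if "N \<le> m" "N \<le> n" for m n
        using that by (meson le_less_trans)
      then show "eventually (\<lambda>p. wnrm b (J (fst p) t -\<^sub>S J (snd p) t) < a) (sequentially \<times>\<^sub>F sequentially)"
        unfolding eventually_prod_sequentially by auto
    qed
    then have "((\<lambda>p. mag (nrm (J (fst p) t -\<^sub>S J (snd p) t))) \<longlongrightarrow> 0) (sequentially \<times>\<^sub>F sequentially)"
      by (intro mag_nrm_tendsto_of_wnrm[OF b]) (simp_all add: dominated_minus b JD)
    from order_tendstoD(2)[OF this \<open>0 < e\<close>]
    show "\<exists>N. \<forall>m\<ge>N. \<forall>n\<ge>N. mag (nrm (J m t -\<^sub>S J n t)) < e"
      unfolding eventually_prod_sequentially by auto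
  qed
  then obtain F where F: "\<And>t. 0 \<le> t \<Longrightarrow> conv (\<lambda>n. J n t) (F t) sequentially" by metis
  have FS: "F t \<in> carrier S" if "0 \<le> t" for t using F[OF that] by (rule conv_closed)
  have conv_diff: "conv (\<lambda>n. J n t -\<^sub>S J n s) (F t -\<^sub>S F s) sequentially" if "0 \<le> s" "0 \<le> t" for s t
    by (rule conv_minus) (rule F, rule that)+
  have F_bound: "AE w in P. nrm (F t -\<^sub>S F s) w \<le> c w * (t - s)"
    if st: "0 \<le> s" "s \<le> t" and c[measurable]: "c \<in> borel_measurable P"
      and dom_c: "\<And>r. r \<in> {s..t} \<Longrightarrow> AE w in P. nrm (f r) w \<le> c w" for s t c
  proof -
    have c0: "AE w in P. 0 \<le> c w"
      using nrm_nonneg[OF f[OF st(1)]] dom_c[of s] st(2) by auto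
    \<comment> \<open>\<open>conv_nrm_le\<close> takes a bound that does not depend on
      \<open>n\<close>, so \<open>1 / 2 ^ n\<close> is first replaced by \<open>1 / 2 ^ k\<close>
      with \<open>k\<close> fixed; then \<open>k\<close> tends to infinity off a single null
      set.\<close>
    have "AE w in P. nrm (F t -\<^sub>S F s) w \<le> c w * ((t - s) + 1 / 2 ^ k)" for k :: nat
    proof (rule conv_nrm_le[OF conv_diff])
      show "eventually (\<lambda>n. AE w in P. nrm (J n t -\<^sub>S J n s) w \<le> c w * ((t - s) + 1 / 2 ^ k)) sequentially"
        using eventually_ge_at_top[of k]
      proof eventually_elim
        case (elim n)
        have le: "t - s + 1 / 2 ^ n \<le> t - s + 1 / 2 ^ k" using elim by (simp add: frac_le power_increasing)
        have "AE w in P. nrm (J n t -\<^sub>S J n s) w \<le> c w * ((t - s) + 1 / 2 ^ n)"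
          by (rule J_bound[OF st dom_c])
        then show ?case using c0
        proof eventually_elim
          case (elim w)
          with mult_left_mono[OF le elim(2)] show ?case by linarith
        qed
      qed
    qed (use st in auto)
    then have "AE w in P. \<forall>k::nat. nrm (F t -\<^sub>S F s) w \<le> c w * ((t - s) + 1 / 2 ^ k)"
      by (simp add: AE_all_countable)
    then show ?thesis
    proof eventually_elim
      case (elim w)
      have "(\<lambda>k. (1 / 2) ^ k) \<longlonglongrightarrow> (0::real)" by (rule LIMSEQ_power_zero) simp
      then have "(\<lambda>k. c w * ((t - s) + (1 / 2) ^ k)) \<longlonglongrightarrow> c w * ((t - s) + 0)"
        by (intro tendsto_mult tendsto_add tendsto_const)
      then show ?case
        by (intro LIMSEQ_le_const[of "\<lambda>k. c w * ((t - s) + (1 / 2) ^ k)"]) (use elim in \<open>auto simp: power_divide\<close>)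
    qed
  qed
  have weak: "wnrm b (F s' -\<^sub>S F s -\<^sub>S act (\<lambda>_. s' - s) (f t)) \<le> \<epsilon> * (s' - s)"
    if st: "0 \<le> s" "s \<le> s'" "0 \<le> t" "0 < \<epsilon>"
      and \<epsilon>: "\<And>r. r \<in> {s..s'} \<Longrightarrow> wnrm b (f r -\<^sub>S f t) \<le> \<epsilon>" for s s' t \<epsilon>
  proof -
    define a where "a n = 1 / 2 ^ n * (real (ix n s') - real (ix n s))" for n
    define D where "D n = J n s' -\<^sub>S J n s -\<^sub>S act (\<lambda>_. a n) (f t)" for n
    let ?D = "F s' -\<^sub>S F s -\<^sub>S act (\<lambda>_. s' - s) (f t)"
    have s': "0 \<le> s'" using st by simp
    have pow: "(\<lambda>n. (1 / 2) ^ n) \<longlonglongrightarrow> (0::real)" by (rule LIMSEQ_power_zero) simp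
    have a_lim: "a \<longlonglongrightarrow> s' - s"
    proof (rule tendsto_sandwich)
      show "(\<lambda>n. (s' - s) - (1 / 2) ^ n) \<longlonglongrightarrow> s' - s" "(\<lambda>n. (s' - s) + (1 / 2) ^ n) \<longlonglongrightarrow> s' - s"
        using tendsto_diff[OF tendsto_const pow] tendsto_add[OF tendsto_const pow] by simp_all
    qed (use ix_diff(2,3)[OF st(1,2)] in \<open>auto simp: a_def power_divide\<close>)
    have a_le: "0 \<le> a n" "a n \<le> s' - s + 1" for n
    proof -
      have "(1::real) / 2 ^ n \<le> 1" by simp
      then show "0 \<le> a n" "a n \<le> s' - s + 1"
        using ix_diff(1,2)[OF st(1,2), of n] unfolding a_def by linarith+
    qed
    have ft: "f t \<in> carrier S" using f st(3) by simp
    have D_conv: "conv D ?D sequentially"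
      unfolding D_def
    proof (rule conv_minus[OF conv_diff[OF st(1) s'] conv_act_var[OF conv_const[OF ft]]])
      show "(\<lambda>n. mag (\<lambda>w. a n - (s' - s))) \<longlonglongrightarrow> 0"
        using tendsto_min[OF tendsto_const[of 1] tendsto_rabs[OF LIM_zero[OF a_lim]]] by (simp add: mag_const)
    qed simp_all
    have DD: "D n \<in> dominated b" for n
      unfolding D_def by (intro dominated_minus dominated_act b JD fD st)
    \<comment> \<open>One bound for all \<open>D n\<close>, so that convergence in probability
      implies convergence in \<open>wnrm\<close>: the increment of \<open>J n\<close> and the
      multiple of \<open>f t\<close> contribute \<open>s' - s + 1\<close> each, as the mesh is at
      most 1.\<close>
    define K where "K = 2 * (s' - s + 1)"
    have D_nrm: "AE w in P. nrm (D n) w \<le> K * (1 + \<bar>b w\<bar>)" for n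
    proof -
      have 1: "AE w in P. nrm (J n s' -\<^sub>S J n s) w \<le> b w * ((s' - s) + 1 / 2 ^ n)"
        using st by (intro J_bound dom) auto
      have 2: "AE w in P. nrm (act (\<lambda>_. a n) (f t)) w = \<bar>a n\<bar> * nrm (f t) w"
        by (rule nrm_act) (simp_all add: ft)
      have c: "J n s' -\<^sub>S J n s \<in> carrier S" "act (\<lambda>_. a n) (f t) \<in> carrier S"
        using JS ft by auto
      show ?thesis
        unfolding D_def using 1 2 nrm_sub[OF c] dom[OF st(3)] nrm_nonneg[OF ft]
      proof eventually_elim
        case (elim w)
        have "b w * ((s' - s) + 1 / 2 ^ n) \<le> (1 + \<bar>b w\<bar>) * (s' - s + 1)"
          using st(2) by (intro mult_mono) auto
        moreover have "\<bar>a n\<bar> * nrm (f t) w \<le> (s' - s + 1) * (1 + \<bar>b w\<bar>)"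
          using a_le[of n] st(2) elim(4,5) by (intro mult_mono) auto
        ultimately show ?case using elim by (simp add: K_def algebra_simps)
      qed
    qed
    have D'_nrm: "AE w in P. nrm ?D w \<le> K * (1 + \<bar>b w\<bar>)"
      by (rule conv_nrm_le[OF D_conv]) (use D_nrm in auto)
    have D'S: "?D \<in> carrier S" using D_conv by (rule conv_closed)
    then have D'D: "?D \<in> dominated b" using D'_nrm by (rule dominatedI)
    have "(\<lambda>n. wnrm b (D n -\<^sub>S ?D)) \<longlonglongrightarrow> 0"
    proof (rule wnrm_tendsto_of_mag[OF b, where K = "2 * K"])
      show "eventually (\<lambda>n. D n -\<^sub>S ?D \<in> carrier S \<and> (AE w in P. nrm (D n -\<^sub>S ?D) w \<le> 2 * K * (1 + \<bar>b w\<bar>))) sequentially"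
      proof (rule always_eventually, rule allI, rule conjI)
        fix n
        note DS = dominated_closed[OF DD[of n]]
        show "D n -\<^sub>S ?D \<in> carrier S" using DS D'S by (rule M.minus_closed)
        show "AE w in P. nrm (D n -\<^sub>S ?D) w \<le> 2 * K * (1 + \<bar>b w\<bar>)"
          using nrm_sub[OF DS D'S] D_nrm[of n] D'_nrm by eventually_elim linarith
      qed
      show "1 \<le> 2 * K" using st by (simp add: K_def)
      show "(\<lambda>n. mag (nrm (D n -\<^sub>S ?D))) \<longlonglongrightarrow> 0" using D_conv by (simp add: conv_def)
    qed
    then have "(\<lambda>n. wnrm b (D n -\<^sub>S ?D) + \<epsilon> * a n) \<longlonglongrightarrow> 0 + \<epsilon> * (s' - s)"
      by (intro tendsto_add tendsto_mult tendsto_const a_lim)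
    moreover have "wnrm b ?D \<le> wnrm b (D n -\<^sub>S ?D) + \<epsilon> * a n" for n
    proof -
      note DS = dominated_closed[OF DD[of n]]
      have "wnrm b (D n) \<le> \<epsilon> * a n"
        unfolding D_def J_def a_def using st
        by (intro riemann_sum_wnrm_le b ix_mono fD \<epsilon> nodes) auto
      moreover have "wnrm b (?D -\<^sub>S 0\<^sub>S) \<le> wnrm b (?D -\<^sub>S D n) + wnrm b (D n -\<^sub>S 0\<^sub>S)"
        by (rule wnrm_triangle[OF b D'D DD dominated_zero])
      ultimately show ?thesis
        using wnrm_minus_commute[OF b DS D'S] by (simp only: minus_zero_right[OF D'S] minus_zero_right[OF DS])
    qed
    ultimately show ?thesis using LIMSEQ_le_const by (metis (no_types, lifting) add_0)
  qed
  have F_deriv: "has_deriv F (f t) t {0..}" if t: "0 \<le> t" for t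
    unfolding has_deriv_def conv_def
  proof (intro conjI)
    have dqS: "diff_quot F t s \<in> carrier S" if "0 \<le> s" for s
      using FS[OF that] FS[OF t] by (simp add: diff_quot_def)
    have ft: "f t \<in> carrier S" using f t by simp
    then show "f t \<in> carrier S" .
    show "eventually (\<lambda>s. diff_quot F t s \<in> carrier S) (at t within {0..})"
      by (rule eventually_within) (simp add: dqS)
    have FD: "F s -\<^sub>S F r \<in> dominated b" if "0 \<le> s" "0 \<le> r" for s r
    proof -
      have *: "F s -\<^sub>S F r \<in> dominated b" if "0 \<le> r" "r \<le> s" for r s
      proof (rule dominatedI)
        show "F s -\<^sub>S F r \<in> carrier S" using that FS by simp
        have "AE w in P. nrm (F s -\<^sub>S F r) w \<le> b w * (s - r)"
          using that by (intro F_bound dom) auto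
        then show "AE w in P. nrm (F s -\<^sub>S F r) w \<le> (s - r) * (1 + \<bar>b w\<bar>)"
        proof eventually_elim
          case (elim w)
          have "b w * (s - r) \<le> (1 + \<bar>b w\<bar>) * (s - r)" using that by (intro mult_right_mono) auto
          with elim show ?case by (simp add: mult.commute)
        qed
      qed
      have "F s -\<^sub>S F r = act (\<lambda>_. -1) (F r -\<^sub>S F s)"
        using FS[OF that(1)] FS[OF that(2)] by (rule minus_swap_act)
      then show ?thesis using *[of r s] *[of s r] dominated_act(1)[OF b, of "F r -\<^sub>S F s" "-1"] that
        by (cases "r \<le> s") auto
    qed
    have dq: "diff_quot F r s -\<^sub>S f t = act (\<lambda>_. 1 / (s - r)) (F s -\<^sub>S F r -\<^sub>S act (\<lambda>_. s - r) (f t))"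
      if "0 \<le> s" "0 \<le> r" "s \<noteq> r" for s r
      using FS[OF that(1)] FS[OF that(2)] ft that(3)
      by (simp add: diff_quot_def act_minus_right act_act)
    show "((\<lambda>s. mag (nrm (diff_quot F t s -\<^sub>S f t))) \<longlongrightarrow> 0) (at t within {0..})"
    proof (rule mag_nrm_tendsto_of_wnrm[OF b])
      show "eventually (\<lambda>s. diff_quot F t s -\<^sub>S f t \<in> dominated b) (at t within {0..})"
        by (rule eventually_within) (simp add: diff_quot_def dominated_minus dominated_act FD fD b t)
      show "((\<lambda>s. wnrm b (diff_quot F t s -\<^sub>S f t)) \<longlongrightarrow> 0) (at t within {0..})"
      proof (rule tendstoI)
        fix e :: real assume "0 < e"
        then obtain \<delta> where \<delta>: "0 < \<delta>" "\<And>s r. s \<in> {0..t + 1} \<Longrightarrow> r \<in> {0..t + 1} \<Longrightarrow> \<bar>s - r\<bar> < \<delta>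
            \<Longrightarrow> wnrm b (f s -\<^sub>S f r) < e / 2"
          using uniformly_continuous_wnrm[of f b "e / 2" "t + 1", OF f cont b dom] half_gt_zero by blast
        have main: "wnrm b (act (\<lambda>_. 1 / (s' - s)) (F s' -\<^sub>S F s -\<^sub>S act (\<lambda>_. s' - s) (f t))) \<le> e / 2"
          if ss: "0 \<le> s" "s < s'" "\<And>r. r \<in> {s..s'} \<Longrightarrow> \<bar>r - t\<bar> < \<delta> \<and> r \<le> t + 1" for s s'
        proof -
          have "wnrm b (F s' -\<^sub>S F s -\<^sub>S act (\<lambda>_. s' - s) (f t)) \<le> e / 2 * (s' - s)"
          proof (rule weak)
            fix r assume "r \<in> {s..s'}"
            then have "wnrm b (f r -\<^sub>S f t) < e / 2" using ss t by (intro \<delta>(2)) auto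
            then show "wnrm b (f r -\<^sub>S f t) \<le> e / 2" by simp
          qed (use ss t \<open>0 < e\<close> in auto)
          then have "\<bar>1 / (s' - s)\<bar> * wnrm b (F s' -\<^sub>S F s -\<^sub>S act (\<lambda>_. s' - s) (f t)) \<le> e / 2"
            using ss(2) by (simp add: divide_le_eq mult.commute)
          then show ?thesis
            by (subst dominated_act(2)[OF b dominated_minus(1)[OF b FD dominated_act(1)[OF b fD]]]) (use ss t in auto)
        qed
        have "eventually (\<lambda>s. s \<in> {0..} \<and> s \<noteq> t \<and> \<bar>s - t\<bar> < min \<delta> 1) (at t within {0..})"
          unfolding eventually_at using \<delta>(1) by (intro exI[of _ "min \<delta> 1"]) (auto simp: dist_real_def)
        then show "eventually (\<lambda>s. dist (wnrm b (diff_quot F t s -\<^sub>S f t)) 0 < e) (at t within {0..})"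
        proof eventually_elim
          case (elim s)
          then have s: "0 \<le> s" "s \<noteq> t" "\<bar>s - t\<bar> < \<delta>" "\<bar>s - t\<bar> < 1" by auto
          have "wnrm b (diff_quot F t s -\<^sub>S f t) \<le> e / 2"
          proof (cases "t < s")
            case True
            then show ?thesis unfolding dq[OF s(1) t s(2)] using s t by (intro main) auto
          next
            case False
            then have "s < t" using s by simp
            \<comment> \<open>To the left of \<open>t\<close> the interval is \<open>[s, t]\<close>;
              the quotient is symmetric in its end points, so \<open>main\<close> covers this case
              too.\<close>
            have "diff_quot F t s = diff_quot F s t"
              by (rule diff_quot_commute[of F, OF FS[OF s(1)] FS[OF t]])
            then show ?thesis
              using main[of s t] s t \<open>s < t\<close> dq[OF t s(1) s(2)[symmetric]] by auto
          qed
          moreover have "0 \<le> wnrm b (diff_quot F t s -\<^sub>S f t)"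
            using dqS[OF s(1)] ft by (intro wnrm_nonneg) simp
          ultimately show ?case using \<open>0 < e\<close> by simp
        qed
      qed
    qed
  qed
  have "J n 0 = 0\<^sub>S" for n by (simp add: J_def ix_def)
  then have F_0: "F 0 = 0\<^sub>S"
    using conv_unique[OF F[of 0], of "0\<^sub>S"] conv_const[OF M.zero_closed, of sequentially] by simp
  show ?thesis by (rule that[of F]) (fact FS F_0 F_deriv F_bound)+
qed

section \<open>Locally Lipschitz functions\<close>

text \<open>The Lipschitz condition of the problem on a single set, with a representative of the
  constant that is nonnegative everywhere and not just almost surely, so that products can be
  estimated at every sample point.\<close>

definition Lip :: "(real \<Rightarrow> 's) \<Rightarrow> real set \<Rightarrow> bool" where
  "Lip g I \<longleftrightarrow> (\<forall>s\<in>I. g s \<in> carrier S) \<and> (\<exists>\<zeta>\<in>borel_measurable P. (\<forall>w. 0 \<le> \<zeta> w) \<and>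
     (\<forall>s\<in>I. \<forall>r\<in>I. AE w in P. nrm (g s -\<^sub>S g r) w \<le> \<zeta> w * \<bar>s - r\<bar>))"

lemma LipI:
  assumes g: "\<And>s. s \<in> I \<Longrightarrow> g s \<in> carrier S" and \<zeta>: "\<zeta> \<in> borel_measurable P"
    and lip: "\<And>s r. s \<in> I \<Longrightarrow> r \<in> I \<Longrightarrow> AE w in P. nrm (g s -\<^sub>S g r) w \<le> \<zeta> w * \<bar>s - r\<bar>"
  shows "Lip g I"
  unfolding Lip_def
proof (intro conjI ballI bexI[of _ "\<lambda>w. \<bar>\<zeta> w\<bar>"] allI)
  fix s r assume "s \<in> I" "r \<in> I"
  from lip[OF this] show "AE w in P. nrm (g s -\<^sub>S g r) w \<le> \<bar>\<zeta> w\<bar> * \<bar>s - r\<bar>"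
  proof eventually_elim
    case (elim w)
    have "\<zeta> w * \<bar>s - r\<bar> \<le> \<bar>\<zeta> w\<bar> * \<bar>s - r\<bar>" by (intro mult_right_mono) auto
    with elim show ?case by linarith
  qed
qed (use g \<zeta> in auto)

lemma LipE:
  assumes "Lip g I"
  obtains \<zeta> where "\<zeta> \<in> borel_measurable P" "\<And>w. 0 \<le> \<zeta> w"
    "\<And>s r. s \<in> I \<Longrightarrow> r \<in> I \<Longrightarrow> AE w in P. nrm (g s -\<^sub>S g r) w \<le> \<zeta> w * \<bar>s - r\<bar>"
  using assms unfolding Lip_def by blast

lemma Lip_closed: "Lip g I \<Longrightarrow> s \<in> I \<Longrightarrow> g s \<in> carrier S"
  by (simp add: Lip_def)

lemma Lip_subset: "Lip g I \<Longrightarrow> J \<subseteq> I \<Longrightarrow> Lip g J"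
  unfolding Lip_def by blast

lemma Lip_const: "x \<in> carrier S \<Longrightarrow> Lip (\<lambda>_. x) I"
  using nrm_zero by (intro LipI[where \<zeta> = "\<lambda>_. 0"]) (auto simp: minus_self elim: AE_mp)

lemma Lip_minus:
  assumes "Lip g I" "Lip h I"
  shows "Lip (\<lambda>s. g s -\<^sub>S h s) I"
proof -
  obtain \<zeta> where \<zeta>: "\<zeta> \<in> borel_measurable P" "\<And>w. 0 \<le> \<zeta> w"
    "\<And>s r. s \<in> I \<Longrightarrow> r \<in> I \<Longrightarrow> AE w in P. nrm (g s -\<^sub>S g r) w \<le> \<zeta> w * \<bar>s - r\<bar>"
    by (rule LipE[OF assms(1)], rule that)
  obtain \<zeta>' where \<zeta>': "\<zeta>' \<in> borel_measurable P" "\<And>w. 0 \<le> \<zeta>' w"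
    "\<And>s r. s \<in> I \<Longrightarrow> r \<in> I \<Longrightarrow> AE w in P. nrm (h s -\<^sub>S h r) w \<le> \<zeta>' w * \<bar>s - r\<bar>"
    by (rule LipE[OF assms(2)], rule that)
  show ?thesis
  proof (rule LipI)
    show "(\<lambda>w. \<zeta> w + \<zeta>' w) \<in> borel_measurable P" using \<zeta> \<zeta>' by simp
    show "g s -\<^sub>S h s \<in> carrier S" if "s \<in> I" for s
      using Lip_closed[OF assms(1) that] Lip_closed[OF assms(2) that] by simp
    fix s r assume sr: "s \<in> I" "r \<in> I"
    note cl = Lip_closed[OF assms(1) sr(1)] Lip_closed[OF assms(2) sr(1)]
       Lip_closed[OF assms(1) sr(2)] Lip_closed[OF assms(2) sr(2)]
    show "AE w in P. nrm (g s -\<^sub>S h s -\<^sub>S (g r -\<^sub>S h r)) w \<le> (\<zeta> w + \<zeta>' w) * \<bar>s - r\<bar>"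
      using nrm_sub[OF M.minus_closed[OF cl(1,3)] M.minus_closed[OF cl(2,4)]] \<zeta>(3)[OF sr] \<zeta>'(3)[OF sr]
      unfolding minus_minus_minus[OF cl] by eventually_elim (simp add: distrib_right)
  qed
qed

lemma Lip_op:
  assumes "Lip g I" and T: "bdd_additive b T"
  shows "Lip (\<lambda>s. T (g s)) I"
proof -
  obtain \<zeta> where \<zeta>: "\<zeta> \<in> borel_measurable P" "\<And>w. 0 \<le> \<zeta> w"
    "\<And>s r. s \<in> I \<Longrightarrow> r \<in> I \<Longrightarrow> AE w in P. nrm (g s -\<^sub>S g r) w \<le> \<zeta> w * \<bar>s - r\<bar>"
    by (rule LipE[OF assms(1)], rule that)
  show ?thesis
  proof (rule LipI)
    show "(\<lambda>w. \<bar>b w\<bar> * \<zeta> w) \<in> borel_measurable P" using \<zeta> bdd_additiveD(1)[OF T] by simp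
    show "T (g s) \<in> carrier S" if "s \<in> I" for s
      using Lip_closed[OF assms(1) that] T by (rule bdd_additiveD(2)[rotated])
    fix s r assume sr: "s \<in> I" "r \<in> I"
    note cl = Lip_closed[OF assms(1) sr(1)] Lip_closed[OF assms(1) sr(2)]
    note d = M.minus_closed[OF cl]
    show "AE w in P. nrm (T (g s) -\<^sub>S T (g r)) w \<le> \<bar>b w\<bar> * \<zeta> w * \<bar>s - r\<bar>"
      using bdd_additiveD(4)[OF T d] \<zeta>(3)[OF sr] nrm_nonneg[OF d]
      unfolding bdd_additive_minus[OF T cl]
    proof eventually_elim
      case (elim w)
      have "b w * nrm (g s -\<^sub>S g r) w \<le> \<bar>b w\<bar> * nrm (g s -\<^sub>S g r) w"
        using elim by (intro mult_right_mono) auto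
      also have "\<dots> \<le> \<bar>b w\<bar> * (\<zeta> w * \<bar>s - r\<bar>)" using elim by (intro mult_left_mono) auto
      finally show ?case using elim by (simp add: mult.assoc)
    qed
  qed
qed

lemma bdd_additive_act_op:
  assumes h: "h \<in> borel_measurable P"
  shows "bdd_additive (\<lambda>w. \<bar>h w\<bar>) (act h)"
  unfolding bdd_additive_def
proof (intro conjI ballI)
  fix x assume "x \<in> carrier S"
  from nrm_act[OF h this] show "AE w in P. nrm (act h x) w \<le> \<bar>h w\<bar> * nrm x w"
    by eventually_elim simp
qed (use h in \<open>simp_all add: act_add_right\<close>)

lemma Lip_shift:
  assumes g: "Lip g J" and I: "\<And>s. s \<in> I \<Longrightarrow> s + h \<in> J"
  shows "Lip (\<lambda>s. g (s + h)) I"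
proof -
  obtain \<zeta> where \<zeta>: "\<zeta> \<in> borel_measurable P" "\<And>w. 0 \<le> \<zeta> w"
    "\<And>s r. s \<in> J \<Longrightarrow> r \<in> J \<Longrightarrow> AE w in P. nrm (g s -\<^sub>S g r) w \<le> \<zeta> w * \<bar>s - r\<bar>"
    by (rule LipE[OF g], rule that)
  show ?thesis
  proof (rule LipI[OF Lip_closed[OF g I] \<zeta>(1)])
    show "AE w in P. nrm (g (s + h) -\<^sub>S g (r + h)) w \<le> \<zeta> w * \<bar>s - r\<bar>" if "s \<in> I" "r \<in> I" for s r
      using \<zeta>(3)[OF I[OF that(1)] I[OF that(2)]] by simp
  qed
qed

lemma Lip_nrm_bound:
  assumes "Lip g {0..L}"
  obtains K where "K \<in> borel_measurable P" "\<And>s. s \<in> {0..L} \<Longrightarrow> AE w in P. nrm (g s) w \<le> K w"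
proof (cases "0 \<le> L")
  case True
  obtain \<zeta> where \<zeta>: "\<zeta> \<in> borel_measurable P" "\<And>w. 0 \<le> \<zeta> w"
    "\<And>s r. s \<in> {0..L} \<Longrightarrow> r \<in> {0..L} \<Longrightarrow> AE w in P. nrm (g s -\<^sub>S g r) w \<le> \<zeta> w * \<bar>s - r\<bar>"
    by (rule LipE[OF assms], rule that)
  have 0: "0 \<in> {0..L}" using True by simp
  note g0 = Lip_closed[OF assms 0]
  show ?thesis
  proof (rule that)
    show "(\<lambda>w. \<zeta> w * L + nrm (g 0) w) \<in> borel_measurable P" using \<zeta> g0 by simp
    fix s assume s: "s \<in> {0..L}"
    show "AE w in P. nrm (g s) w \<le> \<zeta> w * L + nrm (g 0) w"
      using nrm_le_minus[OF Lip_closed[OF assms s] g0] \<zeta>(3)[OF s 0]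
    proof eventually_elim
      case (elim w)
      have "\<zeta> w * \<bar>s - 0\<bar> \<le> \<zeta> w * L" using s \<zeta>(2) by (intro mult_left_mono) auto
      with elim show ?case by linarith
    qed
  qed
qed (use that[of "\<lambda>_. 0"] in auto)

text \<open>As for any product of Lipschitz functions: one summand uses that the exponential is
  bounded on \<open>[0, L]\<close>, the other its Lipschitz constant and a bound on
  \<open>g\<close>, which \<open>Lip_nrm_bound\<close> extracts from the Lipschitz property.\<close>

lemma Lip_act_exp:
  assumes g: "Lip g {0..L}" and c[measurable]: "c \<in> borel_measurable P"
  shows "Lip (\<lambda>s. act (\<lambda>w. exp (c w * s)) (g s)) {0..L}"
proof -
  obtain \<zeta> where \<zeta>: "\<zeta> \<in> borel_measurable P" "\<And>w. 0 \<le> \<zeta> w"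
    "\<And>s r. s \<in> {0..L} \<Longrightarrow> r \<in> {0..L} \<Longrightarrow> AE w in P. nrm (g s -\<^sub>S g r) w \<le> \<zeta> w * \<bar>s - r\<bar>"
    by (rule LipE[OF g], rule that)
  obtain K where K: "K \<in> borel_measurable P" "\<And>s. s \<in> {0..L} \<Longrightarrow> AE w in P. nrm (g s) w \<le> K w"
    by (rule Lip_nrm_bound[OF g], rule that)
  note [measurable] = \<zeta>(1) K(1)
  show ?thesis
  proof (rule LipI)
    show "(\<lambda>w. exp (\<bar>c w\<bar> * L) * \<zeta> w + \<bar>c w\<bar> * exp (\<bar>c w\<bar> * L) * K w) \<in> borel_measurable P" by simp
    show "act (\<lambda>w. exp (c w * s)) (g s) \<in> carrier S" if "s \<in> {0..L}" for s
      using Lip_closed[OF g that] by simp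
    fix s r assume sr: "s \<in> {0..L}" "r \<in> {0..L}"
    note cl = Lip_closed[OF g sr(1)] Lip_closed[OF g sr(2)]
    note d = M.minus_closed[OF cl]
    let ?e = "\<lambda>s w. exp (c w * s)"
    have eq: "act (?e s) (g s) -\<^sub>S act (?e r) (g r) = act (?e s) (g s -\<^sub>S g r) +\<^sub>S act (\<lambda>w. ?e s w - ?e r w) (g r)"
      using cl minus_trans[of "act (?e s) (g s)" "act (?e s) (g r)" "act (?e r) (g r)"]
      by (simp add: act_minus_left act_minus_right)
    have 1: "AE w in P. nrm (act (?e s) (g s -\<^sub>S g r)) w = \<bar>?e s w\<bar> * nrm (g s -\<^sub>S g r) w"
      by (rule nrm_act[OF _ d]) simp
    have 2: "AE w in P. nrm (act (\<lambda>w. ?e s w - ?e r w) (g r)) w = \<bar>?e s w - ?e r w\<bar> * nrm (g r) w"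
      by (rule nrm_act[OF _ cl(2)]) simp
    have 3: "AE w in P. nrm (act (?e s) (g s -\<^sub>S g r) +\<^sub>S act (\<lambda>w. ?e s w - ?e r w) (g r)) w
       \<le> nrm (act (?e s) (g s -\<^sub>S g r)) w + nrm (act (\<lambda>w. ?e s w - ?e r w) (g r)) w"
      by (intro nrm_add) (simp_all add: cl)
    show "AE w in P. nrm (act (?e s) (g s) -\<^sub>S act (?e r) (g r)) w
        \<le> (exp (\<bar>c w\<bar> * L) * \<zeta> w + \<bar>c w\<bar> * exp (\<bar>c w\<bar> * L) * K w) * \<bar>s - r\<bar>"
      unfolding eq using 1 2 3 \<zeta>(3)[OF sr] K(2)[OF sr(2)] nrm_nonneg[OF cl(2)] nrm_nonneg[OF d]
    proof eventually_elim
      case (elim w)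
      have "c w * s \<le> \<bar>c w\<bar> * L" using sr by (intro mult_mono) auto
      then have "\<bar>?e s w\<bar> * nrm (g s -\<^sub>S g r) w \<le> exp (\<bar>c w\<bar> * L) * (\<zeta> w * \<bar>s - r\<bar>)"
        using elim by (intro mult_mono) auto
      moreover have "\<bar>?e s w - ?e r w\<bar> * nrm (g r) w \<le> (\<bar>c w\<bar> * exp (\<bar>c w\<bar> * L) * \<bar>s - r\<bar>) * K w"
        using elim sr by (intro mult_mono exp_diff_le(1)) auto
      ultimately have "nrm (act (?e s) (g s -\<^sub>S g r) +\<^sub>S act (\<lambda>w. ?e s w - ?e r w) (g r)) w
          \<le> exp (\<bar>c w\<bar> * L) * (\<zeta> w * \<bar>s - r\<bar>) + (\<bar>c w\<bar> * exp (\<bar>c w\<bar> * L) * \<bar>s - r\<bar>) * K w"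
        using elim(1-3) by linarith
      then show ?case by (simp add: algebra_simps)
    qed
  qed
qed

lemma Lip_imp_conv:
  assumes g: "Lip g I" and t: "t \<in> I"
  shows "conv g (g t) (at t within I)"
proof -
  obtain \<zeta> where \<zeta>: "\<zeta> \<in> borel_measurable P" "\<And>w. 0 \<le> \<zeta> w"
    "\<And>s r. s \<in> I \<Longrightarrow> r \<in> I \<Longrightarrow> AE w in P. nrm (g s -\<^sub>S g r) w \<le> \<zeta> w * \<bar>s - r\<bar>"
    by (rule LipE[OF g], rule that)
  show ?thesis
  proof (rule convI_Lipschitz[OF Lip_closed[OF g t] _ \<zeta>(1)])
    show "eventually (\<lambda>s. g s \<in> carrier S) (at t within I)"
      by (rule eventually_within) (rule Lip_closed[OF g])
    show "eventually (\<lambda>s. AE w in P. nrm (g s -\<^sub>S g t) w \<le> \<zeta> w * \<bar>s - t\<bar>) (at t within I)"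
      by (rule eventually_within) (rule \<zeta>(3)[OF _ t])
    show "((\<lambda>s. s - t) \<longlongrightarrow> 0) (at t within I)"
      by (auto intro!: tendsto_eq_intros)
  qed
qed

text \<open>The difference of the two functions is Lipschitz with zero derivative. This takes the
  place of exchanging operators with integrals: antiderivatives are identified by their derivative
  and their initial value.\<close>

lemma eq_of_deriv_eq:
  assumes "a \<le> b" and g: "Lip g {a..b}" and h: "Lip h {a..b}"
    and der: "\<And>s. s \<in> {a<..<b} \<Longrightarrow> has_deriv g (d s) s UNIV" "\<And>s. s \<in> {a<..<b} \<Longrightarrow> has_deriv h (d s) s UNIV"
    and "g a = h a"
  shows "g b = h b"
proof -
  have ab: "a \<in> {a..b}" "b \<in> {a..b}" using \<open>a \<le> b\<close> by auto
  note cl = Lip_closed[OF g] Lip_closed[OF h]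
  note gh = Lip_minus[OF g h]
  obtain \<zeta> where \<zeta>: "\<zeta> \<in> borel_measurable P" "\<And>w. 0 \<le> \<zeta> w"
    "\<And>s r. s \<in> {a..b} \<Longrightarrow> r \<in> {a..b} \<Longrightarrow> AE w in P. nrm (g s -\<^sub>S h s -\<^sub>S (g r -\<^sub>S h r)) w \<le> \<zeta> w * \<bar>s - r\<bar>"
    by (rule LipE[OF gh], rule that)
  have "g b -\<^sub>S h b = g a -\<^sub>S h a"
  proof (rule const_of_zero_deriv[OF \<open>a \<le> b\<close> Lip_closed[OF gh] \<zeta>(1,3)])
    fix s assume s: "s \<in> {a<..<b}"
    have "has_deriv (\<lambda>s. g s -\<^sub>S h s) (d s -\<^sub>S d s) s {a..b}"
      by (rule has_deriv_minus[OF has_deriv_subset[OF der(1)] has_deriv_subset[OF der(2)]]) (use s cl in auto)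
    then show "has_deriv (\<lambda>s. g s -\<^sub>S h s) 0\<^sub>S s UNIV"
      using s has_deriv_closed[OF der(1)[OF s]]
      unfolding has_deriv_def by (subst (asm) at_within_interior) (auto simp: minus_self)
  qed
  then have "g b -\<^sub>S h b = 0\<^sub>S" using \<open>g a = h a\<close> minus_self[OF cl(2)[OF ab(1)]] by simp
  then show ?thesis by (rule minus_eq_zero[OF cl(1)[OF ab(2)] cl(2)[OF ab(2)]])
qed

text \<open>Difference quotients obey the bound almost surely, and \<open>conv_nrm_le\<close> passes
  it to the limit. It supplies one random bound for all derivatives of a Lipschitz solution.\<close>

lemma Lip_deriv_nrm_le:
  assumes s: "s \<in> {a<..<b}" and \<zeta>: "\<zeta> \<in> borel_measurable P"
    and g: "\<And>s. s \<in> {a..b} \<Longrightarrow> g s \<in> carrier S"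
    and lip: "\<And>s r. s \<in> {a..b} \<Longrightarrow> r \<in> {a..b} \<Longrightarrow> AE w in P. nrm (g s -\<^sub>S g r) w \<le> \<zeta> w * \<bar>s - r\<bar>"
    and der: "has_deriv g d s UNIV"
  shows "AE w in P. nrm d w \<le> \<zeta> w"
proof (rule conv_nrm_le[OF der[unfolded has_deriv_def] _ \<zeta>])
  have "eventually (\<lambda>r. r \<in> {a..b} \<and> r \<noteq> s) (at s)"
    using s by (intro eventually_at_Icc) auto
  then show "eventually (\<lambda>r. AE w in P. nrm (diff_quot g s r) w \<le> \<zeta> w) (at s)"
  proof eventually_elim
    case (elim r)
    have sI: "s \<in> {a..b}" and "r \<noteq> s" using s elim by simp_all
    have "AE w in P. nrm (diff_quot g s r) w = \<bar>1 / (r - s)\<bar> * nrm (g r -\<^sub>S g s) w"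
      unfolding diff_quot_def using elim g[OF sI] g[of r] by (intro nrm_act) auto
    moreover have "AE w in P. nrm (g r -\<^sub>S g s) w \<le> \<zeta> w * \<bar>r - s\<bar>"
      using elim sI by (intro lip) auto
    ultimately show ?case
    proof eventually_elim
      case (elim w)
      with \<open>r \<noteq> s\<close> show ?case by (simp add: divide_le_eq)
    qed
  qed
qed simp

end

section \<open>Dominated C-semigroups\<close>

text \<open>The bound \<open>m\<close> does not depend on time, so \<open>m * nrm z\<close>
  dominates the whole orbit of \<open>z\<close>, as the Riemann sums require. Decay in time is an
  additional hypothesis of \<open>laplace_limit\<close>.\<close>

locale dominated_semigroup = random_normed_module P S
  for P :: "'w measure"
    and S :: "('w, 'k::{real_normed_field, second_countable_topology}, 's) rn_module" +
  fixes C :: "'s \<Rightarrow> 's" and V :: "real \<Rightarrow> 's \<Rightarrow> 's" and c m :: "'w \<Rightarrow> real"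
  assumes complete: "el_complete P S"
    and C_bdd: "bdd_additive c C"
    and C_act: "h \<in> borel_measurable P \<Longrightarrow> x \<in> carrier S \<Longrightarrow> C (act h x) = act h (C x)"
    and C_inj: "inj_on C (carrier S)"
    and V_bdd: "0 \<le> t \<Longrightarrow> bdd_additive m (V t)"
    and V_act: "0 \<le> t \<Longrightarrow> h \<in> borel_measurable P \<Longrightarrow> x \<in> carrier S \<Longrightarrow> V t (act h x) = act h (V t x)"
    and V_0: "x \<in> carrier S \<Longrightarrow> V 0 x = C x"
    and V_add: "0 \<le> s \<Longrightarrow> 0 \<le> t \<Longrightarrow> x \<in> carrier S \<Longrightarrow> C (V (s + t) x) = V t (V s x)"
    and V_conv: "x \<in> carrier S \<Longrightarrow> 0 \<le> t \<Longrightarrow> conv (\<lambda>s. V s x) (V t x) (at t within {0..})"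
begin

lemma C_closed[simp]: "x \<in> carrier S \<Longrightarrow> C x \<in> carrier S"
  by (rule bdd_additiveD(2)[OF C_bdd])

lemma V_closed[simp]: "0 \<le> t \<Longrightarrow> x \<in> carrier S \<Longrightarrow> V t x \<in> carrier S"
  by (rule bdd_additiveD(2)[OF V_bdd])

lemma V_nrm: "0 \<le> t \<Longrightarrow> x \<in> carrier S \<Longrightarrow> AE w in P. nrm (V t x) w \<le> m w * nrm x w"
  by (rule bdd_additiveD(4)[OF V_bdd])

lemma m_measurable[measurable]: "m \<in> borel_measurable P"
  using bdd_additiveD(1)[OF V_bdd[of 0]] by simp

lemma V_C: "0 \<le> t \<Longrightarrow> x \<in> carrier S \<Longrightarrow> V t (C x) = C (V t x)"
  using V_add[of 0 t x] by (simp add: V_0)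

lemma C_eq_iff: "x \<in> carrier S \<Longrightarrow> y \<in> carrier S \<Longrightarrow> C x = C y \<longleftrightarrow> x = y"
  using C_inj by (simp add: inj_on_eq_iff)

text \<open>This bundles what is kept of the antiderivative, so that choice makes it a function of
  \<open>z\<close>. The last conjunct localizes bounds to \<open>[s, t]\<close>, as the tail
  estimates require.\<close>

definition is_primitive :: "'s \<Rightarrow> (real \<Rightarrow> 's) \<Rightarrow> bool" where
  "is_primitive z F \<longleftrightarrow> (\<forall>t\<ge>0. F t \<in> carrier S) \<and> F 0 = 0\<^sub>S \<and> (\<forall>t\<ge>0. has_deriv F (V t z) t {0..})
    \<and> (\<forall>s t k. 0 \<le> s \<longrightarrow> s \<le> t \<longrightarrow> k \<in> borel_measurable P \<longrightarrow> (\<forall>r\<in>{s..t}. AE w in P. nrm (V r z) w \<le> k w)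
         \<longrightarrow> (AE w in P. nrm (F t -\<^sub>S F s) w \<le> k w * (t - s)))"

definition prim :: "'s \<Rightarrow> real \<Rightarrow> 's" where
  "prim z = (SOME F. is_primitive z F)"

lemma is_primitive_prim:
  assumes z: "z \<in> carrier S"
  shows "is_primitive z (prim z)"
proof -
  have mz: "(\<lambda>w. m w * nrm z w) \<in> borel_measurable P" using z by simp
  show ?thesis
  proof (rule antiderivative_exists[OF complete V_closed[OF _ z] V_conv[OF z] mz V_nrm[OF _ z]])
    fix F assume F: "\<And>t. 0 \<le> t \<Longrightarrow> F t \<in> carrier S" "F 0 = 0\<^sub>S"
      "\<And>t. 0 \<le> t \<Longrightarrow> has_deriv F (V t z) t {0..}"
      "\<And>s t k. 0 \<le> s \<Longrightarrow> s \<le> t \<Longrightarrow> k \<in> borel_measurable P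
        \<Longrightarrow> (\<And>r. r \<in> {s..t} \<Longrightarrow> AE w in P. nrm (V r z) w \<le> k w)
        \<Longrightarrow> AE w in P. nrm (F t -\<^sub>S F s) w \<le> k w * (t - s)"
    have "is_primitive z F"
      unfolding is_primitive_def using F by (intro conjI allI impI) simp_all
    then show "is_primitive z (prim z)"
      unfolding prim_def by (rule someI[of "is_primitive z"])
  qed
qed

context
  fixes z assumes z: "z \<in> carrier S"
begin

lemma prim_closed: "0 \<le> t \<Longrightarrow> prim z t \<in> carrier S"
  and prim_0: "prim z 0 = 0\<^sub>S"
  and prim_deriv: "0 \<le> t \<Longrightarrow> has_deriv (prim z) (V t z) t {0..}"
  using is_primitive_prim[OF z] by (simp_all add: is_primitive_def)

lemma prim_bound:
  assumes "0 \<le> s" "s \<le> t" "k \<in> borel_measurable P"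
    and "\<And>r. r \<in> {s..t} \<Longrightarrow> AE w in P. nrm (V r z) w \<le> k w"
  shows "AE w in P. nrm (prim z t -\<^sub>S prim z s) w \<le> k w * (t - s)"
  using is_primitive_prim[OF z] assms unfolding is_primitive_def by blast

lemma prim_nrm:
  assumes "0 \<le> s" "0 \<le> t"
  shows "AE w in P. nrm (prim z t -\<^sub>S prim z s) w \<le> m w * nrm z w * \<bar>t - s\<bar>"
proof -
  have *: "AE w in P. nrm (prim z t -\<^sub>S prim z s) w \<le> m w * nrm z w * (t - s)" if "0 \<le> s" "s \<le> t" for s t
  proof (rule prim_bound[OF that])
    show "AE w in P. nrm (V r z) w \<le> m w * nrm z w" if "r \<in> {s..t}" for r
      using that \<open>0 \<le> s\<close> z by (intro V_nrm) auto
  qed (simp add: z)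
  show ?thesis
  proof (cases "s \<le> t")
    case True
    then show ?thesis using *[of s t] assms by simp
  next
    case False
    have "AE w in P. nrm (prim z t -\<^sub>S prim z s) w = nrm (prim z s -\<^sub>S prim z t) w"
      by (intro nrm_minus_commute prim_closed assms)
    with *[of t s] False assms show ?thesis by (auto elim: AE_mp)
  qed
qed

lemma prim_Lip: "Lip (prim z) {0..}"
  by (rule LipI[where \<zeta> = "\<lambda>w. m w * nrm z w"]) (use z prim_closed prim_nrm in auto)

lemma prim_unique:
  assumes "0 \<le> t" "Lip g {0..t}" "g 0 = 0\<^sub>S"
    and "\<And>s. s \<in> {0<..<t} \<Longrightarrow> has_deriv g (V s z) s {0..}"
  shows "g t = prim z t"
proof (rule eq_of_deriv_eq[OF assms(1,2)])
  show "Lip (prim z) {0..t}" by (rule Lip_subset[OF prim_Lip]) auto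
  show "has_deriv g (V s z) s UNIV" if "s \<in> {0<..<t}" for s
    using assms(4)[OF that] that by (simp add: has_deriv_at)
  show "has_deriv (prim z) (V s z) s UNIV" if "s \<in> {0<..<t}" for s
    using prim_deriv[of s] that by (simp add: has_deriv_at)
  show "g 0 = prim z 0" using assms(3) by (simp add: prim_0)
qed

end

lemma prim_minus:
  assumes "x \<in> carrier S" "y \<in> carrier S" "0 \<le> t"
  shows "prim x t -\<^sub>S prim y t = prim (x -\<^sub>S y) t"
proof (rule prim_unique[OF _ assms(3)])
  show "Lip (\<lambda>t. prim x t -\<^sub>S prim y t) {0..t}"
    by (rule Lip_subset[OF Lip_minus[OF prim_Lip prim_Lip]]) (use assms in auto)
  fix s assume s: "s \<in> {0<..<t}"
  have "V s (x -\<^sub>S y) = V s x -\<^sub>S V s y"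
    by (rule bdd_additive_minus[OF V_bdd]) (use s assms in auto)
  moreover have "has_deriv (\<lambda>t. prim x t -\<^sub>S prim y t) (V s x -\<^sub>S V s y) s {0..}"
    by (rule has_deriv_minus[OF prim_deriv prim_deriv]) (use s assms prim_closed in auto)
  ultimately show "has_deriv (\<lambda>t. prim x t -\<^sub>S prim y t) (V s (x -\<^sub>S y)) s {0..}" by simp
qed (use assms in \<open>simp_all add: prim_0 minus_self\<close>)

lemma prim_C:
  assumes z: "z \<in> carrier S" and t: "0 \<le> t"
  shows "C (prim z t) = prim (C z) t"
proof (rule prim_unique[OF _ t])
  show "Lip (\<lambda>t. C (prim z t)) {0..t}"
    by (rule Lip_subset[OF Lip_op[OF prim_Lip[OF z] C_bdd]]) auto
  show "has_deriv (\<lambda>t. C (prim z t)) (V s (C z)) s {0..}" if "s \<in> {0<..<t}" for s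
    using that z has_deriv_op[OF prim_deriv[OF z] _ _ C_bdd, of s] by (simp add: V_C prim_closed C_act)
qed (use z in \<open>simp_all add: prim_0 bdd_additive_zero[OF C_bdd]\<close>)

text \<open>In \<open>t\<close> both sides are Lipschitz and vanish at 0, and at \<open>s\<close>
  their derivatives are \<open>V h (V s z)\<close> and \<open>C (V (s + h) z)\<close>, which agree
  by the semigroup law.\<close>

lemma V_prim:
  assumes z: "z \<in> carrier S" and t: "0 \<le> t" and h: "0 \<le> h"
  shows "V h (prim z t) = C (prim z (t + h) -\<^sub>S prim z h)"
proof (rule eq_of_deriv_eq[OF t])
  show "Lip (\<lambda>t. V h (prim z t)) {0..t}"
    by (rule Lip_subset[OF Lip_op[OF prim_Lip[OF z] V_bdd[OF h]]]) auto
  show "Lip (\<lambda>t. C (prim z (t + h) -\<^sub>S prim z h)) {0..t}"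
    by (rule Lip_op[OF Lip_minus[OF Lip_shift[OF prim_Lip[OF z]] Lip_const] C_bdd]) (use h z in \<open>auto simp: prim_closed\<close>)
  show "V h (prim z 0) = C (prim z (0 + h) -\<^sub>S prim z h)"
    using z h by (simp add: prim_0 prim_closed minus_self bdd_additive_zero[OF C_bdd] bdd_additive_zero[OF V_bdd[OF h]])
  fix s assume s: "s \<in> {0<..<t}"
  then have s0: "0 \<le> s" "0 < s" by auto
  have "has_deriv (\<lambda>t. V h (prim z t)) (V h (V s z)) s {0..}"
    by (rule has_deriv_op[OF prim_deriv[OF z s0(1)] _ _ V_bdd[OF h]]) (use z s0 h in \<open>auto simp: prim_closed V_act\<close>)
  then show "has_deriv (\<lambda>t. V h (prim z t)) (V h (V s z)) s UNIV" using has_deriv_at[OF s0(2)] by blast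
  have "has_deriv (\<lambda>t. prim z (t + h) -\<^sub>S prim z h) (V (s + h) z -\<^sub>S 0\<^sub>S) s {0..}"
    by (rule has_deriv_minus[OF has_deriv_shift[OF prim_deriv[OF z]] has_deriv_const]) (use z s0 h in \<open>auto simp: prim_closed\<close>)
  then have "has_deriv (\<lambda>t. C (prim z (t + h) -\<^sub>S prim z h)) (C (V (s + h) z -\<^sub>S 0\<^sub>S)) s {0..}"
    by (rule has_deriv_op[OF _ _ _ C_bdd]) (use z s0 h in \<open>auto simp: prim_closed C_act\<close>)
  then have "has_deriv (\<lambda>t. C (prim z (t + h) -\<^sub>S prim z h)) (V h (V s z)) s {0..}"
    using z s0 h by (simp add: minus_zero_right V_add)
  then show "has_deriv (\<lambda>t. C (prim z (t + h) -\<^sub>S prim z h)) (V h (V s z)) s UNIV"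
    using has_deriv_at[OF s0(2)] by blast
qed

text \<open>At a fixed time \<open>prim\<close> respects differences of its first argument and has
  the random bound \<open>m * t\<close>, so it is continuous in that argument.\<close>

lemma prim_conv:
  assumes f: "conv f l F" and t: "0 \<le> t"
  shows "conv (\<lambda>s. prim (f s) t) (prim l t) F"
proof -
  have l: "l \<in> carrier S" and ev: "eventually (\<lambda>s. f s \<in> carrier S) F"
    and lim: "((\<lambda>s. mag (nrm (f s -\<^sub>S l))) \<longlongrightarrow> 0) F"
    using f by (simp_all add: conv_def)
  show ?thesis
  proof (rule convI_nrm_le[OF prim_closed[OF l t] _ _ _ mag_mult_tendsto[of "\<lambda>w. m w * t", OF _ _ lim]])
    show "eventually (\<lambda>s. prim (f s) t \<in> carrier S) F"
      using ev by eventually_elim (simp add: prim_closed t)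
    show "eventually (\<lambda>s. (\<lambda>w. m w * t * nrm (f s -\<^sub>S l) w) \<in> borel_measurable P) F"
      "eventually (\<lambda>s. nrm (f s -\<^sub>S l) \<in> borel_measurable P) F"
      using ev by (eventually_elim, simp add: l)+
    show "eventually (\<lambda>s. AE w in P. nrm (prim (f s) t -\<^sub>S prim l t) w \<le> \<bar>m w * t * nrm (f s -\<^sub>S l) w\<bar>) F"
      using ev
    proof eventually_elim
      case (elim s)
      have d: "f s -\<^sub>S l \<in> carrier S" using elim l by simp
      have "AE w in P. nrm (prim (f s -\<^sub>S l) t) w \<le> m w * nrm (f s -\<^sub>S l) w * t"
        using prim_nrm[OF d, of 0 t] t d by (simp add: prim_0 minus_zero_right prim_closed)
      then show ?case
        unfolding prim_minus[OF elim l t]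
      proof eventually_elim
        case (elim w)
        also have "m w * nrm (f s -\<^sub>S l) w * t = m w * t * nrm (f s -\<^sub>S l) w" by simp
        also have "\<dots> \<le> \<bar>m w * t * nrm (f s -\<^sub>S l) w\<bar>" by simp
        finally show ?case .
      qed
    qed
  qed simp
qed

text \<open>Both sides are computed as the limit, for \<open>h\<close> tending to 0, of the primitive of
  \<open>V (\<cdot>) z\<^sub>h\<close> with \<open>z\<^sub>h = (V h x - C x) / h\<close>; no bound on the difference quotients of
  \<open>V (\<cdot>) x\<close> is available a priori.\<close>

lemma V_eq_prim:
  assumes x: "x \<in> carrier S" and z: "z \<in> carrier S" and t: "0 \<le> t"
    and gen: "has_deriv (\<lambda>s. V s x) (C z) 0 {0..}"
  shows "V t x -\<^sub>S C x = prim z t"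
proof -
  define zh where "zh h = act (\<lambda>_. 1 / h) (V h x -\<^sub>S C x)" for h
  have right: "at 0 within {0..} = at_right (0::real)"
    by (rule at_within_Ici_at_right)
  have pos: "eventually (\<lambda>h::real. 0 < h) (at_right 0)"
    by (simp add: eventually_at_right_less)
  have 1: "conv (\<lambda>h. prim (zh h) t) (prim (C z) t) (at_right 0)"
  proof (rule prim_conv[OF _ t])
    show "conv zh (C z) (at_right 0)"
      using gen x unfolding has_deriv_def right by (simp add: diff_quot_def[abs_def] zh_def[abs_def] V_0)
  qed
  let ?r = "\<lambda>h. act (\<lambda>_. 1 / h) (prim x (t + h) -\<^sub>S prim x t)"
  have lim: "conv (\<lambda>h. act (\<lambda>_. 1 / h) (prim x (t + h) -\<^sub>S prim x t)) (V t x) (at_right 0)" if "0 \<le> t" for t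
  proof -
    have "filterlim (\<lambda>h. t + h) (at t within {0..}) (at_right 0)"
      unfolding filterlim_at using \<open>0 \<le> t\<close>
    proof (intro conjI)
      show "((\<lambda>h. t + h) \<longlongrightarrow> t) (at_right 0)" by (auto intro!: tendsto_eq_intros)
      show "eventually (\<lambda>h. t + h \<in> {0..} \<and> t + h \<noteq> t) (at_right 0)"
        using pos by eventually_elim (use \<open>0 \<le> t\<close> in auto)
    qed
    from conv_filterlim[OF prim_deriv[OF x that, unfolded has_deriv_def] this]
    show ?thesis by (simp add: diff_quot_def)
  qed
  have lim0: "conv (\<lambda>h. act (\<lambda>_. 1 / h) (prim x h)) (C x) (at_right 0)"
  proof (rule conv_cong)
    show "conv (\<lambda>h. act (\<lambda>_. 1 / h) (prim x (0 + h) -\<^sub>S prim x 0)) (C x) (at_right 0)"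
      using lim[of 0] x by (simp add: V_0)
    show "eventually (\<lambda>h. act (\<lambda>_. 1 / h) (prim x h) = act (\<lambda>_. 1 / h) (prim x (0 + h) -\<^sub>S prim x 0)) (at_right 0)"
      using pos by eventually_elim (simp add: prim_0 prim_closed x minus_zero_right)
  qed
  have 2: "conv (\<lambda>h. C (?r h -\<^sub>S act (\<lambda>_. 1 / h) (prim x h))) (C (V t x -\<^sub>S C x)) (at_right 0)"
    by (rule conv_op[OF conv_minus[OF lim[OF t] lim0] C_bdd])
  have eq: "prim (zh h) t = C (?r h -\<^sub>S act (\<lambda>_. 1 / h) (prim x h))" if h: "0 < h" for h
  proof -
    have zhS: "zh h \<in> carrier S" using x h by (simp add: zh_def)
    note cl = prim_closed[OF x]
    have act_bdd: "bdd_additive (\<lambda>_. \<bar>1 / h\<bar>) (act (\<lambda>_. 1 / h))"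
      by (rule bdd_additive_act_op) simp
    \<comment> \<open>Formally, integrating \<open>V r (V h x - C x)\<close> over
      \<open>[0, s]\<close> gives \<open>C\<close> applied to the integral of the orbit over
      \<open>[h, s + h]\<close> minus that over \<open>[0, s]\<close>. In terms of
      \<open>prim x\<close> this is the expression below, before division by
      \<open>h\<close>.\<close>
    define g where "g s = act (\<lambda>_. 1 / h) (C (prim x (s + h) -\<^sub>S prim x s -\<^sub>S prim x h))" for s
    have "g t = prim (zh h) t"
    proof (rule prim_unique[OF zhS t])
      have L1: "Lip (\<lambda>s. prim x (s + h)) {0..t}"
        by (rule Lip_shift[OF prim_Lip[OF x]]) (use h in simp)
      have L2: "Lip (prim x) {0..t}"
        by (rule Lip_subset[OF prim_Lip[OF x]]) auto
      have L3: "Lip (\<lambda>s. C (prim x (s + h) -\<^sub>S prim x s -\<^sub>S prim x h)) {0..t}"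
        by (rule Lip_op[OF Lip_minus[OF Lip_minus[OF L1 L2] Lip_const] C_bdd]) (use h cl in simp)
      show "Lip g {0..t}"
        unfolding g_def by (rule Lip_op[OF L3 act_bdd])
      show "g 0 = 0\<^sub>S"
        using h x cl by (simp add: g_def prim_0 minus_zero_right minus_self bdd_additive_zero[OF C_bdd])
      fix s assume "s \<in> {0<..<t}"
      then have s: "0 \<le> s" by simp
      have D1: "has_deriv (\<lambda>s. prim x (s + h)) (V (s + h) x) s {0..}"
        by (rule has_deriv_shift[OF prim_deriv[OF x]]) (use s h in auto)
      have D2: "has_deriv (\<lambda>s. prim x (s + h) -\<^sub>S prim x s) (V (s + h) x -\<^sub>S V s x) s {0..}"
        by (rule has_deriv_minus[OF D1 prim_deriv[OF x s]]) (use s h cl in auto)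
      have D3: "has_deriv (\<lambda>s. prim x (s + h) -\<^sub>S prim x s -\<^sub>S prim x h) (V (s + h) x -\<^sub>S V s x -\<^sub>S 0\<^sub>S) s {0..}"
        by (rule has_deriv_minus[OF D2 has_deriv_const]) (use s h cl in auto)
      have D4: "has_deriv (\<lambda>s. C (prim x (s + h) -\<^sub>S prim x s -\<^sub>S prim x h))
          (C (V (s + h) x -\<^sub>S V s x -\<^sub>S 0\<^sub>S)) s {0..}"
        by (rule has_deriv_op[OF D3 _ _ C_bdd]) (use s h cl C_act in auto)
      have "has_deriv g (act (\<lambda>_. 1 / h) (C (V (s + h) x -\<^sub>S V s x -\<^sub>S 0\<^sub>S))) s {0..}"
        unfolding g_def
        by (rule has_deriv_op[OF D4 _ _ act_bdd]) (use s h cl in \<open>auto simp: act_act mult.commute\<close>)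
      moreover have "act (\<lambda>_. 1 / h) (C (V (s + h) x -\<^sub>S V s x -\<^sub>S 0\<^sub>S)) = V s (zh h)"
      proof -
        have "C (V (s + h) x -\<^sub>S V s x -\<^sub>S 0\<^sub>S) = V s (V h x) -\<^sub>S V s (C x)"
          using s h x V_add[of h s x] by (simp add: minus_zero_right bdd_additive_minus[OF C_bdd] V_C add.commute)
        also have "\<dots> = V s (V h x -\<^sub>S C x)"
          using s h x by (simp add: bdd_additive_minus[OF V_bdd])
        finally show ?thesis using s h x by (simp add: zh_def V_act)
      qed
      ultimately show "has_deriv g (V s (zh h)) s {0..}" by simp
    qed
    moreover have "g t = C (?r h -\<^sub>S act (\<lambda>_. 1 / h) (prim x h))"
      using t h cl by (simp add: g_def act_minus_right flip: C_act)
    ultimately show ?thesis by simp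
  qed
  have "conv (\<lambda>h. prim (zh h) t) (C (V t x -\<^sub>S C x)) (at_right 0)"
    by (rule conv_cong[OF _ 2]) (use pos in eventually_elim, rule eq)
  then have "prim (C z) t = C (V t x -\<^sub>S C x)"
    using conv_unique[OF 1] by simp
  \<comment> \<open>The limit is computed under an application of \<open>C\<close>, because the
    semigroup law contributes that factor; \<open>prim_C\<close> and injectivity remove it.\<close>
  then have "C (prim z t) = C (V t x -\<^sub>S C x)" using prim_C[OF z t] by simp
  then show ?thesis using C_eq_iff[of "prim z t" "V t x -\<^sub>S C x"] x z t prim_closed by simp
qed

text \<open>General orbits are merely continuous; by \<open>V_eq_prim\<close> an orbit that is
  differentiable at 0 with a derivative in the range of \<open>C\<close> inherits the Lipschitz
  bound of \<open>prim z\<close>.\<close>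

lemma V_increment_nrm_le:
  assumes x: "x \<in> carrier S" and z: "z \<in> carrier S" and gen: "has_deriv (\<lambda>s. V s x) (C z) 0 {0..}"
    and "0 \<le> s" "0 \<le> t"
  shows "AE w in P. nrm (V t x -\<^sub>S V s x) w \<le> m w * nrm z w * \<bar>t - s\<bar>"
proof -
  have "prim z t -\<^sub>S prim z s = (V t x -\<^sub>S C x) -\<^sub>S (V s x -\<^sub>S C x)"
    using V_eq_prim[OF x z _ gen] assms by simp
  also have "\<dots> = V t x -\<^sub>S V s x"
    using x assms by (subst minus_minus_minus) (simp_all add: minus_self minus_zero_right)
  finally show ?thesis using prim_nrm[OF z assms(4,5)] by simp
qed

lemma V_has_deriv:
  assumes x: "x \<in> carrier S" and z: "z \<in> carrier S" and gen: "has_deriv (\<lambda>s. V s x) (C z) 0 {0..}"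
    and t: "0 \<le> t"
  shows "has_deriv (\<lambda>s. V s x) (V t z) t {0..}"
proof (rule has_deriv_cong)
  show "has_deriv (\<lambda>s. prim z s +\<^sub>S C x) (V t z) t {0..}"
    using has_deriv_add[OF prim_deriv[OF z t] has_deriv_const[of "C x"]] x z t prim_closed by simp
  show "V s x = prim z s +\<^sub>S C x" if "s \<in> {0..}" for s
    using V_eq_prim[OF x z _ gen, of s, symmetric] that x by (simp add: M.a_comm[of _ "C x"] add_minus_cancel)
qed (use t in simp)

text \<open>\<open>V (t - s) (v s)\<close> has zero derivative in \<open>s\<close>, so its values at
  \<open>t\<close> and at 0 agree. Its Lipschitz bound has two sources: increments of
  \<open>v\<close>, multiplied by \<open>m\<close>, and increments of orbits, which are controlled
  because \<open>z s\<close> is bounded by the Lipschitz constant of \<open>v\<close>.\<close>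

lemma V_solution_unique:
  assumes t: "0 < t" and v: "Lip v {0..t}"
    and z: "\<And>s. s \<in> {0<..<t} \<Longrightarrow> z s \<in> carrier S"
    and der: "\<And>s. s \<in> {0<..<t} \<Longrightarrow> has_deriv v (z s) s {0..}"
    and gen: "\<And>s. s \<in> {0<..<t} \<Longrightarrow> has_deriv (\<lambda>h. V h (v s)) (C (z s)) 0 {0..}"
  shows "C (v t) = V t (v 0)"
proof -
  obtain \<zeta> where \<zeta>: "\<zeta> \<in> borel_measurable P" "\<And>w. 0 \<le> \<zeta> w"
    "\<And>s r. s \<in> {0..t} \<Longrightarrow> r \<in> {0..t} \<Longrightarrow> AE w in P. nrm (v s -\<^sub>S v r) w \<le> \<zeta> w * \<bar>s - r\<bar>"
    by (rule LipE[OF v], rule that)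
  note [measurable] = \<zeta>(1)
  note vS = Lip_closed[OF v]
  have der': "has_deriv v (z s) s UNIV" if "s \<in> {0<..<t}" for s
    using der[OF that] that by (simp add: has_deriv_at)
  have z_nrm: "AE w in P. nrm (z s) w \<le> \<zeta> w" if "s \<in> {0<..<t}" for s
    by (rule Lip_deriv_nrm_le[OF that \<zeta>(1) vS \<zeta>(3) der'[OF that]])
  \<comment> \<open>The generator values \<open>z r\<close> exist only for \<open>r\<close> in the
    open interval; the bound reaches the end points by continuity of \<open>v\<close>.\<close>
  have incr: "AE w in P. nrm (V a (v r) -\<^sub>S V b (v r)) w \<le> \<bar>m w\<bar> * \<zeta> w * \<bar>a - b\<bar>"
    if ab: "0 \<le> a" "0 \<le> b" and r: "r \<in> {0..t}" for a b r
  proof (rule conv_nrm_le)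
    have "conv v (v r) (at r within {0..t})" by (rule Lip_imp_conv[OF v r])
    then have "conv v (v r) (at r within {0<..<t})" by (rule conv_mono_filter) (auto intro: at_le)
    then show "conv (\<lambda>r. V a (v r) -\<^sub>S V b (v r)) (V a (v r) -\<^sub>S V b (v r)) (at r within {0<..<t})"
      using conv_minus[OF conv_op[OF _ V_bdd[OF ab(1)]] conv_op[OF _ V_bdd[OF ab(2)]]] by blast
    show "at r within {0<..<t} \<noteq> bot"
    proof -
      consider "r = 0" | "r = t" | "r \<in> {0<..<t}" using r by force
      then have "r islimpt {0<..<t}"
        by cases (simp_all add: t islimpt_greaterThanLessThan1 islimpt_greaterThanLessThan2
            interior_limit_point interior_open)
      then show ?thesis by (simp add: trivial_limit_within)
    qed
    show "eventually (\<lambda>r. AE w in P. nrm (V a (v r) -\<^sub>S V b (v r)) w \<le> \<bar>m w\<bar> * \<zeta> w * \<bar>a - b\<bar>) (at r within {0<..<t})"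
    proof (rule eventually_within)
      fix r assume r: "r \<in> {0<..<t}"
      then have "v r \<in> carrier S" by (intro vS) auto
      from V_increment_nrm_le[OF this z[OF r] gen[OF r] ab(2,1)] z_nrm[OF r] nrm_nonneg[OF z[OF r]]
      show "AE w in P. nrm (V a (v r) -\<^sub>S V b (v r)) w \<le> \<bar>m w\<bar> * \<zeta> w * \<bar>a - b\<bar>"
      proof eventually_elim
        case (elim w)
        have "m w * nrm (z r) w \<le> \<bar>m w\<bar> * \<zeta> w" using elim by (intro mult_mono) auto
        then have "m w * nrm (z r) w * \<bar>a - b\<bar> \<le> \<bar>m w\<bar> * \<zeta> w * \<bar>a - b\<bar>" by (intro mult_right_mono) auto
        with elim show ?case by linarith
      qed
    qed
  qed simp
  define g where "g s = V (t - s) (v s)" for s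
  have "g t = g 0"
  proof (rule const_of_zero_deriv)
    show "g s \<in> carrier S" if "s \<in> {0..t}" for s
      using that vS by (simp add: g_def)
    show "(\<lambda>w. 2 * (\<bar>m w\<bar> * \<zeta> w)) \<in> borel_measurable P" by simp
    fix s r assume sr: "s \<in> {0..t}" "r \<in> {0..t}"
    note cl = vS[OF sr(1)] vS[OF sr(2)]
    have ts: "0 \<le> t - s" "0 \<le> t - r" using sr by auto
    have d: "v s -\<^sub>S v r \<in> carrier S" using cl by simp
    have eq: "g s -\<^sub>S g r = V (t - s) (v s -\<^sub>S v r) +\<^sub>S (V (t - s) (v r) -\<^sub>S V (t - r) (v r))"
      using cl ts by (simp add: g_def bdd_additive_minus[OF V_bdd] minus_trans)
    have "V (t - s) (v s -\<^sub>S v r) \<in> carrier S" "V (t - s) (v r) -\<^sub>S V (t - r) (v r) \<in> carrier S"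
      using cl ts by auto
    from nrm_add[OF this] V_nrm[OF ts(1) d] \<zeta>(3)[OF sr] incr[OF ts sr(2)] nrm_nonneg[OF d]
    show "AE w in P. nrm (g s -\<^sub>S g r) w \<le> 2 * (\<bar>m w\<bar> * \<zeta> w) * \<bar>s - r\<bar>"
      unfolding eq
    proof eventually_elim
      case (elim w)
      have "m w * nrm (v s -\<^sub>S v r) w \<le> \<bar>m w\<bar> * (\<zeta> w * \<bar>s - r\<bar>)" using elim by (intro mult_mono) auto
      moreover have "\<bar>t - s - (t - r)\<bar> = \<bar>s - r\<bar>" by linarith
      ultimately show ?case using elim by (simp add: mult.assoc)
    qed
  next
    fix s assume s: "s \<in> {0<..<t}"
    have sS: "v s \<in> carrier S" using s by (intro vS) auto
    have ts: "0 < t - s" using s by simp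
    have near: "eventually (\<lambda>r. r \<in> {0..t} \<and> r \<noteq> s) (at s)"
      using s by (intro eventually_at_Icc) auto
    have fl: "filterlim (\<lambda>r. t - r) (at (t - s)) (at s)"
      unfolding filterlim_at by (auto intro!: tendsto_intros simp: eventually_at_filter)
    have cont: "conv (\<lambda>r. V (t - r) (z s)) (V (t - s) (z s)) (at s)"
    proof (rule conv_filterlim[OF _ fl, of "\<lambda>r. V r (z s)"])
      have "at (t - s) within {0..} = at (t - s)"
        by (rule at_within_open_subset[of _ "{0<..}"]) (use ts in auto)
      then show "conv (\<lambda>r. V r (z s)) (V (t - s) (z s)) (at (t - s))"
        using V_conv[OF z[OF s], of "t - s"] ts by simp
    qed
    have 1: "conv (\<lambda>r. V (t - r) (diff_quot v s r)) (V (t - s) (z s)) (at s)"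
    proof (rule conv_op_family[where T = "\<lambda>r. V (t - r)", OF _ _ cont])
      show "conv (diff_quot v s) (z s) (at s)" using der'[OF s] by (simp add: has_deriv_def)
      show "eventually (\<lambda>r. bdd_additive m (V (t - r))) (at s)"
        using near by eventually_elim (simp add: V_bdd)
    qed
    have "has_deriv (\<lambda>r. V r (v s)) (V (t - s) (z s)) (t - s) UNIV"
      using V_has_deriv[OF sS z[OF s] gen[OF s], of "t - s"] ts by (simp add: has_deriv_at)
    from conv_filterlim[OF this[unfolded has_deriv_def] fl]
    have 2: "conv (\<lambda>r. diff_quot (\<lambda>r. V r (v s)) (t - s) (t - r)) (V (t - s) (z s)) (at s)" .
    \<comment> \<open>The first term differentiates \<open>v\<close> under the moving operator, the
      second the orbit through \<open>v s\<close>, with a minus sign because time runs backwards in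
      \<open>t - s\<close>. Both limits are \<open>V (t - s) (z s)\<close>.\<close>
    have "conv (\<lambda>r. V (t - r) (diff_quot v s r) -\<^sub>S diff_quot (\<lambda>r. V r (v s)) (t - s) (t - r))
        (V (t - s) (z s) -\<^sub>S V (t - s) (z s)) (at s)"
      by (rule conv_minus[OF 1 2])
    moreover have "eventually (\<lambda>r. diff_quot g s r
        = V (t - r) (diff_quot v s r) -\<^sub>S diff_quot (\<lambda>r. V r (v s)) (t - s) (t - r)) (at s)"
      using near
    proof eventually_elim
      case (elim r)
      then have r: "0 \<le> t - r" "v r \<in> carrier S" "r \<noteq> s" using vS by auto
      have "diff_quot (\<lambda>r. V r (v s)) (t - s) (t - r)
          = act (\<lambda>_. 1 / (s - r)) (V (t - r) (v s) -\<^sub>S V (t - s) (v s))"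
        by (simp add: diff_quot_def)
      also have "\<dots> = act (\<lambda>_. 1 / (r - s)) (V (t - s) (v s) -\<^sub>S V (t - r) (v s))"
        using r sS ts minus_swap_act[of "V (t - s) (v s)" "V (t - r) (v s)"]
        by (simp add: act_act minus_divide_right)
      finally have e2: "diff_quot (\<lambda>r. V r (v s)) (t - s) (t - r)
          = act (\<lambda>_. 1 / (r - s)) (V (t - s) (v s) -\<^sub>S V (t - r) (v s))" .
      have e1: "V (t - r) (diff_quot v s r) = act (\<lambda>_. 1 / (r - s)) (V (t - r) (v r) -\<^sub>S V (t - r) (v s))"
        using r sS by (simp add: diff_quot_def V_act bdd_additive_minus[OF V_bdd])
      have "V (t - r) (v r) -\<^sub>S V (t - r) (v s) -\<^sub>S (V (t - s) (v s) -\<^sub>S V (t - r) (v s)) = g r -\<^sub>S g s"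
        using r sS ts unfolding g_def
        by (subst minus_minus_minus) (simp_all add: minus_self minus_zero_right)
      then show ?case unfolding e1 e2 using r sS ts
        by (simp add: diff_quot_def flip: act_minus_right)
    qed
    ultimately show "has_deriv g 0\<^sub>S s UNIV"
      unfolding has_deriv_def using conv_cong z[OF s] ts by (simp add: minus_self)
  qed (use t in simp)
  moreover have "g t = C (v t)" "g 0 = V t (v 0)" using vS[of t] t by (simp_all add: g_def V_0)
  ultimately show ?thesis by simp
qed

text \<open>\<open>G\<close> is the improper integral of the orbit of \<open>y\<close>; for
  \<open>V s = exp (- \<eta> s) W s\<close> it is the Laplace transform of \<open>W\<close> at
  \<open>\<eta>\<close> applied to \<open>y\<close>. The rate \<open>d\<close> may come arbitrarily
  close to 0, so the tails tend to 0 almost surely, hence in probability, but not uniformly. The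
  equation is \<open>V_prim\<close> in the limit.\<close>

lemma laplace_limit:
  assumes d[measurable]: "d \<in> borel_measurable P" and d_pos: "AE w in P. 0 < d w"
    and m0: "AE w in P. 0 \<le> m w"
    and decay: "\<And>s x. 0 \<le> s \<Longrightarrow> x \<in> carrier S \<Longrightarrow> AE w in P. nrm (V s x) w \<le> m w * exp (- d w * s) * nrm x w"
    and y: "y \<in> carrier S"
  obtains G where "G \<in> carrier S" "\<And>h. 0 \<le> h \<Longrightarrow> V h G = C (G -\<^sub>S prim y h)"
proof -
  let ?F = "prim y"
  note FS = prim_closed[OF y]
  note [measurable] = nrm_measurable[OF y]
  define a where "a w = m w * nrm y w" for w
  have am[measurable]: "a \<in> borel_measurable P" unfolding a_def[abs_def] by simp
  have a0: "AE w in P. 0 \<le> a w" using m0 nrm_nonneg[OF y] by eventually_elim (simp add: a_def)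
  have tail: "AE w in P. nrm (?F t -\<^sub>S ?F s) w \<le> a w * exp (- d w * s) * (t - s)" if st: "0 \<le> s" "s \<le> t" for s t
  proof (rule prim_bound[OF y st])
    fix r assume r: "r \<in> {s..t}"
    then have "0 \<le> r" using st by simp
    from decay[OF this y] a0 d_pos show "AE w in P. nrm (V r y) w \<le> a w * exp (- d w * s)"
    proof eventually_elim
      case (elim w)
      have "a w * exp (- d w * r) \<le> a w * exp (- d w * s)"
        using elim r by (intro mult_left_mono) auto
      with elim show ?case by (simp add: a_def mult_ac)
    qed
  qed simp
  define \<rho> where "\<rho> w = exp (- d w)" for w
  have \<rho>m[measurable]: "\<rho> \<in> borel_measurable P" unfolding \<rho>_def[abs_def] by simp
  have \<rho>_pow: "exp (- d w * real n) = \<rho> w ^ n" for w n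
    by (simp add: \<rho>_def exp_of_nat_mult[symmetric] mult.commute)
  have \<rho>1: "AE w in P. 0 < \<rho> w \<and> \<rho> w < 1" using d_pos by eventually_elim (simp add: \<rho>_def)
  \<comment> \<open>The partial sums of a geometric series with random ratio, multiplied by
    \<open>1 - \<rho> w\<close> so that the induction involves no division.\<close>
  have sum: "AE w in P. nrm (?F (real (n + j)) -\<^sub>S ?F (real n)) w * (1 - \<rho> w) \<le> a w * \<rho> w ^ n * (1 - \<rho> w ^ j)" for n j
  proof (induction j)
    case 0
    have "?F (real (n + 0)) -\<^sub>S ?F (real n) = 0\<^sub>S" using FS by (simp add: minus_self)
    then show ?case using nrm_zero by (auto elim: AE_mp)
  next
    case (Suc j)
    have 1: "AE w in P. nrm (?F (real (n + Suc j)) -\<^sub>S ?F (real (n + j))) w \<le> a w * \<rho> w ^ (n + j)"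
      using tail[of "real (n + j)" "real (n + Suc j)"] unfolding \<rho>_pow by simp
    have "AE w in P. nrm (?F (real (n + Suc j)) -\<^sub>S ?F (real n)) w
        \<le> nrm (?F (real (n + Suc j)) -\<^sub>S ?F (real (n + j))) w + nrm (?F (real (n + j)) -\<^sub>S ?F (real n)) w"
      by (intro nrm_triangle FS) auto
    with 1 Suc \<rho>1 show ?case
    proof eventually_elim
      case (elim w)
      have "nrm (?F (real (n + Suc j)) -\<^sub>S ?F (real n)) w * (1 - \<rho> w)
          \<le> (a w * \<rho> w ^ (n + j) + nrm (?F (real (n + j)) -\<^sub>S ?F (real n)) w) * (1 - \<rho> w)"
        using elim by (intro mult_right_mono) auto
      also have "\<dots> \<le> a w * \<rho> w ^ (n + j) * (1 - \<rho> w) + a w * \<rho> w ^ n * (1 - \<rho> w ^ j)"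
        using elim by (simp add: distrib_right)
      also have "\<dots> = a w * \<rho> w ^ n * (1 - \<rho> w ^ Suc j)" by (simp add: algebra_simps power_add)
      finally show ?case .
    qed
  qed
  define b where "b n w = a w / (1 - \<rho> w) * \<rho> w ^ n" for n :: nat and w
  have bm: "b n \<in> borel_measurable P" for n unfolding b_def[abs_def] by simp
  have b_lim: "(\<lambda>n. mag (b n)) \<longlonglongrightarrow> 0"
  proof (rule mag_tendsto_AE[OF bm])
    show "AE w in P. (\<lambda>n. b n w) \<longlonglongrightarrow> 0"
      using \<rho>1
    proof eventually_elim
      case (elim w)
      then have "(\<lambda>n. \<rho> w ^ n) \<longlonglongrightarrow> 0" by (intro LIMSEQ_power_zero) auto
      then show ?case unfolding b_def by (rule tendsto_mult_right_zero)
    qed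
  qed
  have F_b: "AE w in P. nrm (?F (real (n + j)) -\<^sub>S ?F (real n)) w \<le> b n w" for n j
    using sum[of n j] \<rho>1 a0
  proof eventually_elim
    case (elim w)
    have "a w * \<rho> w ^ n * (1 - \<rho> w ^ j) \<le> a w * \<rho> w ^ n * 1" using elim by (intro mult_left_mono) auto
    with elim have "nrm (?F (real (n + j)) -\<^sub>S ?F (real n)) w * (1 - \<rho> w) \<le> a w * \<rho> w ^ n" by linarith
    then show ?case using elim by (simp add: b_def pos_le_divide_eq)
  qed
  have mag_F: "mag (nrm (?F (real k) -\<^sub>S ?F (real n))) \<le> mag (b n)" if "n \<le> k" for n k
  proof (rule mag_mono)
    have cl: "?F (real k) -\<^sub>S ?F (real n) \<in> carrier S" using FS by simp
    then show "nrm (?F (real k) -\<^sub>S ?F (real n)) \<in> borel_measurable P" by simp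
    have "n + (k - n) = k" using that by simp
    with F_b[of n "k - n"] have "AE w in P. nrm (?F (real k) -\<^sub>S ?F (real n)) w \<le> b n w" by simp
    with nrm_nonneg[OF cl] show "AE w in P. \<bar>nrm (?F (real k) -\<^sub>S ?F (real n)) w\<bar> \<le> \<bar>b n w\<bar>"
      by eventually_elim simp
  qed (rule bm)
  have "\<exists>l. conv (\<lambda>n. ?F (real n)) l sequentially"
  proof (rule complete_mag[OF complete])
    fix e :: real assume "0 < e"
    from order_tendstoD(2)[OF b_lim this] obtain N where N: "\<And>n. n \<ge> N \<Longrightarrow> mag (b n) < e"
      unfolding eventually_sequentially by blast
    have *: "mag (nrm (?F (real k) -\<^sub>S ?F (real n))) < e" if "N \<le> n" "n \<le> k" for k n
      using mag_F[OF that(2)] N[OF that(1)] by linarith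
    have "mag (nrm (?F (real k) -\<^sub>S ?F (real n))) < e" if "N \<le> n" "N \<le> k" for k n
    proof (cases "n \<le> k")
      case False
      then show ?thesis using *[of k n] that mag_nrm_commute[of "?F (real k)" "?F (real n)"] FS by simp
    qed (use * that in simp)
    then show "\<exists>N. \<forall>k\<ge>N. \<forall>n\<ge>N. mag (nrm (?F (real k) -\<^sub>S ?F (real n))) < e" by blast
  qed (use FS in simp)
  then obtain G where G: "conv (\<lambda>n. ?F (real n)) G sequentially" by blast
  show ?thesis
  proof (rule that)
    show GS: "G \<in> carrier S" by (rule conv_closed[OF G])
    fix h :: real assume h: "0 \<le> h"
    \<comment> \<open>\<open>G\<close> is known as a limit along the integers only; the tail
      estimate shows that a shift by \<open>h\<close> leaves the limit unchanged.\<close>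
    have "conv (\<lambda>n. ?F (real n + h) -\<^sub>S ?F (real n)) 0\<^sub>S sequentially"
    proof (rule convI_nrm_le)
      have "(\<lambda>n. mag (\<lambda>w. a w * h * \<rho> w ^ n)) \<longlonglongrightarrow> 0"
      proof (rule mag_tendsto_AE)
        show "AE w in P. (\<lambda>n. a w * h * \<rho> w ^ n) \<longlonglongrightarrow> 0"
          using \<rho>1
        proof eventually_elim
          case (elim w)
          then have "(\<lambda>n. \<rho> w ^ n) \<longlonglongrightarrow> 0" by (intro LIMSEQ_power_zero) auto
          then show ?case by (rule tendsto_mult_right_zero)
        qed
      qed simp
      then show "(\<lambda>n. mag (\<lambda>w. a w * h * \<rho> w ^ n)) \<longlonglongrightarrow> 0" .
      show "eventually (\<lambda>n. AE w in P. nrm (?F (real n + h) -\<^sub>S ?F (real n) -\<^sub>S 0\<^sub>S) w \<le> \<bar>a w * h * \<rho> w ^ n\<bar>) sequentially"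
      proof (rule always_eventually, rule allI)
        fix n :: nat
        have eq: "?F (real n + h) -\<^sub>S ?F (real n) -\<^sub>S 0\<^sub>S = ?F (real n + h) -\<^sub>S ?F (real n)"
          using FS h by (simp add: minus_zero_right)
        have "AE w in P. nrm (?F (real n + h) -\<^sub>S ?F (real n)) w \<le> a w * \<rho> w ^ n * (real n + h - real n)"
          using tail[of "real n" "real n + h"] h unfolding \<rho>_pow by simp
        then show "AE w in P. nrm (?F (real n + h) -\<^sub>S ?F (real n) -\<^sub>S 0\<^sub>S) w \<le> \<bar>a w * h * \<rho> w ^ n\<bar>"
          unfolding eq
        proof eventually_elim
          case (elim w)
          have "a w * \<rho> w ^ n * (real n + h - real n) = a w * h * \<rho> w ^ n" by simp
          with elim show ?case by linarith
        qed
      qed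
    qed (use FS h in auto)
    from conv_add[OF G this] have "conv (\<lambda>n. ?F (real n + h)) G sequentially"
      using FS GS h by (simp add: add_minus_cancel)
    then have "conv (\<lambda>n. C (?F (real n + h) -\<^sub>S ?F h)) (C (G -\<^sub>S ?F h)) sequentially"
      by (intro conv_op[OF conv_minus[OF _ conv_const] C_bdd] FS h)
    moreover have "conv (\<lambda>n. V h (?F (real n))) (V h G) sequentially"
      by (rule conv_op[OF G V_bdd[OF h]])
    then have "conv (\<lambda>n. C (?F (real n + h) -\<^sub>S ?F h)) (V h G) sequentially"
      using V_prim[OF y _ h] by simp
    ultimately show "V h G = C (G -\<^sub>S ?F h)" using conv_unique by fastforce
  qed
qed

end

section \<open>Generators and the abstract Cauchy problem\<close>

lemma continuous_map_Ici_iff: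
  "continuous_map (top_of_set {0..}) X u \<longleftrightarrow> (\<forall>t\<ge>0. limitin X u (u t) (at t within {0..}))"
  for u :: "real \<Rightarrow> 'a"
proof -
  have "atin (top_of_set {0..}) t = at t within {0..}" if "0 \<le> t" for t :: real
  proof (rule filter_eqI)
    fix Q :: "real \<Rightarrow> bool"
    show "eventually Q (atin (top_of_set {0..}) t) \<longleftrightarrow> eventually Q (at t within {0..})"
      using that by (simp add: atin_subtopology_within eventually_atin_within eventually_at_topological)
        (metis open_openin)
  qed
  then show ?thesis by (simp add: continuous_map_atin Ball_def)
qed

section \<open>The notions of the Cauchy problem in terms of representatives\<close>

context random_normed_module
begin

lemma C0_fun_iff: "u \<in> C0_fun P S \<longleftrightarrow> (\<forall>t\<ge>0. conv u (u t) (at t within {0..}))"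
  by (simp add: C0_fun_def continuous_map_Ici_iff limitin_iff)

lemma act_uminus_left:
  "h \<in> borel_measurable P \<Longrightarrow> x \<in> carrier S \<Longrightarrow> act (\<lambda>w. - h w) x = \<ominus>\<^bsub>S\<^esub> act h x"
  by (simp add: minus_act act_act)

lemma gen_limit_iff:
  assumes "W 0 x = C x"
  shows "gen_limit P S C W x l \<longleftrightarrow> has_deriv (\<lambda>s. W s x) l 0 {0..}"
  unfolding gen_limit_def has_deriv_def diff_quot_def[abs_def] limitin_iff scale_of_real
    at_within_Ici_at_right by (simp add: assms)

lemma generator_eqI:
  assumes C: "inj_on C (carrier S)" and x: "x \<in> carrier S" "W 0 x = C x"
    and a: "a \<in> carrier S" and gen: "has_deriv (\<lambda>s. W s x) (C a) 0 {0..}"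
  shows "x \<in> gen_dom P S C W" "generator P S C W x = a"
proof -
  have lim: "gen_limit P S C W x (C a)" using gen x by (simp add: gen_limit_iff)
  then show "x \<in> gen_dom P S C W" using x a by (auto simp: gen_dom_def)
  have "(THE l. gen_limit P S C W x l) = C a"
    using lim
  proof (rule the_equality)
    show "l = C a" if "gen_limit P S C W x l" for l
      using that lim unfolding gen_limit_def limitin_iff by (rule conv_unique) simp
  qed
  then show "generator P S C W x = a"
    using C a by (simp add: generator_def the_inv_into_f_f)
qed

lemma gen_domD:
  assumes C: "inj_on C (carrier S)" and x: "x \<in> gen_dom P S C W" and W: "\<And>x. x \<in> carrier S \<Longrightarrow> W 0 x = C x"
  shows "x \<in> carrier S" "generator P S C W x \<in> carrier S"
    "has_deriv (\<lambda>s. W s x) (C (generator P S C W x)) 0 {0..}"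
proof -
  obtain a where a: "x \<in> carrier S" "a \<in> carrier S" "gen_limit P S C W x (C a)"
    using x by (auto simp: gen_dom_def)
  then have "has_deriv (\<lambda>s. W s x) (C a) 0 {0..}" using W[OF a(1)] by (simp add: gen_limit_iff)
  with generator_eqI(2)[where C = C and W = W, OF C a(1) W[OF a(1)] a(2)] a
  show "x \<in> carrier S" "generator P S C W x \<in> carrier S"
    "has_deriv (\<lambda>s. W s x) (C (generator P S C W x)) 0 {0..}" by simp_all
qed

lemma L0_le_Lipschitz_iff:
  fixes X :: "('w \<Rightarrow> real) set"
  assumes "z \<in> carrier S" "X \<in> carrier (L0 P)"
  shows "L0_le P (L0norm S z) (X \<otimes>\<^bsub>L0 P\<^esub> L0_const P r) \<longleftrightarrow> (AE w in P. nrm z w \<le> L0_rep X w * r)"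
proof -
  have c: "L0_const P r \<in> carrier (L0 P)" by (simp add: L0_const_def L0_carrier)
  have "AE w in P. L0_rep (L0_const P r) w = r"
    unfolding L0_const_def by (rule L0_rep_class) simp
  with L0_rep_mult[OF assms(2) c]
  have "AE w in P. L0_rep (X \<otimes>\<^bsub>L0 P\<^esub> L0_const P r) w = L0_rep X w * r"
    by eventually_elim simp
  then show ?thesis unfolding L0_le_def nrm_def by (auto elim: AE_mp)
qed

lemma locally_L0_Lipschitz_imp_Lip:
  assumes g: "locally_L0_Lipschitz P S g" "\<And>s. 0 \<le> s \<Longrightarrow> g s \<in> carrier S" and "0 < L"
  shows "Lip g {0..L}"
proof -
  obtain \<zeta> where \<zeta>: "\<zeta> \<in> L0_plus P" and le: "\<forall>s1\<in>{0..L}. \<forall>s2\<in>{0..L}.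
    L0_le P (L0norm S (g s1 -\<^sub>S g s2)) (\<zeta> \<otimes>\<^bsub>L0 P\<^esub> L0_const P \<bar>s1 - s2\<bar>)"
    using g(1) \<open>0 < L\<close> unfolding locally_L0_Lipschitz_def by blast
  have c: "\<zeta> \<in> carrier (L0 P)" using \<zeta> by (simp add: L0_plus_iff)
  show ?thesis
  proof (rule LipI[OF _ L0_class_rep(1)[OF c]])
    fix s r assume sr: "s \<in> {0..L}" "r \<in> {0..L}"
    then have "g s -\<^sub>S g r \<in> carrier S" using g(2) by simp
    then show "AE w in P. nrm (g s -\<^sub>S g r) w \<le> L0_rep \<zeta> w * \<bar>s - r\<bar>"
      using le[rule_format, OF sr] L0_le_Lipschitz_iff c by blast
  qed (use g(2) in simp)
qed

lemma Lip_imp_locally_L0_Lipschitz: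
  assumes "\<And>L. Lip g {0..L}"
  shows "locally_L0_Lipschitz P S g"
  unfolding locally_L0_Lipschitz_def
proof (intro allI impI)
  fix L :: real
  note g = assms[of L]
  obtain \<zeta> where \<zeta>: "\<zeta> \<in> borel_measurable P" "\<And>w. 0 \<le> \<zeta> w"
    "\<And>s r. s \<in> {0..L} \<Longrightarrow> r \<in> {0..L} \<Longrightarrow> AE w in P. nrm (g s -\<^sub>S g r) w \<le> \<zeta> w * \<bar>s - r\<bar>"
    by (rule LipE[OF g], rule that)
  have rep: "AE w in P. L0_rep (L0_class P \<zeta>) w = \<zeta> w" by (rule L0_rep_class(2)[OF \<zeta>(1)])
  have c: "L0_class P \<zeta> \<in> carrier (L0 P)" using \<zeta>(1) by (simp add: L0_carrier)
  have "L0_class P \<zeta> \<in> L0_plus P" unfolding L0_plus_iff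
  proof
    show "AE w in P. 0 \<le> L0_rep (L0_class P \<zeta>) w" using rep by eventually_elim (simp add: \<zeta>(2))
  qed (rule c)
  moreover have "L0_le P (L0norm S (g s -\<^sub>S g r)) (L0_class P \<zeta> \<otimes>\<^bsub>L0 P\<^esub> L0_const P \<bar>s - r\<bar>)"
    if "s \<in> {0..L}" "r \<in> {0..L}" for s r
  proof -
    have cl: "g s -\<^sub>S g r \<in> carrier S" using Lip_closed[OF g that(1)] Lip_closed[OF g that(2)] by simp
    have "AE w in P. nrm (g s -\<^sub>S g r) w \<le> L0_rep (L0_class P \<zeta>) w * \<bar>s - r\<bar>"
      using \<zeta>(3)[OF that] rep by eventually_elim simp
    then show ?thesis using L0_le_Lipschitz_iff[OF cl c] by simp
  qed
  ultimately show "\<exists>\<zeta>\<in>L0_plus P. \<forall>s1\<in>{0..L}. \<forall>s2\<in>{0..L}.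
      L0_le P (L0norm S (g s1 -\<^sub>S g s2)) (\<zeta> \<otimes>\<^bsub>L0 P\<^esub> L0_const P \<bar>s1 - s2\<bar>)" by blast
qed

lemma graph_norm:
  assumes "x \<in> carrier S" "A x \<in> carrier S"
  shows "L0_rep (L0norm (graph_module P S D A) x) \<in> borel_measurable P"
    "AE w in P. L0_rep (L0norm (graph_module P S D A) x) w = nrm x w + nrm (A x) w"
proof -
  have eq: "L0norm (graph_module P S D A) x = L0_class P (\<lambda>w. nrm x w + nrm (A x) w)"
    using assms by (simp add: graph_module_def L0norm_nrm L0_add_class)
  have m: "(\<lambda>w. nrm x w + nrm (A x) w) \<in> borel_measurable P" using assms by simp
  show "L0_rep (L0norm (graph_module P S D A) x) \<in> borel_measurable P"
    "AE w in P. L0_rep (L0norm (graph_module P S D A) x) w = nrm x w + nrm (A x) w"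
    unfolding eq by (rule L0_rep_class[OF m])+
qed

text \<open>\<open>ACP_solution\<close> expresses membership in the domain only through continuity
  into the graph module; a continuous map takes values in the topological space, which lies inside
  \<open>D\<close>.\<close>

lemma C0_fun_graph_closed:
  assumes D: "\<And>x. x \<in> D \<Longrightarrow> x \<in> carrier S \<and> A x \<in> carrier S"
    and u: "u \<in> C0_fun P (graph_module P S D A)" and "0 \<le> t"
  shows "u t \<in> D"
proof -
  let ?G = "graph_module P S D A"
  have car: "carrier ?G = D" by (simp add: graph_module_def)
  have "openin (el_topology P ?G) (topspace (el_topology P ?G))" by simp
  then have "el_open P ?G (topspace (el_topology P ?G))"
    by (subst (asm) openin_el_topology) (auto simp: car prob_space_axioms D graph_norm(1))
  then have "topspace (el_topology P ?G) \<subseteq> D" by (simp add: el_open_def car)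
  moreover have "u t \<in> topspace (el_topology P ?G)"
    using u \<open>0 \<le> t\<close> by (auto simp: C0_fun_def continuous_map_def)
  ultimately show ?thesis by blast
qed

text \<open>Because \<open>A\<close> respects differences on \<open>D\<close>, the graph norm of an
  increment of \<open>u\<close> splits into the norms of the increments of \<open>u\<close> and of
  \<open>A u\<close>, each of which tends to 0.\<close>

lemma C0_fun_graphI:
  assumes D: "\<And>x. x \<in> D \<Longrightarrow> x \<in> carrier S \<and> A x \<in> carrier S"
    and D_add: "\<And>x y. x \<in> D \<Longrightarrow> y \<in> D \<Longrightarrow> x +\<^sub>S y \<in> D"
    and D_minus: "\<And>x y. x \<in> D \<Longrightarrow> y \<in> D \<Longrightarrow> x -\<^sub>S y \<in> D \<and> A (x -\<^sub>S y) = A x -\<^sub>S A y"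
    and u: "\<And>t. 0 \<le> t \<Longrightarrow> u t \<in> D"
    and conv: "\<And>t. 0 \<le> t \<Longrightarrow> conv u (u t) (at t within {0..})"
      "\<And>t. 0 \<le> t \<Longrightarrow> conv (\<lambda>s. A (u s)) (A (u t)) (at t within {0..})"
  shows "u \<in> C0_fun P (graph_module P S D A)"
  unfolding C0_fun_def continuous_map_Ici_iff mem_Collect_eq
proof (intro allI impI)
  fix t :: real assume t: "0 \<le> t"
  let ?G = "graph_module P S D A"
  have car: "carrier ?G = D" and add: "(\<oplus>\<^bsub>?G\<^esub>) = (\<oplus>\<^bsub>S\<^esub>)" by (simp_all add: graph_module_def)
  show "limitin (el_topology P ?G) u (u t) (at t within {0..})"
  proof (rule limitin_el_topologyI[where z = "\<lambda>s. u s -\<^sub>S u t"])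
    fix z assume "z \<in> carrier ?G"
    then have z: "z \<in> carrier S" "A z \<in> carrier S" using D by (auto simp: car)
    show "L0_rep (L0norm ?G z) \<in> borel_measurable P" by (rule graph_norm(1)[where A = A and x = z, OF z])
    show "AE w in P. 0 \<le> L0_rep (L0norm ?G z) w"
      using graph_norm(2)[where A = A and x = z and D = D, OF z] nrm_nonneg[OF z(1)] nrm_nonneg[OF z(2)] by eventually_elim simp
  next
    show "eventually (\<lambda>s. u s -\<^sub>S u t \<in> carrier ?G \<and> u s = u t \<oplus>\<^bsub>?G\<^esub> (u s -\<^sub>S u t)) (at t within {0..})"
    proof (rule eventually_within)
      fix s :: real assume "s \<in> {0..}"
      then have "u s \<in> D" using u by simp
      then show "u s -\<^sub>S u t \<in> carrier ?G \<and> u s = u t \<oplus>\<^bsub>?G\<^esub> (u s -\<^sub>S u t)"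
        using u[OF t] D D_minus by (simp add: car add add_minus_cancel)
    qed
    show "((\<lambda>s. mag (L0_rep (L0norm ?G (u s -\<^sub>S u t)))) \<longlongrightarrow> 0) (at t within {0..})"
    proof (rule tendsto_sandwich[OF _ _ tendsto_const])
      show "eventually (\<lambda>s. mag (L0_rep (L0norm ?G (u s -\<^sub>S u t)))
          \<le> mag (nrm (u s -\<^sub>S u t)) + mag (nrm (A (u s) -\<^sub>S A (u t)))) (at t within {0..})"
      proof (rule eventually_within)
        fix s :: real assume "s \<in> {0..}"
        then have "u s \<in> D" using u by simp
        then have m: "u s -\<^sub>S u t \<in> D" and A: "A (u s -\<^sub>S u t) = A (u s) -\<^sub>S A (u t)"
          using D_minus u[OF t] by auto
        have z: "u s -\<^sub>S u t \<in> carrier S" "A (u s -\<^sub>S u t) \<in> carrier S" using D[OF m] by auto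
        show "mag (L0_rep (L0norm ?G (u s -\<^sub>S u t)))
            \<le> mag (nrm (u s -\<^sub>S u t)) + mag (nrm (A (u s) -\<^sub>S A (u t)))"
          unfolding A[symmetric]
        proof (rule mag_le_add)
          show "AE w in P. \<bar>L0_rep (L0norm ?G (u s -\<^sub>S u t)) w\<bar>
              \<le> \<bar>nrm (u s -\<^sub>S u t) w\<bar> + \<bar>nrm (A (u s -\<^sub>S u t)) w\<bar>"
            using graph_norm(2)[where A = A and D = D and x = "u s -\<^sub>S u t", OF z] by eventually_elim simp
        qed (use z graph_norm(1)[where A = A and x = "u s -\<^sub>S u t", OF z] in simp_all)
      qed
      show "((\<lambda>s. mag (nrm (u s -\<^sub>S u t)) + mag (nrm (A (u s) -\<^sub>S A (u t)))) \<longlongrightarrow> 0) (at t within {0..})"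
        using conv[OF t] tendsto_add_zero by (auto simp: conv_def)
    qed (simp add: mag_nonneg)
  qed (use D_add u[OF t] in \<open>simp_all add: car add\<close>)
qed

end

section \<open>Exponentially bounded C-semigroups and their solutions\<close>

locale exp_bounded_semigroup = random_normed_module P S
  for P :: "'w measure"
    and S :: "('w, 'k::{real_normed_field, second_countable_topology}, 's) rn_module" +
  fixes C :: "'s \<Rightarrow> 's" and W :: "real \<Rightarrow> 's \<Rightarrow> 's" and c m \<xi> \<eta> :: "'w \<Rightarrow> real"
  assumes complete: "el_complete P S"
    and C_bdd: "bdd_additive c C"
    and C_act: "h \<in> borel_measurable P \<Longrightarrow> x \<in> carrier S \<Longrightarrow> C (act h x) = act h (C x)"
    and C_inj: "inj_on C (carrier S)"
    and W_bdd: "0 \<le> t \<Longrightarrow> bdd_additive (\<lambda>w. m w * exp (\<xi> w * t)) (W t)"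
    and W_act: "0 \<le> t \<Longrightarrow> h \<in> borel_measurable P \<Longrightarrow> x \<in> carrier S \<Longrightarrow> W t (act h x) = act h (W t x)"
    and W_0: "x \<in> carrier S \<Longrightarrow> W 0 x = C x"
    and W_add: "0 \<le> s \<Longrightarrow> 0 \<le> t \<Longrightarrow> x \<in> carrier S \<Longrightarrow> C (W (s + t) x) = W t (W s x)"
    and W_conv: "x \<in> carrier S \<Longrightarrow> 0 \<le> t \<Longrightarrow> conv (\<lambda>s. W s x) (W t x) (at t within {0..})"
    and m_meas[measurable]: "m \<in> borel_measurable P" and m_nonneg: "AE w in P. 0 \<le> m w"
    and \<xi>_meas[measurable]: "\<xi> \<in> borel_measurable P" and \<eta>_meas[measurable]: "\<eta> \<in> borel_measurable P"
    and \<xi>_less: "AE w in P. \<xi> w < \<eta> w"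
begin

abbreviation A :: "'s \<Rightarrow> 's" where "A \<equiv> generator P S C W"

abbreviation D :: "'s set" where "D \<equiv> gen_dom P S C W"

definition V :: "real \<Rightarrow> 's \<Rightarrow> 's" where
  "V t x = act (\<lambda>w. exp (- \<eta> w * t)) (W t x)"

lemma W_closed[simp]: "0 \<le> t \<Longrightarrow> x \<in> carrier S \<Longrightarrow> W t x \<in> carrier S"
  by (rule bdd_additiveD(2)[OF W_bdd])

lemma V_decay:
  assumes "0 \<le> t" "x \<in> carrier S"
  shows "AE w in P. nrm (V t x) w \<le> m w * exp (- (\<eta> w - \<xi> w) * t) * nrm x w"
proof -
  have "AE w in P. nrm (V t x) w = \<bar>exp (- \<eta> w * t)\<bar> * nrm (W t x) w"
    unfolding V_def using assms by (intro nrm_act) auto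
  with bdd_additiveD(4)[OF W_bdd[OF assms(1)] assms(2)] show ?thesis
  proof eventually_elim
    case (elim w)
    have "exp (- (\<eta> w - \<xi> w) * t) = exp (- \<eta> w * t) * exp (\<xi> w * t)"
      by (simp add: algebra_simps flip: exp_add)
    moreover have "exp (- \<eta> w * t) * nrm (W t x) w \<le> exp (- \<eta> w * t) * (m w * exp (\<xi> w * t) * nrm x w)"
      using elim by (intro mult_left_mono) auto
    ultimately show ?case using elim by (simp add: mult_ac)
  qed
qed

lemma act_exp_cancel:
  "x \<in> carrier S \<Longrightarrow> act (\<lambda>w. exp (\<eta> w * t)) (act (\<lambda>w. exp (- \<eta> w * t)) x) = x"
  by (simp add: act_act flip: exp_add)

lemma W_eq_V: "0 \<le> t \<Longrightarrow> x \<in> carrier S \<Longrightarrow> W t x = act (\<lambda>w. exp (\<eta> w * t)) (V t x)"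
  unfolding V_def by (rule act_exp_cancel[symmetric]) simp

text \<open>As \<open>W t\<close> commutes with random scalars, the exponentials multiply and
  \<open>V\<close> inherits the semigroup law; as \<open>\<xi> < \<eta>\<close> almost surely, the
  exponential factor left in the bound is at most 1.\<close>

sublocale V: dominated_semigroup P S C V c m
proof
  fix t :: real assume t: "0 \<le> t"
  show "bdd_additive m (V t)"
    unfolding bdd_additive_def
  proof (intro conjI ballI)
    fix x assume x: "x \<in> carrier S"
    then show "V t x \<in> carrier S" using t by (simp add: V_def)
    show "AE w in P. nrm (V t x) w \<le> m w * nrm x w"
      using V_decay[OF t x] m_nonneg \<xi>_less nrm_nonneg[OF x]
    proof eventually_elim
      case (elim w)
      have "m w * exp (- (\<eta> w - \<xi> w) * t) \<le> m w * 1"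
        using elim t by (intro mult_left_mono) (auto simp: mult_nonpos_nonneg)
      then have "m w * exp (- (\<eta> w - \<xi> w) * t) * nrm x w \<le> m w * nrm x w"
        using elim by (intro mult_right_mono) auto
      with elim show ?case by linarith
    qed
    fix y assume y: "y \<in> carrier S"
    show "V t (x +\<^sub>S y) = V t x +\<^sub>S V t y"
      using t x y by (simp add: V_def bdd_additiveD(3)[OF W_bdd] act_add_right)
  qed simp
  show "V t (act h x) = act h (V t x)" if "h \<in> borel_measurable P" "x \<in> carrier S" for h x
    using that t by (simp add: V_def W_act act_act mult.commute)
  show "conv (\<lambda>s. V s x) (V t x) (at t within {0..})" if x: "x \<in> carrier S" for x
    unfolding V_def
    by (rule conv_act_var[OF W_conv[OF x t] _ _ mag_exp_tendsto(1)]) simp_all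
  fix s :: real and x assume s: "0 \<le> s" and x: "x \<in> carrier S"
  have "V t (V s x) = act (\<lambda>w. exp (- \<eta> w * t) * exp (- \<eta> w * s)) (W t (W s x))"
    using s t x by (simp add: V_def W_act act_act)
  also have "\<dots> = act (\<lambda>w. exp (- \<eta> w * (s + t))) (C (W (s + t) x))"
    using s t x by (simp add: W_add distrib_left add.commute flip: exp_add)
  finally show "C (V (s + t) x) = V t (V s x)"
    using s t x by (simp add: V_def C_act)
qed (simp_all add: complete C_bdd C_act C_inj V_def W_0 bdd_additiveD(2)[OF C_bdd])

lemma W_C: "0 \<le> t \<Longrightarrow> x \<in> carrier S \<Longrightarrow> W t (C x) = C (W t x)"
  using W_add[of 0 t x] by (simp add: W_0)

lemmas genD = gen_domD[where W = W, OF C_inj _ W_0]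

lemma genI:
  "x \<in> carrier S \<Longrightarrow> a \<in> carrier S \<Longrightarrow> has_deriv (\<lambda>s. W s x) (C a) 0 {0..} \<Longrightarrow> x \<in> D \<and> A x = a"
  using generator_eqI[where W = W, OF C_inj _ W_0] by blast

lemma gen_add:
  assumes "x \<in> D" "y \<in> D" shows "x +\<^sub>S y \<in> D"
proof -
  note cl = genD(1,2)[OF assms(1)] genD(1,2)[OF assms(2)]
  have "has_deriv (\<lambda>s. W s x +\<^sub>S W s y) (C (A x) +\<^sub>S C (A y)) 0 {0..}"
    by (rule has_deriv_add[OF genD(3)[OF assms(1)] genD(3)[OF assms(2)]]) (use cl in auto)
  then have "has_deriv (\<lambda>s. W s (x +\<^sub>S y)) (C (A x) +\<^sub>S C (A y)) 0 {0..}"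
    by (rule has_deriv_cong) (use cl in \<open>simp_all add: bdd_additiveD(3)[OF W_bdd]\<close>)
  then show ?thesis
    using genI[of "x +\<^sub>S y" "A x +\<^sub>S A y"] cl by (simp add: bdd_additiveD(3)[OF C_bdd])
qed

lemma gen_minus:
  assumes "x \<in> D" "y \<in> D" shows "x -\<^sub>S y \<in> D \<and> A (x -\<^sub>S y) = A x -\<^sub>S A y"
proof -
  note cl = genD(1,2)[OF assms(1)] genD(1,2)[OF assms(2)]
  have "has_deriv (\<lambda>s. W s x -\<^sub>S W s y) (C (A x) -\<^sub>S C (A y)) 0 {0..}"
    by (rule has_deriv_minus[OF genD(3)[OF assms(1)] genD(3)[OF assms(2)]]) (use cl in auto)
  then have "has_deriv (\<lambda>s. W s (x -\<^sub>S y)) (C (A x) -\<^sub>S C (A y)) 0 {0..}"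
    by (rule has_deriv_cong) (use cl in \<open>simp_all add: bdd_additive_minus[OF W_bdd]\<close>)
  then show ?thesis
    using genI[of "x -\<^sub>S y" "A x -\<^sub>S A y"] cl by (simp add: bdd_additive_minus[OF C_bdd])
qed

text \<open>In the product rule at 0 the exponential contributes \<open>- \<eta>\<close> times
  \<open>C x\<close> and the orbit contributes \<open>C (A x)\<close>. Thus equations for
  \<open>A\<close> become equations for \<open>A - \<eta>\<close>, to which the results on dominated
  semigroups apply.\<close>

lemma V_gen:
  assumes x: "x \<in> D"
  shows "has_deriv (\<lambda>s. V s x) (C (A x -\<^sub>S act \<eta> x)) 0 {0..}"
proof -
  note cl = genD(1,2)[OF x]
  have "has_deriv (\<lambda>s. act (\<lambda>w. exp (- \<eta> w * s)) (W s x))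
      (act (\<lambda>w. - \<eta> w * exp (- \<eta> w * 0)) (W 0 x) +\<^sub>S act (\<lambda>w. exp (- \<eta> w * 0)) (C (A x))) 0 {0..}"
    by (rule has_deriv_act[OF genD(3)[OF x] _ _ _ _ mag_exp_tendsto]) (use cl in auto)
  moreover have "act (\<lambda>w. - \<eta> w * exp (- \<eta> w * 0)) (W 0 x) +\<^sub>S act (\<lambda>w. exp (- \<eta> w * 0)) (C (A x))
      = C (A x -\<^sub>S act \<eta> x)"
    using cl by (simp add: W_0 act_uminus_left bdd_additive_minus[OF C_bdd] C_act) (simp add: M.minus_eq M.a_comm)
  ultimately show ?thesis by (simp add: V_def)
qed

text \<open>For the difference \<open>d\<close> of two preimages the orbit of \<open>V\<close> has
  zero derivative at 0, hence is constantly \<open>C d\<close>. As \<open>V\<close> decays,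
  \<open>C d = 0\<close>, and injectivity of \<open>C\<close> gives \<open>d = 0\<close>.\<close>

lemma inj_resolvent: "inj_on (\<lambda>x. act \<eta> x -\<^sub>S A x) D"
proof (rule inj_onI)
  fix x y assume xy: "x \<in> D" "y \<in> D" and eq: "act \<eta> x -\<^sub>S A x = act \<eta> y -\<^sub>S A y"
  note cl = genD(1,2)[OF xy(1)] genD(1,2)[OF xy(2)]
  define d where "d = x -\<^sub>S y"
  have d: "d \<in> D" "A d = A x -\<^sub>S A y" using gen_minus[OF xy] by (simp_all add: d_def)
  note dS = genD(1,2)[OF d(1)]
  have "act \<eta> d -\<^sub>S A d = (act \<eta> x -\<^sub>S act \<eta> y) -\<^sub>S (A x -\<^sub>S A y)"
    unfolding d(2) using cl by (simp add: d_def act_minus_right)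
  also have "\<dots> = (act \<eta> x -\<^sub>S A x) -\<^sub>S (act \<eta> y -\<^sub>S A y)"
    by (rule minus_minus_minus) (use cl in simp_all)
  also have "\<dots> = 0\<^sub>S" using cl by (simp add: eq minus_self)
  finally have "act \<eta> d -\<^sub>S A d = 0\<^sub>S" .
  then have "act \<eta> d = A d" using dS by (simp add: minus_eq_zero)
  then have gen: "has_deriv (\<lambda>s. V s d) (C 0\<^sub>S) 0 {0..}"
    using V_gen[OF d(1)] dS by (simp add: minus_self)
  have VC: "V t d = C d" if "0 \<le> t" for t
  proof -
    have "V.prim 0\<^sub>S t = 0\<^sub>S"
      using V.prim_minus[of "0\<^sub>S" "0\<^sub>S" t] V.prim_closed[of "0\<^sub>S" t] that by (simp add: minus_self)
    then have "V t d -\<^sub>S C d = 0\<^sub>S"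
      using V.V_eq_prim[OF dS(1) _ that gen] by simp
    then show ?thesis using dS that by (simp add: minus_eq_zero)
  qed
  have CS: "C d \<in> carrier S" using dS by simp
  \<comment> \<open>The decay is used at integer times only, so that one null set serves for all of
    them and the limit can be taken pointwise.\<close>
  have "AE w in P. \<forall>n. nrm (C d) w \<le> m w * exp (- (\<eta> w - \<xi> w) * real n) * nrm d w"
    unfolding AE_all_countable
  proof
    fix n show "AE w in P. nrm (C d) w \<le> m w * exp (- (\<eta> w - \<xi> w) * real n) * nrm d w"
      using V_decay[of "real n" d] VC[of "real n"] dS by simp
  qed
  with \<xi>_less nrm_nonneg[OF CS] have "AE w in P. nrm (C d) w = 0"
  proof eventually_elim
    case (elim w)
    have "(\<lambda>n. exp (- (\<eta> w - \<xi> w)) ^ n) \<longlonglongrightarrow> 0" using elim by (intro LIMSEQ_power_zero) simp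
    then have "(\<lambda>n. m w * exp (- (\<eta> w - \<xi> w)) ^ n * nrm d w) \<longlonglongrightarrow> m w * 0 * nrm d w"
      by (intro tendsto_mult tendsto_const)
    then have "nrm (C d) w \<le> m w * 0 * nrm d w"
      by (rule LIMSEQ_le_const) (use elim(3) in \<open>auto simp: exp_of_nat_mult[symmetric] mult.commute\<close>)
    with elim show ?case by simp
  qed
  then have "C d = 0\<^sub>S" by (rule nrm_eq_0[OF CS])
  then have "C d = C 0\<^sub>S" by (simp add: bdd_additive_zero[OF C_bdd])
  then have "d = 0\<^sub>S" using V.C_eq_iff[of d "0\<^sub>S"] dS by simp
  then show "x = y" using cl by (simp add: d_def minus_eq_zero)
qed

lemma solution_unique:
  assumes t: "0 \<le> t" and v: "Lip v {0..t}"
    and vD: "\<And>s. s \<in> {0<..<t} \<Longrightarrow> v s \<in> D"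
    and der: "\<And>s. s \<in> {0<..<t} \<Longrightarrow> has_deriv v (A (v s)) s {0..t}"
  shows "C (v t) = W t (v 0)"
proof (cases "t = 0")
  case True
  then show ?thesis using Lip_closed[OF v, of 0] by (simp add: W_0)
next
  case False
  with t have t0: "0 < t" by simp
  let ?e = "\<lambda>s w. exp (- \<eta> w * s)"
  have e[measurable]: "?e s \<in> borel_measurable P" for s by simp
  note vS = Lip_closed[OF v]
  have at: "at s within {0..} = at s within {0..t}" if "s \<in> {0<..<t}" for s
  proof -
    have "at s within {0..} = at s" "at s within {0..t} = at s"
      by (rule at_within_open_subset[of _ "{0<..<t}"], use that in auto)+
    then show ?thesis by simp
  qed
  have "C (act (?e t) (v t)) = V t (act (?e 0) (v 0))"
  proof (rule V.V_solution_unique[OF t0 Lip_act_exp[OF v]])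
    fix s assume s: "s \<in> {0<..<t}"
    then have sI: "s \<in> {0..t}" by simp
    note cl = genD(1,2)[OF vD[OF s]]
    let ?z = "act (?e s) (A (v s) -\<^sub>S act \<eta> (v s))"
    show "?z \<in> carrier S" using cl by simp
    have "has_deriv (\<lambda>s. act (?e s) (v s)) (act (\<lambda>w. - \<eta> w * exp (- \<eta> w * s)) (v s) +\<^sub>S act (?e s) (A (v s))) s {0..t}"
      by (rule has_deriv_act[OF der[OF s] sI vS _ _ mag_exp_tendsto]) simp_all
    moreover have "act (\<lambda>w. - \<eta> w * exp (- \<eta> w * s)) (v s) +\<^sub>S act (?e s) (A (v s)) = ?z"
    proof -
      have "act (\<lambda>w. - \<eta> w * exp (- \<eta> w * s)) (v s) = \<ominus>\<^bsub>S\<^esub> act (\<lambda>w. exp (- \<eta> w * s) * \<eta> w) (v s)"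
        using cl act_uminus_left[of "\<lambda>w. exp (- \<eta> w * s) * \<eta> w" "v s"] by (simp add: mult.commute)
      then show ?thesis using cl by (simp add: act_minus_right act_act) (simp add: M.minus_eq M.a_comm)
    qed
    ultimately show "has_deriv (\<lambda>s. act (?e s) (v s)) ?z s {0..}"
      using at[OF s] by (simp add: has_deriv_def)
    have "has_deriv (\<lambda>h. act (?e s) (V h (v s))) (act (?e s) (C (A (v s) -\<^sub>S act \<eta> (v s)))) 0 {0..}"
      by (rule has_deriv_op[OF V_gen[OF vD[OF s]] _ _ bdd_additive_act_op[OF e]])
        (use cl in \<open>simp_all add: act_act mult.commute\<close>)
    then have "has_deriv (\<lambda>h. V h (act (?e s) (v s))) (act (?e s) (C (A (v s) -\<^sub>S act \<eta> (v s)))) 0 {0..}"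
      by (rule has_deriv_cong) (use cl in \<open>simp_all add: V.V_act\<close>)
    then show "has_deriv (\<lambda>h. V h (act (?e s) (v s))) (C ?z) 0 {0..}"
      using cl by (simp add: C_act)
  qed simp
  then have "act (?e t) (C (v t)) = V t (v 0)" using vS t by (simp add: C_act)
  then have "act (\<lambda>w. exp (\<eta> w * t)) (act (?e t) (C (v t))) = W t (v 0)"
    using W_eq_V[OF t vS[of 0]] t by simp
  then show ?thesis using act_exp_cancel[of "C (v t)" t] vS[of t] t by simp
qed

lemma solution_exists:
  assumes y: "y \<in> carrier S"
  obtains u where "\<And>t. 0 \<le> t \<Longrightarrow> u t \<in> D" "\<And>t. 0 \<le> t \<Longrightarrow> A (u t) = act \<eta> (u t) -\<^sub>S W t y"
    "\<And>t. 0 \<le> t \<Longrightarrow> has_deriv u (A (u t)) t {0..}" "\<And>L. Lip u {0..L}"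
    "\<And>t. 0 \<le> t \<Longrightarrow> W t (u 0) = C (u t)"
proof -
  have dm: "(\<lambda>w. \<eta> w - \<xi> w) \<in> borel_measurable P" by simp
  have dp: "AE w in P. 0 < \<eta> w - \<xi> w" using \<xi>_less by eventually_elim simp
  have "\<exists>G\<in>carrier S. \<forall>h\<ge>0. V h G = C (G -\<^sub>S V.prim y h)"
    by (rule V.laplace_limit[OF dm dp m_nonneg V_decay y]) blast+
  then obtain G where G: "G \<in> carrier S" and VG: "\<And>h. 0 \<le> h \<Longrightarrow> V h G = C (G -\<^sub>S V.prim y h)"
    by blast
  let ?e = "\<lambda>t w. exp (\<eta> w * t)"
  have e[measurable]: "?e s \<in> borel_measurable P" for s by simp
  define u where "u t = act (?e t) (G -\<^sub>S V.prim y t)" for t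
  note FS = V.prim_closed[OF y]
  have uS: "u t \<in> carrier S" if "0 \<le> t" for t using G FS[OF that] by (simp add: u_def)
  have u0: "u 0 = G" using G y by (simp add: u_def V.prim_0 minus_zero_right)
  have WG: "W t G = C (u t)" if "0 \<le> t" for t
    using W_eq_V[OF that G] VG[OF that] G FS[OF that] by (simp add: u_def C_act)
  \<comment> \<open>\<open>C (u t)\<close> is \<open>W t G\<close>; the semigroup law produces one
    factor \<open>C\<close> and \<open>WG\<close> another, and injectivity removes the outer
    one.\<close>
  have Wu: "W h (u t) = C (u (t + h))" if "0 \<le> t" "0 \<le> h" for t h
  proof -
    have "C (W h (u t)) = W h (W t G)" using W_C[OF that(2) uS[OF that(1)]] WG[OF that(1)] by simp
    also have "\<dots> = C (C (u (t + h)))" using W_add[OF that G] WG[of "t + h"] that by simp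
    finally show ?thesis using V.C_eq_iff[of "W h (u t)" "C (u (t + h))"] uS that by simp
  qed
  have u_deriv: "has_deriv u (act \<eta> (u t) -\<^sub>S W t y) t {0..}" if t: "0 \<le> t" for t
  proof -
    have 1: "has_deriv (\<lambda>t. G -\<^sub>S V.prim y t) (0\<^sub>S -\<^sub>S V t y) t {0..}"
      by (rule has_deriv_minus[OF has_deriv_const[OF G] V.prim_deriv[OF y t]]) (use t G FS in auto)
    have "has_deriv u (act (\<lambda>w. \<eta> w * exp (\<eta> w * t)) (G -\<^sub>S V.prim y t) +\<^sub>S act (?e t) (0\<^sub>S -\<^sub>S V t y)) t {0..}"
      unfolding u_def by (rule has_deriv_act[OF 1 _ _ _ _ mag_exp_tendsto]) (use t G FS in auto)
    moreover have "act (?e t) (0\<^sub>S -\<^sub>S V t y) = \<ominus>\<^bsub>S\<^esub> W t y"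
      using W_eq_V[OF t y] t y by (simp add: act_minus_right) (simp add: M.minus_eq)
    moreover have "act (\<lambda>w. \<eta> w * exp (\<eta> w * t)) (G -\<^sub>S V.prim y t) = act \<eta> (u t)"
      using G FS[OF t] by (simp add: u_def act_act)
    ultimately show ?thesis by (simp add: M.minus_eq)
  qed
  \<comment> \<open>By \<open>Wu\<close> the orbit of \<open>u t\<close> is \<open>C\<close> applied
    to a shift of \<open>u\<close>, so its right derivative at 0 is \<open>C\<close> of the
    derivative of \<open>u\<close> at \<open>t\<close>. It therefore lies in the range of
    \<open>C\<close>, which puts \<open>u t\<close> in the domain.\<close>
  have gen: "u t \<in> D \<and> A (u t) = act \<eta> (u t) -\<^sub>S W t y" if t: "0 \<le> t" for t
  proof (rule genI[OF uS[OF t]])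
    have "has_deriv (\<lambda>h. u (h + t)) (act \<eta> (u t) -\<^sub>S W t y) 0 {0..}"
      by (rule has_deriv_shift) (use u_deriv[OF t] t in simp_all)
    then have "has_deriv (\<lambda>h. C (u (h + t))) (C (act \<eta> (u t) -\<^sub>S W t y)) 0 {0..}"
      by (rule has_deriv_op[OF _ _ _ C_bdd]) (use uS t C_act in auto)
    then show "has_deriv (\<lambda>h. W h (u t)) (C (act \<eta> (u t) -\<^sub>S W t y)) 0 {0..}"
      by (rule has_deriv_cong) (use Wu[OF t] in \<open>simp_all add: add.commute\<close>)
    show "act \<eta> (u t) -\<^sub>S W t y \<in> carrier S" using uS[OF t] t y by simp
  qed
  have Lip: "Lip u {0..L}" for L
    unfolding u_def
  proof (rule Lip_act_exp)
    show "Lip (\<lambda>t. G -\<^sub>S V.prim y t) {0..L}"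
      by (rule Lip_minus[OF Lip_const[OF G] Lip_subset[OF V.prim_Lip[OF y]]]) auto
  qed simp
  show ?thesis
  proof (rule that[of u])
    fix t :: real assume t: "0 \<le> t"
    show "u t \<in> D" "A (u t) = act \<eta> (u t) -\<^sub>S W t y" using gen[OF t] by simp_all
    then show "has_deriv u (A (u t)) t {0..}" using u_deriv[OF t] by simp
    show "W t (u 0) = C (u t)" using WG[OF t] u0 by simp
  qed (rule Lip)
qed

lemma resolvent_eq:
  assumes "x \<in> D" "act \<eta> x -\<^sub>S A x = C y" "\<eta>' = L0_class P (\<lambda>w. of_real (\<eta> w))"
  shows "C_resolvent S C D A \<eta>' y = x"
  unfolding C_resolvent_def assms(3) act_def[symmetric] using the_inv_into_f_f[OF inj_resolvent assms(1)] assms(2) by simp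

text \<open>The proof contains the two properties defining the resolvent set:
  \<open>inj_resolvent\<close> gives injectivity, and for each \<open>y\<close> the solution built
  from \<open>y\<close> supplies at time 0 a preimage of \<open>C y\<close>. So the given initial
  value is the value at 0 of that solution.\<close>

lemma ACP_well_posed:
  assumes u0: "u0 \<in> C_resolvent S C D A (L0_class P (\<lambda>w. of_real (\<eta> w))) ` carrier S"
  shows "\<exists>u. ACP_solution P S D A u0 u \<and>
      (\<forall>v. ACP_solution P S D A u0 v \<longrightarrow> (\<forall>t\<ge>0. v t = u t)) \<and>
      (\<forall>t\<ge>0. W t u0 \<in> C ` carrier S \<and> u t = op_inv S C (W t u0)) \<and>
      (u0 \<in> C ` carrier S \<longrightarrow> (\<forall>t\<ge>0. u t = W t (op_inv S C u0)))"
proof -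
  obtain y where y: "y \<in> carrier S" "u0 = C_resolvent S C D A (L0_class P (\<lambda>w. of_real (\<eta> w))) y"
    using u0 by blast
  obtain u where u: "\<And>t. 0 \<le> t \<Longrightarrow> u t \<in> D" "\<And>t. 0 \<le> t \<Longrightarrow> A (u t) = act \<eta> (u t) -\<^sub>S W t y"
    "\<And>t. 0 \<le> t \<Longrightarrow> has_deriv u (A (u t)) t {0..}" "\<And>L. Lip u {0..L}"
    "\<And>t. 0 \<le> t \<Longrightarrow> W t (u 0) = C (u t)"
    by (rule solution_exists[OF y(1)], rule that)
  note uS = genD(1,2)[OF u(1)]
  \<comment> \<open>The formula for \<open>A (u t)\<close> at time 0, where \<open>W 0 y\<close> is
    \<open>C y\<close>.\<close>
  have "act \<eta> (u 0) -\<^sub>S A (u 0) = C y"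
  proof -
    have "act \<eta> (u 0) -\<^sub>S (act \<eta> (u 0) -\<^sub>S C y) = (act \<eta> (u 0) -\<^sub>S 0\<^sub>S) -\<^sub>S (act \<eta> (u 0) -\<^sub>S C y)"
      using uS[of 0] y by (simp add: minus_zero_right)
    also have "\<dots> = 0\<^sub>S -\<^sub>S (0\<^sub>S -\<^sub>S C y)"
      using uS[of 0] y by (subst minus_minus_minus) (simp_all add: minus_self)
    also have "\<dots> = C y" using y by (simp add: M.minus_eq)
    finally show ?thesis using u(2)[of 0] y by (simp add: W_0)
  qed
  then have u_0: "u 0 = u0" using resolvent_eq[OF u(1)[of 0] _ refl] y by simp
  have u_conv: "conv u (u t) (at t within {0..})" if t: "0 \<le> t" for t
  proof -
    \<comment> \<open>Lipschitz bounds hold on bounded intervals; near \<open>t\<close> the interval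
      \<open>[0, t + 1]\<close> gives the same limits as the half-line.\<close>
    have "conv u (u t) (at t within {0..t + 1})"
      by (rule Lip_imp_conv[OF u(4)]) (use t in simp)
    moreover have "at t within {0..} = at t within {0..t + 1}"
      by (rule at_within_nhd[of t "{..<t + 1}"]) auto
    ultimately show ?thesis by simp
  qed
  \<comment> \<open>Continuity of \<open>A u\<close>, and with it continuity into the graph module,
    comes from the explicit formula for \<open>A (u t)\<close>, whose terms are visibly
    continuous.\<close>
  have Au_conv: "conv (\<lambda>s. A (u s)) (A (u t)) (at t within {0..})" if t: "0 \<le> t" for t
  proof (rule conv_cong)
    show "conv (\<lambda>s. act \<eta> (u s) -\<^sub>S W s y) (A (u t)) (at t within {0..})"
      unfolding u(2)[OF t] by (rule conv_minus[OF conv_act[OF u_conv[OF t]] W_conv[OF y(1) t]]) simp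
    show "eventually (\<lambda>s. A (u s) = act \<eta> (u s) -\<^sub>S W s y) (at t within {0..})"
      by (rule eventually_within) (use u(2) in simp)
  qed
  have gen_closed: "x \<in> carrier S \<and> A x \<in> carrier S" if "x \<in> D" for x using genD(1,2)[OF that] by simp
  have "u \<in> C0_fun P (graph_module P S D A)"
    by (rule C0_fun_graphI[OF gen_closed gen_add gen_minus u(1) u_conv Au_conv])
  moreover have "u \<in> C1_fun P S"
    unfolding C1_fun_def mem_Collect_eq
  proof (intro conjI bexI[of _ "\<lambda>t. A (u t)"] allI impI)
    show "u \<in> C0_fun P S" "(\<lambda>t. A (u t)) \<in> C0_fun P S" using u_conv Au_conv by (simp_all add: C0_fun_iff)
    show "has_el_derivative P S u (A (u t)) t" if "0 \<le> t" for t
      using u(3)[OF that] by (simp add: has_el_derivative_iff)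
  qed
  ultimately have sol: "ACP_solution P S D A u0 u"
    using u u_0 Lip_imp_locally_L0_Lipschitz by (simp add: ACP_solution_def has_el_derivative_iff)
  have Wu0: "W t u0 = C (u t)" if "0 \<le> t" for t using u(5)[OF that] u_0 by simp
  have unique: "v t = u t" if v: "ACP_solution P S D A u0 v" and t: "0 \<le> t" for v t
  proof -
    have vD: "v s \<in> D" if "0 \<le> s" for s
      using C0_fun_graph_closed[OF gen_closed _ that] v unfolding ACP_solution_def by blast
    have vS: "v s \<in> carrier S" if "0 \<le> s" for s by (rule genD(1)[OF vD[OF that]])
    have "locally_L0_Lipschitz P S v" using v by (simp add: ACP_solution_def)
    from locally_L0_Lipschitz_imp_Lip[OF this vS, of "t + 1"] have "Lip v {0..t + 1}" using t by simp
    then have "Lip v {0..t}" by (rule Lip_subset) auto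
    then have "C (v t) = W t (v 0)"
    proof (rule solution_unique[OF t])
      fix s assume s: "s \<in> {0<..<t}"
      then show "v s \<in> D" using vD by simp
      have "has_deriv v (A (v s)) s {0..}" using v s by (simp add: ACP_solution_def has_el_derivative_iff)
      then show "has_deriv v (A (v s)) s {0..t}" by (rule has_deriv_subset) auto
    qed
    also have "v 0 = u0" using v by (simp add: ACP_solution_def)
    finally show ?thesis using Wu0[OF t] V.C_eq_iff[OF vS[OF t] uS(1)[OF t]] by simp
  qed
  have "u t = op_inv S C (W t u0)" "W t u0 \<in> C ` carrier S" if "0 \<le> t" for t
    using Wu0[OF that] uS[OF that] the_inv_into_f_f[OF C_inj uS(1)[OF that]] by simp_all
  moreover have "u t = W t (op_inv S C u0)" if t: "0 \<le> t" and C0: "u0 \<in> C ` carrier S" for t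
  proof -
    obtain x where x: "x \<in> carrier S" "u0 = C x" using C0 by blast
    have "C (W t x) = C (u t)" using W_C[OF t x(1)] Wu0[OF t] x(2) by simp
    then have "u t = W t x" using V.C_eq_iff[of "W t x" "u t"] uS[OF t] t x by simp
    then show ?thesis using x the_inv_into_f_f[OF C_inj x(1)] by simp
  qed
  ultimately show ?thesis using sol unique by blast
qed

end

theorem theorem5p1:
  fixes P :: "'w measure"
    and S :: "('w, 'k::{real_normed_field, second_countable_topology}, 's) rn_module"
    and C :: "'s \<Rightarrow> 's" and W :: "real \<Rightarrow> 's \<Rightarrow> 's"
    and M \<xi> \<eta> :: "('w \<Rightarrow> real) set" and u0 :: 's
  defines "A \<equiv> generator P S C W" and "D \<equiv> gen_dom P S C W"
  assumes "random_normed_module P S"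
    and "el_complete P S"
    and "C \<in> bounded_ops P S" and "inj_on C (carrier S)"
    and "C_semigroup P S C W"
    and "M \<in> L0_plus P" and "\<xi> \<in> carrier (L0 P)"
    and "\<And>s. 0 \<le> s \<Longrightarrow>
      L0_le P (op_L0norm P S (W s)) (M \<otimes>\<^bsub>L0 P\<^esub> L0_map P exp (\<xi> \<otimes>\<^bsub>L0 P\<^esub> L0_const P s))"
    and "\<eta> \<in> L0_above P \<xi>"
    and "u0 \<in> C_resolvent S C D A (L0_map P of_real \<eta>) ` carrier S"
  shows "\<exists>u. ACP_solution P S D A u0 u \<and>
      (\<forall>v. ACP_solution P S D A u0 v \<longrightarrow> (\<forall>t\<ge>0. v t = u t)) \<and>
      (\<forall>t\<ge>0. W t u0 \<in> C ` carrier S \<and> u t = op_inv S C (W t u0)) \<and>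
      (u0 \<in> C ` carrier S \<longrightarrow> (\<forall>t\<ge>0. u t = W t (op_inv S C u0)))"
proof -
  interpret random_normed_module P S by fact
  define m x e where "m = L0_rep M" and "x = L0_rep \<xi>" and "e = L0_rep \<eta>"
  have M: "M \<in> carrier (L0 P)" "AE w in P. 0 \<le> m w"
    using \<open>M \<in> L0_plus P\<close> by (simp_all add: L0_plus_iff m_def)
  have \<eta>: "\<eta> \<in> carrier (L0 P)" "AE w in P. x w < e w"
    using \<open>\<eta> \<in> L0_above P \<xi>\<close> by (simp_all add: L0_above_def x_def e_def)
  have meas[measurable]: "m \<in> borel_measurable P" "x \<in> borel_measurable P" "e \<in> borel_measurable P"
    unfolding m_def x_def e_def using M \<eta> \<open>\<xi> \<in> carrier (L0 P)\<close> by (simp_all add: L0_class_rep(1))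
  obtain c where c: "bdd_additive c C" using bounded_opsD(1)[OF \<open>C \<in> bounded_ops P S\<close>] by blast
  have sg: "\<And>t. 0 \<le> t \<Longrightarrow> W t \<in> bounded_ops P S" "\<And>z. z \<in> carrier S \<Longrightarrow> W 0 z = C z"
    "\<And>s t z. 0 \<le> s \<Longrightarrow> 0 \<le> t \<Longrightarrow> z \<in> carrier S \<Longrightarrow> C (W (s + t) z) = W t (W s z)"
    "\<And>z. z \<in> carrier S \<Longrightarrow> continuous_map (top_of_set {0..}) (el_topology P S) (\<lambda>s. W s z)"
    using \<open>C_semigroup P S C W\<close> unfolding C_semigroup_def by simp_all
  \<comment> \<open>The growth hypothesis concerns the infimum \<open>op_L0norm\<close>; it becomes
    a bound on each \<open>W t z\<close> because that infimum is itself a bound of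
    \<open>W t\<close>.\<close>
  have W_bdd: "bdd_additive (\<lambda>w. m w * exp (x w * t)) (W t)" if t: "0 \<le> t" for t
  proof -
    obtain b where b: "bdd_additive b (W t)" using bounded_opsD(1)[OF sg(1)[OF t]] by blast
    have "\<xi> \<otimes>\<^bsub>L0 P\<^esub> L0_const P t = L0_class P (\<lambda>w. x w * t)"
    proof -
      have "\<xi> = L0_class P x" unfolding x_def using L0_class_rep(2)[OF \<open>\<xi> \<in> carrier (L0 P)\<close>] by simp
      then show ?thesis by (simp add: L0_const_def L0_mult_class)
    qed
    then have "L0_map P exp (\<xi> \<otimes>\<^bsub>L0 P\<^esub> L0_const P t) = L0_class P (\<lambda>w. exp (x w * t))"
      using L0_rep_class(2)[of "\<lambda>w. x w * t" P] by (simp add: L0_map_def) (rule L0_class_cong, auto)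
    moreover have "M = L0_class P m" unfolding m_def using L0_class_rep(2)[OF M(1)] by simp
    ultimately have "M \<otimes>\<^bsub>L0 P\<^esub> L0_map P exp (\<xi> \<otimes>\<^bsub>L0 P\<^esub> L0_const P t) = L0_class P (\<lambda>w. m w * exp (x w * t))"
      by (simp add: L0_mult_class)
    with assms(10)[OF t] L0_rep_class(2)[of "\<lambda>w. m w * exp (x w * t)" P]
    have le: "AE w in P. L0_rep (op_L0norm P S (W t)) w \<le> m w * exp (x w * t)"
      by (auto simp: L0_le_def)
    show ?thesis
      unfolding bdd_additive_def
    proof (intro conjI ballI)
      fix z assume z: "z \<in> carrier S"
      show "W t z \<in> carrier S" by (rule bdd_additiveD(2)[OF b z])
      show "AE w in P. nrm (W t z) w \<le> m w * exp (x w * t) * nrm z w"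
        using bounded_opsD(3)[OF sg(1)[OF t] z] le nrm_nonneg[OF z]
        by eventually_elim (meson mult_right_mono order_trans)
      fix z' assume "z' \<in> carrier S"
      then show "W t (z \<oplus>\<^bsub>S\<^esub> z') = W t z \<oplus>\<^bsub>S\<^esub> W t z'" by (rule bdd_additiveD(3)[OF b z])
    qed simp
  qed
  interpret exp_bounded_semigroup P S C W c m x e
  proof
    show "conv (\<lambda>s. W s z) (W t z) (at t within {0..})" if "z \<in> carrier S" "0 \<le> t" for z t
      using sg(4)[OF that(1)] that(2) by (simp add: continuous_map_Ici_iff limitin_iff)
    show "W t (act h z) = act h (W t z)" if "0 \<le> t" "h \<in> borel_measurable P" "z \<in> carrier S" for t h z
      by (rule bounded_opsD(2)[OF sg(1)[OF that(1)] that(2,3)])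
    show "C (act h z) = act h (C z)" if "h \<in> borel_measurable P" "z \<in> carrier S" for h z
      by (rule bounded_opsD(2)[OF \<open>C \<in> bounded_ops P S\<close> that])
  qed (fact assms(4) c assms(6) W_bdd sg(2) sg(3) meas M(2) \<eta>(2))+
  have "L0_map P of_real \<eta> = L0_class P (\<lambda>w. of_real (e w) :: 'k)" by (simp add: L0_map_def e_def)
  then show ?thesis using ACP_well_posed assms(12) unfolding A_def D_def by simp
qed

end
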